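(* Assume the null hypothesis $\lambda_0=0$ and Assumptions 1, 2 and 3 (all stated in the context). Then, as $n\to\infty$, the penalized maximum likelihood estimator $(\hat\theta^*,\hat\gamma^* )$ satisfies $\hat\theta^*\to_p\theta_0$ and $$\|\hat\gamma^*\|_1=o_p\left(n^{-1/4}(\log d\,\log n)^{-1/2}\right).$$
   Context: Model. For each $n$, $\{(Y_i,X_i,D_i,Z_i,\varepsilon_i,\delta_i)\}_{i=1}^n$ are i.i.d. copies of $(Y,X,D,Z,\varepsilon,\delta)$ with $$Y_i=X_i'\alpha_0+D_i(\beta_0+\delta_i\lambda_0)+\varepsilon_i,\qquad \mathbb P(\delta_i=1\mid X_i,Z_i)=\pi(Z_i'\gamma_0),\qquad \mathbb P(\delta_i=0\mid X_i,Z_i)=1-\pi(Z_i'\gamma_0),$$ where $\pi(x)=e^x/(1+e^x)$, $Y_i\in\mathbb R$, $D_i\in\mathbb R$, $X_i\in\mathbb R^q$ with $q$ fixed, $Z_i=(Z_{(1),i},\dots,Z_{(d),i})'\in\mathbb R^{d}$ with $d=d_n$ allowed to depend on $n$, $\delta_i\in\{0,1\}$ is latent, and $\varepsilon_i\sim N(0,\sigma_0^2)$ is an independent error term. The observables are $(Y_i,X_i,D_i,Z_i)$. Write $W_i=(X_i',D_i,Z_i')'$ and $U_i=(X_i',D_i)'$. Throughout $n\wedge d\ge 2$; limits are as $n\to\infty$. Under the null hypothesis $\lambda_0=0$ the parameter $\gamma$ is not identified. $\theta=(\alpha',\beta,\lambda,\sigma^2)'$; the subscript $0$ denotes true values, $\theta_0=(\alpha_0',\beta_0,\lambda_0,\sigma_0^2)'$.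 Likelihood. With $\phi_\sigma$ the density of $N(0,\sigma^2)$, $$f(Y_i|W_i;\theta,\gamma)=\pi(Z_i'\gamma)\phi_\sigma(Y_i-X_i'\alpha-D_i(\beta+\lambda))+(1-\pi(Z_i'\gamma))\phi_\sigma(Y_i-X_i'\alpha-D_i\beta),$$ $l_n(\theta,\gamma)=\sum_{i=1}^n\log f(Y_i|W_i;\theta,\gamma)$ and $l_n^*(\theta,\gamma)=l_n(\theta,\gamma)-p\|\gamma\|_1$, where $\|\gamma\|_1=\sum_{j=1}^d|\gamma_j|$ and $p=p_n>0$ is a tuning parameter with $p_n/n\to0$. The estimator is $(\hat\theta^*,\hat\gamma^* )=\arg\max_{\theta\in\Theta,\gamma\in\Gamma}l_n^*(\theta,\gamma)$, with $\Theta=\Theta^\alpha\times\Theta^\beta\times\Theta^\lambda\times\Theta^{\sigma^2}$. Assumption 1. (a) $\Theta^\alpha$ and $\Theta^\beta$ are compact convex sets; (b) $\Theta^{\sigma^2}=(0,\infty)$; (c) $\Theta^\lambda=[0,u_\lambda]$ for some $0<u_\lambda<\infty$; (d) $\Gamma=\mathbb R^d$; (e) $(\alpha_0',\beta_0)'$ lies in the interior of $\Theta^\alpha\times\Theta^\beta$. Assumption 2. (a) $\mathbb E[\|U\|^{10}]<\infty$; (b) $\mathbb E[UU']$ is positive definite; (c) $Z$ is uniformly sub-Gaussian: there are finite $K,C>0$, independent of $n$ and $j$, with $\mathbb P(|Z_{(j)}|>t)\le Ke^{-Ct^2}$ for all $0<t<\infty$ and $1\le j\le d$; (d) $D$ is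 bounded and $\mathrm{Var}(D)>0$. Assumption 3. (a) $n^{7/4}\sqrt{\log n}\,\log d/p^2=o(1)$; (b) $\log d=o(n^{1/4})$. *)

theory Defs
  imports "HOL-Probability.Probability" "HOL-Library.Landau_Symbols"
begin

text \<open>
  Vectors in \<open>R^d\<close> with \<open>d = d n\<close> varying are functions on \<^typ>\<open>nat\<close> that are
  extensional on \<open>{..<d}\<close>; their Borel structure is the finite product sigma-algebra.
\<close>

definition Rvec :: "nat \<Rightarrow> (nat \<Rightarrow> real) set" where
  "Rvec d = (\<Pi>\<^sub>E j\<in>{..<d}. UNIV)"

definition Rvec_borel :: "nat \<Rightarrow> (nat \<Rightarrow> real) measure" where
  "Rvec_borel d = (\<Pi>\<^sub>M j\<in>{..<d}. borel)"

definition l1norm :: "nat \<Rightarrow> (nat \<Rightarrow> real) \<Rightarrow> real" where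
  "l1norm d g = (\<Sum>j<d. \<bar>g j\<bar>)"

definition dotp :: "nat \<Rightarrow> (nat \<Rightarrow> real) \<Rightarrow> (nat \<Rightarrow> real) \<Rightarrow> real" where
  "dotp d z g = (\<Sum>j<d. z j * g j)"

text \<open>An observation is a tuple \<open>(Y, X, D, Z, \<epsilon>, \<delta>)\<close>; \<open>\<delta> = 1\<close> is encoded as \<^term>\<open>True\<close>.\<close>

type_synonym 'q obs = "real \<times> (real^'q) \<times> real \<times> (nat \<Rightarrow> real) \<times> real \<times> bool"

definition obs_space :: "nat \<Rightarrow> ('q::finite) obs measure" where
  "obs_space d =
     borel \<Otimes>\<^sub>M borel \<Otimes>\<^sub>M borel \<Otimes>\<^sub>M Rvec_borel d \<Otimes>\<^sub>M borel \<Otimes>\<^sub>M count_space UNIV"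

definition obs_Y :: "('q::finite) obs \<Rightarrow> real" where
  "obs_Y = (\<lambda>(y, x, d, z, e, b). y)"
definition obs_X :: "('q::finite) obs \<Rightarrow> real^'q" where
  "obs_X = (\<lambda>(y, x, d, z, e, b). x)"
definition obs_D :: "('q::finite) obs \<Rightarrow> real" where
  "obs_D = (\<lambda>(y, x, d, z, e, b). d)"
definition obs_Z :: "('q::finite) obs \<Rightarrow> nat \<Rightarrow> real" where
  "obs_Z = (\<lambda>(y, x, d, z, e, b). z)"
definition obs_eps :: "('q::finite) obs \<Rightarrow> real" where
  "obs_eps = (\<lambda>(y, x, d, z, e, b). e)"
definition obs_delta :: "('q::finite) obs \<Rightarrow> bool" where
  "obs_delta = (\<lambda>(y, x, d, z, e, b). b)"

text \<open>\<open>U = (X', D)'\<close>; the index \<^term>\<open>Inr ()\<close> is the coordinate of \<open>D\<close>.\<close>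

definition obs_U :: "('q::finite) obs \<Rightarrow> real^('q + unit)" where
  "obs_U v = (\<chi> k. case k of Inl i \<Rightarrow> obs_X v $ i | Inr _ \<Rightarrow> obs_D v)"

definition logistic :: "real \<Rightarrow> real" where
  "logistic x = exp x / (1 + exp x)"

text \<open>
  \<open>Q\<close> is the joint law of the generic \<open>(Y, X, D, Z, \<epsilon>, \<delta>)\<close> when \<open>Z\<close> has dimension \<open>d\<close>.
  \<open>sigsq0\<close> is the true variance. \<open>P(\<delta> = \<cdot> | X, Z)\<close> is taken given the sigma-algebra generated by \<open>(X, Z)\<close>;
  independence of \<open>\<epsilon>\<close> and \<open>(X, D, Z, \<delta>)\<close> is stated with generated sigma-algebras because the
  library notion for two random variables requires equal value types.
\<close>

definition regime_model ::
  "nat \<Rightarrow> real^'q \<Rightarrow> real \<Rightarrow> real \<Rightarrow> real \<Rightarrow> (nat \<Rightarrow> real) \<Rightarrow> ('q::finite) obs measure \<Rightarrow> bool" where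
  "regime_model d alpha0 beta0 lambda0 sigsq0 gamma0 Q \<longleftrightarrow>
     prob_space Q \<and> sets Q = sets (obs_space d) \<and>
     (AE v in Q. obs_Y v =
        obs_X v \<bullet> alpha0 + obs_D v * (beta0 + of_bool (obs_delta v) * lambda0) + obs_eps v) \<and>
     (let F = vimage_algebra (space Q) (\<lambda>v. (obs_X v, obs_Z v)) (borel \<Otimes>\<^sub>M Rvec_borel d) in
       (AE v in Q. real_cond_exp Q F (\<lambda>v. of_bool (obs_delta v)) v
          = logistic (dotp d (obs_Z v) gamma0)) \<and>
       (AE v in Q. real_cond_exp Q F (\<lambda>v. of_bool (\<not> obs_delta v)) v
          = 1 - logistic (dotp d (obs_Z v) gamma0))) \<and>
     distributed Q lborel obs_eps (\<lambda>x. ennreal (normal_density 0 (sqrt sigsq0) x)) \<and>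
     prob_space.indep_set Q
       (sets (vimage_algebra (space Q) obs_eps borel))
       (sets (vimage_algebra (space Q) (\<lambda>v. (obs_X v, obs_D v, obs_Z v, obs_delta v))
          (borel \<Otimes>\<^sub>M borel \<Otimes>\<^sub>M Rvec_borel d \<Otimes>\<^sub>M count_space UNIV)))"

definition iid_sample ::
  "nat \<Rightarrow> 'a measure \<Rightarrow> 'b measure \<Rightarrow> (nat \<Rightarrow> 'a \<Rightarrow> 'b) \<Rightarrow> bool" where
  "iid_sample n M Q V \<longleftrightarrow>
     prob_space M \<and> prob_space.indep_vars M (\<lambda>_. Q) V {..<n} \<and> (\<forall>i<n. distr M Q (V i) = Q)"

text \<open>Parameters are \<open>\<theta> = (\<alpha>, \<beta>, lam, \<sigma>\<^sup>2)\<close>: the last entry is the variance.\<close>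

type_synonym 'q param = "(real^'q) \<times> real \<times> real \<times> real"

definition param_space :: "(real^'q) set \<Rightarrow> real set \<Rightarrow> real \<Rightarrow> ('q::finite) param set" where
  "param_space A B u = A \<times> B \<times> {0..u} \<times> {0<..}"

definition mix_density ::
  "nat \<Rightarrow> ('q::finite) param \<Rightarrow> (nat \<Rightarrow> real) \<Rightarrow> 'q obs \<Rightarrow> real" where
  "mix_density d = (\<lambda>(\<alpha>, \<beta>, lam, s) \<gamma> v.
     logistic (dotp d (obs_Z v) \<gamma>) *
       normal_density 0 (sqrt s) (obs_Y v - obs_X v \<bullet> \<alpha> - obs_D v * (\<beta> + lam)) +
     (1 - logistic (dotp d (obs_Z v) \<gamma>)) *
       normal_density 0 (sqrt s) (obs_Y v - obs_X v \<bullet> \<alpha> - obs_D v * \<beta>))"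

definition loglik ::
  "nat \<Rightarrow> nat \<Rightarrow> (nat \<Rightarrow> ('q::finite) obs) \<Rightarrow> 'q param \<Rightarrow> (nat \<Rightarrow> real) \<Rightarrow> real" where
  "loglik n d v \<theta> \<gamma> = (\<Sum>i<n. ln (mix_density d \<theta> \<gamma> (v i)))"

definition pen_loglik ::
  "nat \<Rightarrow> nat \<Rightarrow> real \<Rightarrow> (nat \<Rightarrow> ('q::finite) obs) \<Rightarrow> 'q param \<Rightarrow> (nat \<Rightarrow> real) \<Rightarrow> real" where
  "pen_loglik n d p v \<theta> \<gamma> = loglik n d v \<theta> \<gamma> - p * l1norm d \<gamma>"

definition is_pen_mle ::
  "nat \<Rightarrow> nat \<Rightarrow> real \<Rightarrow> ('q::finite) param set \<Rightarrow> (nat \<Rightarrow> 'q obs) \<Rightarrow> 'q param \<Rightarrow> (nat \<Rightarrow> real) \<Rightarrow> bool"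
  where
  "is_pen_mle n d p \<Theta> v \<theta> \<gamma> \<longleftrightarrow>
     is_arg_max (\<lambda>(t, g). pen_loglik n d p v t g) (\<lambda>(t, g). t \<in> \<Theta> \<and> g \<in> Rvec d) (\<theta>, \<gamma>)"

definition pos_definite :: "real^'n^'n \<Rightarrow> bool" where
  "pos_definite A \<longleftrightarrow> transpose A = A \<and> (\<forall>c. c \<noteq> 0 \<longrightarrow> 0 < c \<bullet> (A *v c))"

definition second_moment :: "'a measure \<Rightarrow> ('a \<Rightarrow> real^'n) \<Rightarrow> real^'n^'n" where
  "second_moment Q U = (\<chi> i j. \<integral>v. U v $ i * U v $ j \<partial>Q)"

text \<open>
  Convergence in probability, for random elements that for each \<open>n\<close> may live on their own
  probability space \<open>M n\<close>.
\<close>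

definition converges_in_prob ::
  "(nat \<Rightarrow> 'a measure) \<Rightarrow> (nat \<Rightarrow> 'a \<Rightarrow> 'b::metric_space) \<Rightarrow> 'b \<Rightarrow> bool" where
  "converges_in_prob M T c \<longleftrightarrow>
     (\<forall>e>0. (\<lambda>n. measure (M n) {\<omega> \<in> space (M n). dist (T n \<omega>) c > e}) \<longlonglongrightarrow> 0)"

definition small_o_p ::
  "(nat \<Rightarrow> 'a measure) \<Rightarrow> (nat \<Rightarrow> 'a \<Rightarrow> real) \<Rightarrow> (nat \<Rightarrow> real) \<Rightarrow> bool" where
  "small_o_p M T r \<longleftrightarrow> converges_in_prob M (\<lambda>n \<omega>. T n \<omega> / r n) 0"

end

theory Submission
  imports Defs "HOL-Real_Asymp.Real_Asymp"
begin

text \<open>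
  Under the null the conditional law of \<open>Y\<close> is the normal law \<open>f\<^sub>0\<close>, and for every fixed
  \<open>(\<theta>, \<gamma>)\<close> the ratio \<open>f / f\<^sub>0\<close> has mean one. Hence the square root of the likelihood ratio has mean
  at most one over the whole sample, and Markov's inequality with a union bound gives, for a finite
  set \<open>S\<close> of parameters, \<open>max (l\<^sub>n - l\<^sub>n(\<theta>\<^sub>0)) \<le> 2 ln (n \<cdot> card S)\<close> over \<open>S\<close> with probability at least
  \<open>1 - 1/n\<close> (\<open>iid_product_tail\<close>, \<open>nn_integral_root_lr_le_1\<close>, \<open>whp_net_likelihood\<close>). Neither
  symmetrization nor chaining enters; everything rests on a good choice of \<open>S\<close>.

  The parameter \<open>\<theta>\<close> lies, with high probability, in a bounded set with \<open>\<sigma>\<^sup>2\<close> bounded away from zero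
  (\<open>whp_param_bounds\<close>): a tiny \<open>\<sigma>\<^sup>2\<close> pays off only if many residuals are tiny, and anti-concentration
  of the normal noise excludes this uniformly in the regression coefficients
  (\<open>whp_few_small_residuals\<close>). A grid with mesh \<open>n\<^sup>-\<^sup>3\<close> then has polynomially many points.

  For \<open>\<gamma>\<close>, the logarithm of the mixture density is \<open>1\<close>-Lipschitz in \<open>Z'\<gamma>\<close>, because changing the logit
  by \<open>h\<close> changes both mixture weights by a factor of at most \<open>exp \<bar>h\<bar>\<close>. A vector of \<open>l\<^sub>1\<close>-norm at most \<open>R\<close>
  is approximated by \<open>R/m\<close> times a sum of \<open>m\<close> signed unit vectors with total error
  \<open>n R K / \<surd>m\<close>, where \<open>K\<close> bounds the covariates (\<open>sparse_approximation\<close>, a greedy form of Maurey's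
  argument). With \<open>K\<^sup>2\<close> of order \<open>ln n + ln d\<close> and \<open>m\<close> of order \<open>n\<^sup>2 K\<^sup>2 / p\<^sup>2\<close> this error is at most half the
  penalty \<open>p R\<close>, so the other half is bounded by the logarithm of the number of net points, which is of order
  \<open>ln n + m ln d\<close> (\<open>whp_l1_bound\<close>). Under the rate conditions this is \<open>O(n\<^sup>1\<^sup>/\<^sup>2)\<close>, and dividing by
  \<open>p\<close> gives the claimed rate (\<open>penalty_rate_tendsto_0\<close>).

  For consistency, the rate makes \<open>Z'\<gamma>\<close> uniformly negligible, so \<open>\<theta>\<close> nearly maximizes the likelihood
  with weights \<open>1/2\<close>. There \<open>\<theta>\<^sub>0\<close> is identified: a balanced mixture of two normals with equal variance
  is a centred normal only if both means vanish (\<open>mix_half_identifiable\<close>). By compactness the expected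
  root likelihood ratio is at most some \<open>\<rho> < 1\<close> away from \<open>\<theta>\<^sub>0\<close> (\<open>affinity_gap\<close>), uniformly in \<open>n\<close>
  because the law of \<open>(U, \<epsilon>)\<close> is fixed, and the polynomial grid cannot offset the
  factor \<open>\<rho>\<^sup>n\<close> (\<open>whp_theta_near\<close>).
\<close>

section \<open>Grids and sparse approximation of linear predictors\<close>

lemma finite_grid_cover:
  fixes L \<eta> :: real
  assumes "0 \<le> L" "0 < \<eta>"
  obtains T :: "'a::euclidean_space set" where "finite T"
    "real (card T) \<le> (2 * L / \<eta> + 3) ^ DIM('a)"
    "\<And>x. norm x \<le> L \<Longrightarrow> \<exists>t\<in>T. dist x t \<le> DIM('a) * \<eta>"
proof -
  define K where "K = \<lceil>L / \<eta>\<rceil>"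
  have K0: "0 \<le> K" using assms divide_nonneg_pos[of L \<eta>] unfolding K_def by linarith
  define T :: "'a set" where
    "T = (\<lambda>k. \<Sum>b\<in>Basis. (\<eta> * of_int (k b)) *\<^sub>R b) ` (Basis \<rightarrow>\<^sub>E {-K..K})"
  have fin: "finite (Basis \<rightarrow>\<^sub>E {-K..K} :: ('a \<Rightarrow> int) set)"
    by (intro finite_PiE) auto
  show thesis
  proof
    show "finite T" unfolding T_def using fin by blast
    have "card T \<le> card (Basis \<rightarrow>\<^sub>E {-K..K} :: ('a \<Rightarrow> int) set)"
      unfolding T_def by (rule card_image_le[OF fin])
    also have "\<dots> = nat (2 * K + 1) ^ DIM('a)"
      using K0 by (subst card_PiE) (auto simp: algebra_simps)
    finally have "real (card T) \<le> real (nat (2 * K + 1)) ^ DIM('a)"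
      by (metis of_nat_le_iff of_nat_power)
    also have "\<dots> \<le> (2 * L / \<eta> + 3) ^ DIM('a)"
    proof (rule power_mono)
      have "of_int K \<le> L / \<eta> + 1" unfolding K_def by linarith
      thus "real (nat (2 * K + 1)) \<le> 2 * L / \<eta> + 3" using K0 by simp
    qed simp
    finally show "real (card T) \<le> (2 * L / \<eta> + 3) ^ DIM('a)" .
    fix x :: 'a assume x: "norm x \<le> L"
    define k where "k = (\<lambda>b\<in>Basis. \<lfloor>(x \<bullet> b) / \<eta>\<rfloor>)"
    define t where "t = (\<Sum>b\<in>Basis. (\<eta> * of_int (k b)) *\<^sub>R b)"
    have kK: "k b \<in> {-K..K}" if b: "b \<in> Basis" for b
    proof -
      have "\<bar>x \<bullet> b\<bar> \<le> L" using Basis_le_norm[OF b, of x] x by linarith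
      hence "- (L / \<eta>) \<le> (x \<bullet> b) / \<eta>" "(x \<bullet> b) / \<eta> \<le> L / \<eta>"
        using assms(2) by (auto simp: field_simps abs_le_iff)
      thus ?thesis using b unfolding k_def K_def
        by (simp add: le_floor_iff floor_le_iff) linarith
    qed
    have "k \<in> Basis \<rightarrow>\<^sub>E {-K..K}" using kK by (auto simp: k_def)
    hence "t \<in> T" unfolding T_def t_def by blast
    moreover have "dist x t \<le> DIM('a) * \<eta>"
    proof -
      have "dist x t \<le> (\<Sum>b\<in>Basis. \<bar>(x - t) \<bullet> b\<bar>)"
        unfolding dist_norm by (rule norm_le_l1)
      also have "\<dots> \<le> (\<Sum>b\<in>(Basis::'a set). \<eta>)"
      proof (rule sum_mono)
        fix b :: 'a assume b: "b \<in> Basis"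
        have "t \<bullet> b = \<eta> * of_int (k b)"
          unfolding t_def using b by (simp add: inner_sum_left_Basis)
        moreover have "k b = \<lfloor>(x \<bullet> b) / \<eta>\<rfloor>" using b by (simp add: k_def)
        moreover have "\<bar>(x \<bullet> b) / \<eta> - of_int \<lfloor>(x \<bullet> b) / \<eta>\<rfloor>\<bar> \<le> 1" by linarith
        hence "\<eta> * \<bar>(x \<bullet> b) / \<eta> - of_int \<lfloor>(x \<bullet> b) / \<eta>\<rfloor>\<bar> \<le> \<eta>"
          using assms(2) by simp
        moreover have "\<eta> * \<bar>(x \<bullet> b) / \<eta> - of_int \<lfloor>(x \<bullet> b) / \<eta>\<rfloor>\<bar>
            = \<bar>x \<bullet> b - \<eta> * of_int \<lfloor>(x \<bullet> b) / \<eta>\<rfloor>\<bar>"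
        proof -
          have "\<eta> * \<bar>(x \<bullet> b) / \<eta> - of_int \<lfloor>(x \<bullet> b) / \<eta>\<rfloor>\<bar>
              = \<bar>\<eta> * ((x \<bullet> b) / \<eta> - of_int \<lfloor>(x \<bullet> b) / \<eta>\<rfloor>)\<bar>"
            using assms(2) by (simp add: abs_mult)
          also have "\<eta> * ((x \<bullet> b) / \<eta> - of_int \<lfloor>(x \<bullet> b) / \<eta>\<rfloor>)
              = x \<bullet> b - \<eta> * of_int \<lfloor>(x \<bullet> b) / \<eta>\<rfloor>"
            using assms(2) by (simp add: right_diff_distrib)
          finally show ?thesis .
        qed
        ultimately show "\<bar>(x - t) \<bullet> b\<bar> \<le> \<eta>" by (simp add: inner_diff_left)
      qed
      finally show ?thesis by simp
    qed
    ultimately show "\<exists>t\<in>T. dist x t \<le> DIM('a) * \<eta>" by blast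
  qed
qed

text \<open>
  The sums of \<open>m\<close> vectors from \<open>{0, \<plusminus>e\<^sub>1, \<dots>, \<plusminus>e\<^sub>d}\<close>. The zero vector is among the atoms so that
  any vector of \<open>l\<^sub>1\<close>-norm at most one is a convex combination of atoms.
\<close>

primrec signed_sums :: "nat \<Rightarrow> nat \<Rightarrow> (nat \<Rightarrow> real) set" where
  "signed_sums d 0 = {\<lambda>_. 0}"
| "signed_sums d (Suc m) =
     (\<lambda>(g, j, r). \<lambda>i. g i + (if i = j then r else 0)) ` (signed_sums d m \<times> {..<d} \<times> {-1, 0, 1})"

lemma finite_signed_sums: "finite (signed_sums d m)"
  by (induction m) auto

lemma card_signed_sums: "card (signed_sums d m) \<le> (3 * d) ^ m"
proof (induction m)
  case (Suc m)
  have "card (signed_sums d (Suc m)) \<le> card (signed_sums d m \<times> {..<d} \<times> {-1, 0, 1::real})"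
    unfolding signed_sums.simps by (rule card_image_le) (auto simp: finite_signed_sums)
  also have "\<dots> = card (signed_sums d m) * (d * 3)"
    by (simp add: card_cartesian_product)
  also have "\<dots> \<le> (3 * d) ^ m * (d * 3)" using Suc by (rule mult_right_mono) simp
  finally show ?case by (simp add: mult_ac)
qed simp

lemma dotp_add_single:
  "j < d \<Longrightarrow> dotp d z (\<lambda>i. g i + (if i = j then r else 0)) = dotp d z g + r * z j"
  unfolding dotp_def
  by (simp add: distrib_left sum.distrib if_distrib[of "\<lambda>x. _ * x"] cong: if_cong)

lemma dotp_scale: "dotp d z (\<lambda>j. r * g j) = r * dotp d z g"
  unfolding dotp_def by (simp add: sum_distrib_left mult_ac)

text \<open>
  Averaging over the atoms: choose \<open>r e\<^sub>j\<close> with weight \<open>\<bar>c\<^sub>j\<bar>\<close> and \<open>r = sgn c\<^sub>j\<close>, and the zero atom with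
  the remaining weight. The chosen linear predictors then have mean \<open>Z'c\<close>, so the cross terms
  with \<open>E\<close> cancel on average and the mean square grows by at most \<open>n K\<^sup>2\<close>; some atom does no worse
  than the average.
\<close>

lemma signed_sums_greedy_step:
  fixes K :: real and E :: "nat \<Rightarrow> real" and z :: "nat \<Rightarrow> nat \<Rightarrow> real" and n :: nat
  assumes d: "0 < d" and c: "l1norm d c \<le> 1"
    and z: "\<And>i j. i < n \<Longrightarrow> j < d \<Longrightarrow> \<bar>z i j\<bar> \<le> K"
  shows "\<exists>j<d. \<exists>r\<in>{-1, 0, 1}.
    (\<Sum>i<n. (E i + r * z i j - dotp d (z i) c)\<^sup>2) \<le> (\<Sum>i<n. (E i)\<^sup>2) + n * K\<^sup>2"
proof (rule ccontr)
  define A where "A i = E i - dotp d (z i) c" for i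
  define S where "S = (\<Sum>i<n. (E i)\<^sup>2) + n * K\<^sup>2"
  define h where "h r j = (\<Sum>i<n. (A i + r * z i j)\<^sup>2)" for r j
  assume neg: "\<not> ?thesis"
  have big: "S < h r j" if "j < d" "r \<in> {-1, 0, 1}" for j r
  proof -
    have "\<not> (\<Sum>i<n. (E i + r * z i j - dotp d (z i) c)\<^sup>2) \<le> S"
      using neg that unfolding S_def by blast
    moreover have "h r j = (\<Sum>i<n. (E i + r * z i j - dotp d (z i) c)\<^sup>2)"
      unfolding h_def A_def by (intro sum.cong) (auto simp: algebra_simps)
    ultimately show ?thesis by simp
  qed
  have sgn3: "sgn x \<in> {-1, 0, 1}" for x :: real by (simp add: sgn_if)
  \<comment> \<open>The weighted average of the candidate errors is strictly larger than \<open>S\<close> by assumption, and at most \<open>S\<close> by expansion.\<close>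
  have "S = (\<Sum>j<d. \<bar>c j\<bar> * S) + (1 - l1norm d c) * S"
    by (simp only: sum_distrib_right[symmetric] l1norm_def) (simp add: left_diff_distrib)
  also have "\<dots> < (\<Sum>j<d. \<bar>c j\<bar> * h (sgn (c j)) j) + (1 - l1norm d c) * h 0 0"
  proof (cases "l1norm d c = 1")
    case True
    then obtain k where k: "k < d" "c k \<noteq> 0"
      unfolding l1norm_def by (cases "\<exists>k<d. c k \<noteq> 0") auto
    have "(\<Sum>j<d. \<bar>c j\<bar> * S) < (\<Sum>j<d. \<bar>c j\<bar> * h (sgn (c j)) j)"
    proof (rule sum_strict_mono_ex1)
      show "\<forall>j\<in>{..<d}. \<bar>c j\<bar> * S \<le> \<bar>c j\<bar> * h (sgn (c j)) j"
        using big[OF _ sgn3] by (simp add: mult_left_mono less_imp_le)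
      have "\<bar>c k\<bar> * S < \<bar>c k\<bar> * h (sgn (c k)) k"
        using k big[OF k(1) sgn3] by (intro mult_strict_left_mono) auto
      thus "\<exists>j\<in>{..<d}. \<bar>c j\<bar> * S < \<bar>c j\<bar> * h (sgn (c j)) j" using k by blast
    qed simp
    thus ?thesis using True by simp
  next
    case False
    have "(\<Sum>j<d. \<bar>c j\<bar> * S) \<le> (\<Sum>j<d. \<bar>c j\<bar> * h (sgn (c j)) j)"
      using big[OF _ sgn3] by (intro sum_mono) (simp add: mult_left_mono less_imp_le)
    moreover have "(1 - l1norm d c) * S < (1 - l1norm d c) * h 0 0"
      using False c big[OF d, of 0] by (intro mult_strict_left_mono) auto
    ultimately show ?thesis by linarith
  qed
  also have "\<dots> = (\<Sum>i<n. (\<Sum>j<d. \<bar>c j\<bar> * (A i + sgn (c j) * z i j)\<^sup>2) + (1 - l1norm d c) * (A i)\<^sup>2)"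
  proof -
    have "(\<Sum>j<d. \<bar>c j\<bar> * h (sgn (c j)) j)
        = (\<Sum>i<n. \<Sum>j<d. \<bar>c j\<bar> * (A i + sgn (c j) * z i j)\<^sup>2)"
      unfolding h_def sum_distrib_left by (rule sum.swap)
    moreover have "(1 - l1norm d c) * h 0 0 = (\<Sum>i<n. (1 - l1norm d c) * (A i)\<^sup>2)"
      unfolding h_def sum_distrib_left by simp
    ultimately show ?thesis by (simp only: sum.distrib)
  qed
  also have "\<dots> \<le> (\<Sum>i<n. (E i)\<^sup>2 + K\<^sup>2)"
  proof (rule sum_mono)
    fix i assume i: "i \<in> {..<n}"
    have "(\<Sum>j<d. \<bar>c j\<bar> * (A i + sgn (c j) * z i j)\<^sup>2)
        = (\<Sum>j<d. \<bar>c j\<bar> * (A i)\<^sup>2 + 2 * A i * (z i j * c j) + \<bar>c j\<bar> * (z i j)\<^sup>2)"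
    proof (rule sum.cong[OF refl])
      fix j
      show "\<bar>c j\<bar> * (A i + sgn (c j) * z i j)\<^sup>2
          = \<bar>c j\<bar> * (A i)\<^sup>2 + 2 * A i * (z i j * c j) + \<bar>c j\<bar> * (z i j)\<^sup>2"
        by (cases "c j" "0::real" rule: linorder_cases)
          (simp_all add: power2_eq_square algebra_simps)
    qed
    also have "\<dots> = l1norm d c * (A i)\<^sup>2 + 2 * A i * dotp d (z i) c + (\<Sum>j<d. \<bar>c j\<bar> * (z i j)\<^sup>2)"
      unfolding sum.distrib l1norm_def dotp_def sum_distrib_left sum_distrib_right ..
    finally have *: "(\<Sum>j<d. \<bar>c j\<bar> * (A i + sgn (c j) * z i j)\<^sup>2) + (1 - l1norm d c) * (A i)\<^sup>2
        = (A i)\<^sup>2 + 2 * A i * dotp d (z i) c + (\<Sum>j<d. \<bar>c j\<bar> * (z i j)\<^sup>2)"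
      by (simp add: algebra_simps)
    have "(\<Sum>j<d. \<bar>c j\<bar> * (z i j)\<^sup>2) \<le> (\<Sum>j<d. \<bar>c j\<bar> * K\<^sup>2)"
    proof (intro sum_mono mult_left_mono)
      fix j assume "j \<in> {..<d}"
      hence "\<bar>z i j\<bar>\<^sup>2 \<le> K\<^sup>2" using z i by (intro power_mono) auto
      thus "(z i j)\<^sup>2 \<le> K\<^sup>2" by simp
    qed simp
    also have "\<dots> = l1norm d c * K\<^sup>2" by (simp add: l1norm_def sum_distrib_right)
    also have "\<dots> \<le> 1 * K\<^sup>2" using c by (intro mult_right_mono) auto
    finally have 1: "(\<Sum>j<d. \<bar>c j\<bar> * (z i j)\<^sup>2) \<le> K\<^sup>2" by simp
    have "(A i)\<^sup>2 + 2 * A i * dotp d (z i) c = (E i)\<^sup>2 - (dotp d (z i) c)\<^sup>2"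
      unfolding A_def by (simp add: power2_eq_square algebra_simps)
    hence "(A i)\<^sup>2 + 2 * A i * dotp d (z i) c \<le> (E i)\<^sup>2" by simp
    with * 1 show "(\<Sum>j<d. \<bar>c j\<bar> * (A i + sgn (c j) * z i j)\<^sup>2) + (1 - l1norm d c) * (A i)\<^sup>2
        \<le> (E i)\<^sup>2 + K\<^sup>2" by linarith
  qed
  also have "\<dots> = S" by (simp add: S_def sum.distrib)
  finally show False by simp
qed

lemma signed_sums_greedy:
  fixes K :: real and z :: "nat \<Rightarrow> nat \<Rightarrow> real" and n m :: nat
  assumes d: "0 < d" and c: "l1norm d c \<le> 1"
    and z: "\<And>i j. i < n \<Longrightarrow> j < d \<Longrightarrow> \<bar>z i j\<bar> \<le> K"
  shows "\<exists>g\<in>signed_sums d m. (\<Sum>i<n. (dotp d (z i) g - m * dotp d (z i) c)\<^sup>2) \<le> m * (n * K\<^sup>2)"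
proof (induction m)
  case 0
  show ?case by (simp add: dotp_def)
next
  case (Suc m)
  then obtain g where g: "g \<in> signed_sums d m"
    "(\<Sum>i<n. (dotp d (z i) g - m * dotp d (z i) c)\<^sup>2) \<le> m * (n * K\<^sup>2)" by blast
  define E where "E i = dotp d (z i) g - m * dotp d (z i) c" for i
  have "\<exists>j<d. \<exists>r\<in>{-1, 0, 1}.
      (\<Sum>i<n. (E i + r * z i j - dotp d (z i) c)\<^sup>2) \<le> (\<Sum>i<n. (E i)\<^sup>2) + n * K\<^sup>2"
    by (rule signed_sums_greedy_step[OF d c z])
  then obtain j r where jr: "j < d" "r \<in> {-1, 0, 1}"
      "(\<Sum>i<n. (E i + r * z i j - dotp d (z i) c)\<^sup>2) \<le> (\<Sum>i<n. (E i)\<^sup>2) + n * K\<^sup>2"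
    by blast
  let ?h = "\<lambda>i. g i + (if i = j then r else 0)"
  have "?h \<in> signed_sums d (Suc m)" using g jr(1,2)
    unfolding signed_sums.simps by (intro image_eqI[where x = "(g, j, r)"]) simp_all
  moreover have "(\<Sum>i<n. (dotp d (z i) ?h - Suc m * dotp d (z i) c)\<^sup>2) \<le> Suc m * (n * K\<^sup>2)"
  proof -
    have eq: "dotp d (z i) ?h - Suc m * dotp d (z i) c = E i + r * z i j - dotp d (z i) c" for i
      unfolding dotp_add_single[OF jr(1)] E_def by (simp add: distrib_right)
    have "(\<Sum>i<n. (E i)\<^sup>2) \<le> m * (n * K\<^sup>2)" using g(2) unfolding E_def .
    moreover have "real (Suc m) * (n * K\<^sup>2) = m * (n * K\<^sup>2) + n * K\<^sup>2"
      by (simp add: distrib_right)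
    ultimately show ?thesis unfolding eq using jr(3) by linarith
  qed
  ultimately show ?case by (intro bexI[where x = ?h])
qed

text \<open>
  The greedy choice makes the squared error of \<open>m\<close> summands grow linearly in \<open>m\<close>, so after scaling
  by \<open>R / m\<close> the root mean square error is \<open>R K / \<surd>m\<close>; the Cauchy-Schwarz inequality passes to absolute
  errors.
\<close>

lemma sparse_approximation:
  fixes R K :: real and \<gamma> :: "nat \<Rightarrow> real" and z :: "nat \<Rightarrow> nat \<Rightarrow> real" and n m :: nat
  assumes d: "0 < d" and m: "0 < m" and R: "0 < R" "l1norm d \<gamma> \<le> R" and K: "0 \<le> K"
    and z: "\<And>i j. i < n \<Longrightarrow> j < d \<Longrightarrow> \<bar>z i j\<bar> \<le> K"
  shows "\<exists>g\<in>signed_sums d m.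
    (\<Sum>i<n. \<bar>dotp d (z i) \<gamma> - dotp d (z i) (\<lambda>j. R / m * g j)\<bar>) \<le> n * R * K / sqrt m"
proof -
  define c where "c j = \<gamma> j / R" for j
  have "l1norm d c = l1norm d \<gamma> / R"
    using R(1) by (simp add: l1norm_def c_def abs_divide sum_divide_distrib)
  hence c1: "l1norm d c \<le> 1" using R by simp
  obtain g where g: "g \<in> signed_sums d m"
    "(\<Sum>i<n. (dotp d (z i) g - m * dotp d (z i) c)\<^sup>2) \<le> m * (n * K\<^sup>2)"
    using signed_sums_greedy[where z = z and m = m, OF d c1, of n K] z by blast
  define x where "x i = dotp d (z i) g - m * dotp d (z i) c" for i
  have eq: "\<bar>dotp d (z i) \<gamma> - dotp d (z i) (\<lambda>j. R / m * g j)\<bar> = R / m * \<bar>x i\<bar>" for i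
  proof -
    have "\<gamma> = (\<lambda>j. R * c j)" using R by (auto simp: c_def)
    hence "dotp d (z i) \<gamma> = R * dotp d (z i) c" using dotp_scale[of d "z i" R c] by simp
    hence "dotp d (z i) \<gamma> - dotp d (z i) (\<lambda>j. R / m * g j) = - (R / m * x i)"
      using m unfolding dotp_scale[where r = "R / m"] by (simp add: x_def field_simps)
    thus ?thesis using R by (simp add: abs_mult)
  qed
  have "(\<Sum>i<n. \<bar>x i\<bar>)\<^sup>2 \<le> (\<Sum>i<n. \<bar>x i\<bar>\<^sup>2) * card {..<n}"
    by (rule sum_squared_le_sum_of_squares)
  also have "\<dots> \<le> (m * (n * K\<^sup>2)) * n" using g(2) by (intro mult_mono) (auto simp: x_def intro!: sum_nonneg)
  also have "\<dots> = (n * K * sqrt m)\<^sup>2" by (simp add: power_mult_distrib power2_eq_square)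
  finally have "(\<Sum>i<n. \<bar>x i\<bar>) \<le> n * K * sqrt m"
    by (rule power2_le_imp_le) (use K in simp)
  hence "R / m * (\<Sum>i<n. \<bar>x i\<bar>) \<le> R / m * (n * K * sqrt m)"
    using R by (intro mult_left_mono) auto
  also have "\<dots> = n * R * K / sqrt m" using m by (simp add: field_simps)
  finally show ?thesis using g(1) by (intro bexI[of _ g]) (simp_all only: eq sum_distrib_left[symmetric])
qed

section \<open>Mixtures of two normal densities\<close>

abbreviation gauss :: "real \<Rightarrow> real \<Rightarrow> real" where
  "gauss s \<equiv> normal_density 0 (sqrt s)"

lemma normal_density_var:
  "0 < s \<Longrightarrow> gauss s x = exp (- x\<^sup>2 / (2 * s)) / sqrt (2 * pi * s)"
  by (simp add: normal_density_def)

definition mix :: "real \<Rightarrow> real \<Rightarrow> real \<Rightarrow> real \<Rightarrow> real \<Rightarrow> real" where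
  "mix w s a b e = w * gauss s (e - a) + (1 - w) * gauss s (e - b)"

lemma measurable_mix [measurable]:
  assumes [measurable]: "w \<in> borel_measurable N" "a \<in> borel_measurable N"
    "b \<in> borel_measurable N" "e \<in> borel_measurable N"
  shows "(\<lambda>x. mix (w x) s (a x) (b x) (e x)) \<in> borel_measurable N"
  unfolding mix_def by measurable

lemma logistic_bounds: "0 < logistic x" "logistic x < 1"
  by (auto simp: logistic_def add_pos_pos)

lemma one_minus_logistic: "1 - logistic x = 1 / (1 + exp x)"
proof -
  have "1 + exp x \<noteq> 0" using exp_gt_zero[of x] by linarith
  thus ?thesis by (simp add: logistic_def field_simps)
qed

lemma logistic_le_exp_abs_mult: "logistic x \<le> exp \<bar>x - y\<bar> * logistic y"
proof (cases "y \<le> x")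
  case True
  have "exp x / (1 + exp x) \<le> exp x / (1 + exp y)"
    using True by (intro divide_left_mono mult_pos_pos add_pos_pos) auto
  also have "\<dots> = exp \<bar>x - y\<bar> * logistic y" using True by (simp add: logistic_def exp_diff)
  finally show ?thesis by (simp add: logistic_def)
next
  case False
  have "logistic x = exp x * (1 / (1 + exp x))" by (simp add: logistic_def)
  also have "exp x * (1 / (1 + exp x)) \<le> exp y / (1 + exp y)"
  proof -
    have "exp x * (1 + exp y) \<le> exp y * (1 + exp x)" using False by (simp add: distrib_left mult.commute)
    moreover have "0 < 1 + exp x" "0 < 1 + exp y" by (auto intro: add_pos_pos)
    ultimately show ?thesis by (simp add: divide_simps mult.commute)
  qed
  also have "\<dots> = 1 * logistic y" by (simp add: logistic_def)
  also have "\<dots> \<le> exp \<bar>x - y\<bar> * logistic y"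
    using logistic_bounds[of y] by (intro mult_right_mono) auto
  finally show ?thesis .
qed

lemma logistic_uminus: "1 - logistic x = logistic (- x)"
  unfolding one_minus_logistic
  by (simp add: logistic_def exp_minus field_simps add_pos_pos)

lemma mix_nonneg: "0 \<le> w \<Longrightarrow> w \<le> 1 \<Longrightarrow> 0 \<le> mix w s a b e"
  unfolding mix_def by (intro add_nonneg_nonneg mult_nonneg_nonneg) auto

lemma mix_pos:
  assumes "0 < s" "0 \<le> w" "w \<le> 1"
  shows "0 < mix w s a b e"
proof (cases "w = 0")
  case True
  thus ?thesis using assms by (simp add: mix_def normal_density_pos)
next
  case False
  hence "0 < w * gauss s (e - a)" using assms by (simp add: normal_density_pos)
  moreover have "0 \<le> (1 - w) * gauss s (e - b)" using assms by simp
  ultimately show ?thesis by (simp add: mix_def)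
qed

text \<open>
  The multiplicative form of the statement that \<open>ln (mix (logistic x) \<dots>)\<close> is \<open>1\<close>-Lipschitz in \<open>x\<close>,
  whatever the component means, the variance and the residual: each of the two weights changes by at most
  the factor \<open>exp \<bar>x - y\<bar>\<close>. The bound does not degrade when one component is far more likely than the other.
\<close>

lemma mix_logistic_lipschitz:
  "mix (logistic x) s a b e \<le> exp \<bar>x - y\<bar> * mix (logistic y) s a b e"
proof -
  have "1 - logistic x \<le> exp \<bar>x - y\<bar> * (1 - logistic y)"
    using logistic_le_exp_abs_mult[of "- x" "- y"]
    by (simp add: logistic_uminus abs_minus_commute)
  hence "mix (logistic x) s a b e \<le> (exp \<bar>x - y\<bar> * logistic y) * gauss s (e - a)
      + (exp \<bar>x - y\<bar> * (1 - logistic y)) * gauss s (e - b)"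
    unfolding mix_def using logistic_le_exp_abs_mult by (intro add_mono mult_right_mono) auto
  thus ?thesis by (simp add: mix_def algebra_simps)
qed

lemma mix_le_cases:
  assumes "0 \<le> w" "w \<le> 1" "gauss s (e - a) \<le> c" "gauss s (e - b) \<le> c"
  shows "mix w s a b e \<le> c"
proof -
  have "mix w s a b e \<le> w * c + (1 - w) * c"
    unfolding mix_def using assms by (intro add_mono mult_left_mono) auto
  thus ?thesis by (simp add: algebra_simps)
qed

lemma mix_le:
  assumes "0 < s" "0 \<le> w" "w \<le> 1"
  shows "mix w s a b e \<le> 1 / sqrt (2 * pi * s)"
proof -
  have "gauss s x \<le> 1 / sqrt (2 * pi * s)" for x
    using assms by (simp add: normal_density_var divide_right_mono)
  thus ?thesis using assms by (intro mix_le_cases) auto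
qed

lemma mix_le_away:
  assumes "0 < s" "0 \<le> w" "w \<le> 1" "0 \<le> \<kappa>" "\<kappa> \<le> \<bar>e - a\<bar>" "\<kappa> \<le> \<bar>e - b\<bar>"
  shows "mix w s a b e \<le> exp (- \<kappa>\<^sup>2 / (2 * s)) / sqrt (2 * pi * s)"
proof -
  have "gauss s x \<le> exp (- \<kappa>\<^sup>2 / (2 * s)) / sqrt (2 * pi * s)" if "\<kappa> \<le> \<bar>x\<bar>" for x
  proof -
    have "\<kappa>\<^sup>2 \<le> x\<^sup>2" using that assms(4) by (metis abs_le_square_iff abs_of_nonneg)
    thus ?thesis using assms by (simp add: normal_density_var divide_right_mono)
  qed
  thus ?thesis using assms by (intro mix_le_cases) auto
qed

lemma normal_density_param_lipschitz:
  assumes s1: "0 < s1" "s1 \<le> s" "s1 \<le> s'" and \<eta>: "\<bar>s - s'\<bar> \<le> \<eta>"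
    and A: "\<bar>x\<bar> \<le> A" "\<bar>x'\<bar> \<le> A" "\<bar>x - x'\<bar> \<le> \<delta>"
  shows "gauss s x
    \<le> exp (\<eta> / s1 + A * \<delta> / s1 + A\<^sup>2 * \<eta> / s1\<^sup>2) * gauss s' x'"
proof -
  have pos: "0 < s" "0 < s'" "0 \<le> A" "0 \<le> \<delta>" "0 \<le> \<eta>" using assms by linarith+
  have "sqrt s' \<le> exp (\<eta> / s1) * sqrt s"
  proof -
    have "s' \<le> s + \<eta>" using \<eta> by linarith
    also have "\<eta> \<le> (\<eta> / s1) * s"
      using s1 pos mult_left_mono[of s1 s "\<eta> / s1"] by simp
    finally have "s' \<le> (1 + \<eta> / s1) * s" by (simp add: algebra_simps)
    also have "\<dots> \<le> exp (\<eta> / s1) * s" using pos exp_ge_add_one_self by (intro mult_right_mono) auto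
    also have "\<dots> \<le> (exp (\<eta> / s1))\<^sup>2 * s"
      using pos s1 by (intro mult_right_mono) (auto simp: power2_eq_square)
    finally have "sqrt s' \<le> sqrt ((exp (\<eta> / s1))\<^sup>2 * s)" by simp
    thus ?thesis by (simp add: real_sqrt_mult)
  qed
  hence "sqrt (2 * pi) * sqrt s' \<le> exp (\<eta> / s1) * (sqrt (2 * pi) * sqrt s)"
    by (metis (no_types, opaque_lifting) mult.left_commute mult_left_mono real_sqrt_ge_0_iff pi_ge_zero zero_le_mult_iff zero_le_numeral)
  hence 1: "1 / sqrt (2 * pi * s) \<le> exp (\<eta> / s1) / sqrt (2 * pi * s')"
    using pos by (simp add: real_sqrt_mult divide_simps mult_ac)
  have 2: "- x\<^sup>2 / (2 * s) \<le> (A * \<delta> / s1 + A\<^sup>2 * \<eta> / s1\<^sup>2) - x'\<^sup>2 / (2 * s')"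
  proof -
    have "x'\<^sup>2 / (2 * s') - x\<^sup>2 / (2 * s) = ((x' - x) * (x' + x)) / (2 * s') + x\<^sup>2 * (s - s') / (2 * (s * s'))"
      using pos by (simp add: divide_simps power2_eq_square) (simp add: algebra_simps)
    also have "\<dots> \<le> (\<delta> * (2 * A)) / (2 * s1) + A\<^sup>2 * \<eta> / (2 * (s1 * s1))"
    proof (intro add_mono frac_le)
      have "(x' - x) * (x' + x) \<le> \<bar>x' - x\<bar> * \<bar>x' + x\<bar>" by (metis abs_ge_self abs_mult)
      also have "\<dots> \<le> \<delta> * (2 * A)" using A pos by (intro mult_mono) auto
      finally show "(x' - x) * (x' + x) \<le> \<delta> * (2 * A)" .
      have "x\<^sup>2 \<le> A\<^sup>2" using A by (metis abs_le_square_iff abs_of_nonneg pos(3))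
      hence "x\<^sup>2 * \<bar>s - s'\<bar> \<le> A\<^sup>2 * \<eta>" using \<eta> by (intro mult_mono) auto
      thus "x\<^sup>2 * (s - s') \<le> A\<^sup>2 * \<eta>"
        by (meson abs_ge_self mult_left_mono order_trans zero_le_power2)
      show "2 * (s1 * s1) \<le> 2 * (s * s')" using s1 by (intro mult_left_mono mult_mono) auto
    qed (use pos s1 in auto)
    also have "\<dots> \<le> A * \<delta> / s1 + A\<^sup>2 * \<eta> / s1\<^sup>2"
      using pos s1 by (simp add: power2_eq_square divide_simps)
    finally show ?thesis by linarith
  qed
  have "gauss s x = exp (- x\<^sup>2 / (2 * s)) * (1 / sqrt (2 * pi * s))"
    using pos by (simp add: normal_density_var)
  also have "\<dots> \<le> exp ((A * \<delta> / s1 + A\<^sup>2 * \<eta> / s1\<^sup>2) - x'\<^sup>2 / (2 * s')) * (exp (\<eta> / s1) / sqrt (2 * pi * s'))"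
    using 1 2 pos by (intro mult_mono) auto
  also have "\<dots> = exp (\<eta> / s1 + A * \<delta> / s1 + A\<^sup>2 * \<eta> / s1\<^sup>2) * gauss s' x'"
  proof -
    have "exp (P - Q) * (exp E / S) = exp (E + P) * (exp (- Q) / S)" for P Q E S :: real
      by (simp add: exp_add exp_diff exp_minus divide_inverse mult_ac)
    thus ?thesis by (simp only: normal_density_var[OF pos(2)] add.assoc minus_divide_left[symmetric])
  qed
  finally show ?thesis .
qed

text \<open>
  On residuals bounded by \<open>A\<close> and variances bounded below by \<open>s1\<close>, the mixture is multiplicatively
  Lipschitz in means and variance with constants polynomial in \<open>A\<close>; hence a grid of polynomially small mesh
  suffices.
\<close>

lemma mix_param_lipschitz:
  assumes s1: "0 < s1" "s1 \<le> s" "s1 \<le> s'" and \<eta>: "\<bar>s - s'\<bar> \<le> \<eta>" and w: "0 \<le> w" "w \<le> 1"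
    and a: "\<bar>e - a\<bar> \<le> A" "\<bar>e - a'\<bar> \<le> A" "\<bar>a - a'\<bar> \<le> \<delta>"
    and b: "\<bar>e - b\<bar> \<le> A" "\<bar>e - b'\<bar> \<le> A" "\<bar>b - b'\<bar> \<le> \<delta>"
  shows "mix w s a b e \<le> exp (\<eta> / s1 + A * \<delta> / s1 + A\<^sup>2 * \<eta> / s1\<^sup>2) * mix w s' a' b' e"
proof -
  let ?E = "exp (\<eta> / s1 + A * \<delta> / s1 + A\<^sup>2 * \<eta> / s1\<^sup>2)"
  have "mix w s a b e \<le> w * (?E * gauss s' (e - a'))
      + (1 - w) * (?E * gauss s' (e - b'))"
    unfolding mix_def using w a b
    by (intro add_mono mult_left_mono normal_density_param_lipschitz[OF s1 \<eta>]) auto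
  thus ?thesis by (simp add: mix_def algebra_simps)
qed

lemma nn_integral_normal_density_shift:
  assumes "0 < s"
  shows "(\<integral>\<^sup>+e. ennreal (gauss s (e - a)) \<partial>lborel) = 1"
proof -
  have "gauss s (e - a) = normal_density a (sqrt s) e" for e
    by (simp add: normal_density_def)
  thus ?thesis using assms
    by (simp add: nn_integral_eq_integral)
qed

lemma nn_integral_mix:
  assumes "0 < s" "0 \<le> w" "w \<le> 1"
  shows "(\<integral>\<^sup>+e. ennreal (mix w s a b e) \<partial>lborel) = 1"
proof -
  have "(\<integral>\<^sup>+e. ennreal (mix w s a b e) \<partial>lborel)
      = (\<integral>\<^sup>+e. ennreal w * ennreal (gauss s (e - a))
          + ennreal (1 - w) * ennreal (gauss s (e - b)) \<partial>lborel)"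
    unfolding mix_def using assms by (intro nn_integral_cong) (simp add: ennreal_plus ennreal_mult)
  also have "\<dots> = ennreal w + ennreal (1 - w)"
    using assms by (simp add: nn_integral_add nn_integral_cmult nn_integral_normal_density_shift)
  also have "\<dots> = 1" using assms by (simp add: ennreal_plus[symmetric] del: ennreal_plus)
  finally show ?thesis .
qed

lemma two_le_exp_add_exp_minus: "2 \<le> exp x + exp (- x)" for x :: real
proof -
  have "exp x + exp (- x) - 2 = (exp (x / 2) - exp (- x / 2))\<^sup>2"
    by (simp add: power2_eq_square algebra_simps exp_add[symmetric])
  also have "\<dots> \<ge> 0" by simp
  finally show ?thesis by simp
qed

lemma exp_add_exp_minus_eq_two: "exp x + exp (- x) = 2 \<Longrightarrow> x = 0" for x :: real
proof -
  assume "exp x + exp (- x) = 2"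
  moreover have "exp x + exp (- x) - 2 = (exp (x / 2) - exp (- x / 2))\<^sup>2"
    by (simp add: power2_eq_square algebra_simps exp_add[symmetric])
  ultimately show "x = 0" by simp
qed

text \<open>
  Dividing by \<open>exp (- x\<^sup>2 / (2 s))\<close> turns the identity into
  \<open>A exp (p x) + B exp (q x) = C exp (\<kappa> x\<^sup>2)\<close> with \<open>2 \<kappa> = 1/s - 1/s0\<close>. The even part of the left side is smallest at
  zero, which excludes \<open>\<kappa> < 0\<close>; it grows only exponentially, which excludes \<open>\<kappa> > 0\<close>; and it is constant
  only for \<open>p = q = 0\<close>.
\<close>

lemma mix_half_identifiable:
  assumes s: "0 < s" "0 < s0" and eq: "\<And>x. mix (1/2) s a b x = gauss s0 x"
  shows "s = s0 \<and> a = 0 \<and> b = 0"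
proof -
  define A B where "A = exp (- a\<^sup>2 / (2 * s))" and "B = exp (- b\<^sup>2 / (2 * s))"
  define p q \<kappa> C where "p = a / s" and "q = b / s" and "\<kappa> = 1 / (2 * s) - 1 / (2 * s0)"
    and "C = 2 * sqrt s / sqrt s0"
  have AB: "0 < A" "0 < B" by (auto simp: A_def B_def)
  have tilt: "A * exp (p * x) + B * exp (q * x) = C * exp (\<kappa> * x\<^sup>2)" for x
  proof -
    have t: "exp (- (x - c)\<^sup>2 / (2 * s)) = exp (- c\<^sup>2 / (2 * s)) * exp (c / s * x) * exp (- x\<^sup>2 / (2 * s))" for c
      using s by (simp add: exp_add[symmetric] power2_eq_square divide_simps) (simp add: algebra_simps)
    have "exp (- (x - a)\<^sup>2 / (2 * s)) + exp (- (x - b)\<^sup>2 / (2 * s)) = C * exp (- x\<^sup>2 / (2 * s0))"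
    proof -
      define \<rho> where "\<rho> = sqrt (2 * pi)"
      have r: "sqrt (2 * pi * v) = \<rho> * sqrt v" for v unfolding \<rho>_def by (rule real_sqrt_mult)
      have "0 < \<rho>" by (simp add: \<rho>_def)
      have "\<rho> * (sqrt s0 * (exp (- (x - a)\<^sup>2 / (2 * s)) + exp (- (x - b)\<^sup>2 / (2 * s))))
          = \<rho> * (2 * sqrt s * exp (- x\<^sup>2 / (2 * s0)))"
        using eq[of x] s \<open>0 < \<rho>\<close>
        unfolding mix_def normal_density_var[OF s(1)] normal_density_var[OF s(2)] r
        by (simp add: field_simps)
      hence "sqrt s0 * (exp (- (x - a)\<^sup>2 / (2 * s)) + exp (- (x - b)\<^sup>2 / (2 * s)))
          = 2 * sqrt s * exp (- x\<^sup>2 / (2 * s0))"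
        using \<open>0 < \<rho>\<close> by (simp only: mult_cancel_left) auto
      thus ?thesis using s unfolding C_def by (simp add: field_simps)
    qed
    hence "(A * exp (p * x) + B * exp (q * x)) * exp (- x\<^sup>2 / (2 * s)) = C * exp (- x\<^sup>2 / (2 * s0))"
      unfolding t A_def B_def p_def q_def by (simp add: algebra_simps)
    also have "\<dots> = C * exp (\<kappa> * x\<^sup>2) * exp (- x\<^sup>2 / (2 * s))"
      unfolding \<kappa>_def by (simp add: exp_add[symmetric] algebra_simps)
    finally show ?thesis by simp
  qed
  have sym: "A * (exp (p * x) + exp (- (p * x))) + B * (exp (q * x) + exp (- (q * x)))
      = 2 * (A + B) * exp (\<kappa> * x\<^sup>2)" for x
    using tilt[of x] tilt[of "- x"] tilt[of 0] by (simp add: algebra_simps)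
  have lower: "2 * (A + B) \<le> 2 * (A + B) * exp (\<kappa> * x\<^sup>2)" for x
  proof -
    have "A * 2 + B * 2 \<le> A * (exp (p * x) + exp (- (p * x))) + B * (exp (q * x) + exp (- (q * x)))"
      using AB two_le_exp_add_exp_minus by (intro add_mono mult_left_mono) auto
    thus ?thesis unfolding sym by simp
  qed
  have "\<not> \<kappa> < 0"
  proof
    assume "\<kappa> < 0"
    hence "exp (\<kappa> * 1\<^sup>2) < 1" by simp
    hence "2 * (A + B) * exp (\<kappa> * 1\<^sup>2) < 2 * (A + B) * 1" using AB by (intro mult_strict_left_mono) auto
    with lower[of 1] show False by simp
  qed
  moreover have "\<not> 0 < \<kappa>"
  proof
    assume k: "0 < \<kappa>"
    define r where "r = \<bar>p\<bar> + \<bar>q\<bar> + 1"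
    \<comment> \<open>At this point \<open>\<kappa> x\<^sup>2 = r x\<close>, so the right-hand side exceeds both exponentials.\<close>
    define x where "x = r / \<kappa>"
    have x: "0 < x" using k by (simp add: x_def r_def add_nonneg_pos)
    have kx: "\<kappa> * x\<^sup>2 = r * x" using k by (simp add: x_def power2_eq_square)
    have "p < r" "q < r" by (auto simp: r_def)
    hence "p * x < r * x" "q * x < r * x" using x by auto
    hence "A * exp (p * x) + B * exp (q * x) < A * exp (r * x) + B * exp (r * x)"
      using AB by (intro add_strict_mono mult_strict_left_mono) auto
    also have "\<dots> = C * exp (\<kappa> * x\<^sup>2)" using tilt[of 0] by (simp add: kx distrib_right[symmetric])
    finally show False using tilt[of x] by simp
  qed
  ultimately have k0: "\<kappa> = 0" by simp
  hence "s = s0" using s by (simp add: \<kappa>_def field_simps)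
  have "A * (exp p + exp (- p) - 2) + B * (exp q + exp (- q) - 2) = 0"
    using sym[of 1] by (simp add: k0 algebra_simps)
  moreover have "0 \<le> A * (exp p + exp (- p) - 2)" "0 \<le> B * (exp q + exp (- q) - 2)"
    using AB two_le_exp_add_exp_minus[of p] two_le_exp_add_exp_minus[of q] by auto
  ultimately have "A * (exp p + exp (- p) - 2) = 0" "B * (exp q + exp (- q) - 2) = 0" by linarith+
  hence "p = 0" "q = 0" using AB by (auto intro!: exp_add_exp_minus_eq_two)
  thus ?thesis using \<open>s = s0\<close> s by (simp add: p_def q_def)
qed

section \<open>Statements that hold with probability tending to one\<close>

text \<open>
  The statement \<open>P\<close> fails only on a measurable exceptional event of vanishing probability, up to null sets;
  \<open>P\<close> itself may be non-measurable, as is natural for statements about maximizers.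
\<close>

definition whp :: "(nat \<Rightarrow> 'a measure) \<Rightarrow> (nat \<Rightarrow> 'a \<Rightarrow> bool) \<Rightarrow> bool" where
  "whp M P \<longleftrightarrow> (\<exists>E. (\<forall>\<^sub>F n in sequentially. E n \<in> sets (M n) \<and> (AE \<omega> in M n. \<omega> \<notin> E n \<longrightarrow> P n \<omega>)) \<and>
     (\<lambda>n. measure (M n) (E n)) \<longlonglongrightarrow> 0)"

lemma whpI:
  assumes "\<forall>\<^sub>F n in sequentially. E n \<in> sets (M n) \<and> measure (M n) (E n) \<le> r n \<and>
      (AE \<omega> in M n. \<omega> \<notin> E n \<longrightarrow> P n \<omega>)"
    and r: "r \<longlonglongrightarrow> 0"
  shows "whp M P"
  unfolding whp_def
proof (intro exI[of _ E] conjI)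
  show "\<forall>\<^sub>F n in sequentially. E n \<in> sets (M n) \<and> (AE \<omega> in M n. \<omega> \<notin> E n \<longrightarrow> P n \<omega>)"
    using assms(1) by eventually_elim auto
  show "(\<lambda>n. measure (M n) (E n)) \<longlonglongrightarrow> 0"
    using assms(1) by (intro tendsto_sandwich[OF _ _ tendsto_const r]) (auto elim: eventually_mono)
qed

lemma whp_AE:
  assumes "\<forall>\<^sub>F n in sequentially. AE \<omega> in M n. P n \<omega>"
  shows "whp M P"
  by (rule whpI[where E = "\<lambda>_. {}" and r = "\<lambda>_. 0"]) (use assms in auto)

lemma whp_conj:
  assumes "whp M P" "whp M R"
  shows "whp M (\<lambda>n \<omega>. P n \<omega> \<and> R n \<omega>)"
proof -
  obtain E where E: "\<forall>\<^sub>F n in sequentially. E n \<in> sets (M n) \<and> (AE \<omega> in M n. \<omega> \<notin> E n \<longrightarrow> P n \<omega>)"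
    "(\<lambda>n. measure (M n) (E n)) \<longlonglongrightarrow> 0" using assms(1) unfolding whp_def by auto
  obtain F where F: "\<forall>\<^sub>F n in sequentially. F n \<in> sets (M n) \<and> (AE \<omega> in M n. \<omega> \<notin> F n \<longrightarrow> R n \<omega>)"
    "(\<lambda>n. measure (M n) (F n)) \<longlonglongrightarrow> 0" using assms(2) unfolding whp_def by auto
  show ?thesis
  proof (rule whpI[where E = "\<lambda>n. E n \<union> F n"])
    show "\<forall>\<^sub>F n in sequentially. E n \<union> F n \<in> sets (M n) \<and>
        measure (M n) (E n \<union> F n) \<le> measure (M n) (E n) + measure (M n) (F n) \<and>
        (AE \<omega> in M n. \<omega> \<notin> E n \<union> F n \<longrightarrow> P n \<omega> \<and> R n \<omega>)"
      using E(1) F(1)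
    proof eventually_elim
      case (elim n)
      have "AE \<omega> in M n. \<omega> \<notin> E n \<longrightarrow> P n \<omega>" "AE \<omega> in M n. \<omega> \<notin> F n \<longrightarrow> R n \<omega>" using elim by auto
      hence "AE \<omega> in M n. \<omega> \<notin> E n \<union> F n \<longrightarrow> P n \<omega> \<and> R n \<omega>" by eventually_elim auto
      thus ?case using elim by (auto intro: measure_Un_le)
    qed
    show "(\<lambda>n. measure (M n) (E n) + measure (M n) (F n)) \<longlonglongrightarrow> 0"
      using tendsto_add[OF E(2) F(2)] by simp
  qed
qed

lemma whp_mono:
  assumes "whp M P" and "\<forall>\<^sub>F n in sequentially. \<forall>\<omega>. P n \<omega> \<longrightarrow> R n \<omega>"
  shows "whp M R"
proof -
  obtain E where E: "\<forall>\<^sub>F n in sequentially. E n \<in> sets (M n) \<and> (AE \<omega> in M n. \<omega> \<notin> E n \<longrightarrow> P n \<omega>)"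
    "(\<lambda>n. measure (M n) (E n)) \<longlonglongrightarrow> 0" using assms(1) unfolding whp_def by auto
  show ?thesis
  proof (rule whpI[where E = E])
    show "\<forall>\<^sub>F n in sequentially. E n \<in> sets (M n) \<and> measure (M n) (E n) \<le> measure (M n) (E n) \<and>
        (AE \<omega> in M n. \<omega> \<notin> E n \<longrightarrow> R n \<omega>)"
      using E(1) assms(2)
    proof eventually_elim
      case (elim n)
      hence "AE \<omega> in M n. \<omega> \<notin> E n \<longrightarrow> P n \<omega>" by auto
      hence "AE \<omega> in M n. \<omega> \<notin> E n \<longrightarrow> R n \<omega>" by eventually_elim (use elim in auto)
      thus ?case using elim by auto
    qed
  qed fact
qed

lemma converges_in_prob_if_whp:
  assumes M: "\<forall>\<^sub>F n in sequentially. prob_space (M n)"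
    and T: "\<And>e. 0 < e \<Longrightarrow> whp M (\<lambda>n \<omega>. dist (T n \<omega>) c \<le> e)"
  shows "converges_in_prob M T c"
  unfolding converges_in_prob_def
proof (intro allI impI)
  fix e :: real assume "0 < e"
  then obtain E where E: "\<forall>\<^sub>F n in sequentially. E n \<in> sets (M n) \<and> (AE \<omega> in M n. \<omega> \<notin> E n \<longrightarrow> dist (T n \<omega>) c \<le> e)"
    "(\<lambda>n. measure (M n) (E n)) \<longlonglongrightarrow> 0" using T[of e] unfolding whp_def by auto
  show "(\<lambda>n. measure (M n) {\<omega> \<in> space (M n). e < dist (T n \<omega>) c}) \<longlonglongrightarrow> 0"
  proof (rule tendsto_sandwich[OF _ _ tendsto_const E(2)])
    show "\<forall>\<^sub>F n in sequentially. measure (M n) {\<omega> \<in> space (M n). e < dist (T n \<omega>) c} \<le> measure (M n) (E n)"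
      using M E(1)
    proof eventually_elim
      case (elim n)
      then interpret prob_space "M n" by simp
      have "AE \<omega> in M n. \<omega> \<notin> E n \<longrightarrow> dist (T n \<omega>) c \<le> e" using elim by auto
      hence "AE \<omega> in M n. \<omega> \<in> {\<omega> \<in> space (M n). e < dist (T n \<omega>) c} \<longrightarrow> \<omega> \<in> E n"
        by eventually_elim auto
      thus ?case using elim by (intro finite_measure_mono_AE) auto
    qed
  qed auto
qed

lemma iid_sample_measurable: "iid_sample n M Q V \<Longrightarrow> i < n \<Longrightarrow> V i \<in> measurable M Q"
  unfolding iid_sample_def by (auto simp: prob_space.indep_vars_def)

lemma iid_sample_AE:
  assumes iid: "iid_sample n M Q V" and P: "AE v in Q. P v"
  shows "AE \<omega> in M. \<forall>i<n. P (V i \<omega>)"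
proof -
  have "AE \<omega> in M. P (V i \<omega>)" if "i < n" for i
  proof -
    have eq: "distr M Q (V i) = Q" using iid that unfolding iid_sample_def by blast
    show ?thesis by (rule AE_distrD[OF iid_sample_measurable[OF iid that]]) (unfold eq, rule P)
  qed
  hence "AE \<omega> in M. \<forall>i\<in>{..<n}. P (V i \<omega>)" by (intro AE_finite_allI) auto
  thus ?thesis unfolding Ball_def lessThan_iff .
qed

text \<open>
  Markov's inequality for a product of independent copies, whose mean is the \<open>n\<close>-th power of one mean,
  with a union bound over \<open>S\<close>. Exponentials of sums, counts of small residuals and likelihood ratios are
  all products of this form, so no other exponential inequality enters.
\<close>

lemma iid_product_tail:
  fixes \<rho> c :: real
  assumes iid: "iid_sample n M Q V" and S: "finite S"
    and g: "\<And>\<nu>. \<nu> \<in> S \<Longrightarrow> g \<nu> \<in> borel_measurable Q" "\<And>\<nu> v. \<nu> \<in> S \<Longrightarrow> 0 \<le> g \<nu> v"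
    and \<rho>: "\<And>\<nu>. \<nu> \<in> S \<Longrightarrow> (\<integral>\<^sup>+v. ennreal (g \<nu> v) \<partial>Q) \<le> ennreal \<rho>" "0 \<le> \<rho>" and c: "0 < c"
  defines "E \<equiv> {\<omega> \<in> space M. \<exists>\<nu>\<in>S. c \<le> (\<Prod>i<n. g \<nu> (V i \<omega>))}"
  shows "E \<in> sets M" "measure M E \<le> card S * \<rho> ^ n / c"
proof -
  interpret M: prob_space M using iid by (simp add: iid_sample_def)
  have V: "V i \<in> measurable M Q" if "i < n" for i
    using iid_sample_measurable[OF iid that] .
  define A where "A \<nu> = {\<omega> \<in> space M. c \<le> (\<Prod>i<n. g \<nu> (V i \<omega>))}" for \<nu>
  have prod_meas: "(\<lambda>\<omega>. \<Prod>i<n. g \<nu> (V i \<omega>)) \<in> borel_measurable M" if "\<nu> \<in> S" for \<nu>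
    by (intro borel_measurable_prod) (use V g(1)[OF that] in \<open>blast intro: measurable_compose\<close>)
  have A_sets: "A \<nu> \<in> sets M" if "\<nu> \<in> S" for \<nu>
    unfolding A_def using prod_meas[OF that] by measurable
  have E: "E = (\<Union>\<nu>\<in>S. A \<nu>)" by (auto simp: E_def A_def)
  show "E \<in> sets M" unfolding E by (intro sets.finite_UN S A_sets)
  have A_le: "measure M (A \<nu>) \<le> \<rho> ^ n / c" if \<nu>: "\<nu> \<in> S" for \<nu>
  proof -
    have ind: "M.indep_vars (\<lambda>_. borel) (\<lambda>i \<omega>. ennreal (g \<nu> (V i \<omega>))) {..<n}"
    proof (rule M.indep_vars_compose2[where M' = "\<lambda>_. Q" and X = V])
      show "M.indep_vars (\<lambda>_. Q) V {..<n}" using iid unfolding iid_sample_def by blast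
      show "(\<lambda>v. ennreal (g \<nu> v)) \<in> borel_measurable Q" using g(1)[OF \<nu>] by measurable
    qed
    have "(\<integral>\<^sup>+\<omega>. ennreal (\<Prod>i<n. g \<nu> (V i \<omega>)) \<partial>M) = (\<integral>\<^sup>+\<omega>. (\<Prod>i<n. ennreal (g \<nu> (V i \<omega>))) \<partial>M)"
      using g(2)[OF \<nu>] by (simp add: prod_ennreal)
    also have "\<dots> = (\<Prod>i<n. \<integral>\<^sup>+\<omega>. ennreal (g \<nu> (V i \<omega>)) \<partial>M)"
      by (rule M.indep_vars_nn_integral[OF _ ind]) auto
    also have "\<dots> \<le> (\<Prod>i<n. ennreal \<rho>)"
    proof (rule prod_mono_ennreal)
      fix i assume "i \<in> {..<n}"
      hence i: "i < n" by simp
      have "(\<integral>\<^sup>+\<omega>. ennreal (g \<nu> (V i \<omega>)) \<partial>M) = (\<integral>\<^sup>+v. ennreal (g \<nu> v) \<partial>(distr M Q (V i)))"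
        by (rule nn_integral_distr[OF V[OF i], symmetric]) (use g(1)[OF \<nu>] in measurable)
      also have "distr M Q (V i) = Q" using iid i unfolding iid_sample_def by blast
      finally show "(\<integral>\<^sup>+\<omega>. ennreal (g \<nu> (V i \<omega>)) \<partial>M) \<le> ennreal \<rho>" using \<rho>(1)[OF \<nu>] by simp
    qed
    also have "\<dots> = ennreal (\<rho> ^ n)" using \<rho>(2) by (simp add: ennreal_power)
    finally have int: "(\<integral>\<^sup>+\<omega>. ennreal (\<Prod>i<n. g \<nu> (V i \<omega>)) \<partial>M) \<le> ennreal (\<rho> ^ n)" .
    have "emeasure M (A \<nu>) \<le> emeasure M {\<omega> \<in> space M. 1 \<le> ennreal (1 / c) * ennreal (\<Prod>i<n. g \<nu> (V i \<omega>))}"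
    proof (rule emeasure_mono)
      show "{\<omega> \<in> space M. 1 \<le> ennreal (1 / c) * ennreal (\<Prod>i<n. g \<nu> (V i \<omega>))} \<in> sets M"
        using prod_meas[OF \<nu>] by measurable
      show "A \<nu> \<subseteq> {\<omega> \<in> space M. 1 \<le> ennreal (1 / c) * ennreal (\<Prod>i<n. g \<nu> (V i \<omega>))}"
        using c by (auto simp: A_def ennreal_mult'[symmetric] ennreal_1[symmetric] simp del: ennreal_1)
    qed
    also have "\<dots> \<le> ennreal (1 / c) * (\<integral>\<^sup>+\<omega>. ennreal (\<Prod>i<n. g \<nu> (V i \<omega>)) \<partial>M)"
    proof -
      have meas: "(\<lambda>\<omega>. ennreal (\<Prod>i<n. g \<nu> (V i \<omega>))) \<in> borel_measurable M"
        using prod_meas[OF \<nu>] by measurable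
      have "emeasure M {\<omega> \<in> space M. 1 \<le> ennreal (1 / c) * ennreal (\<Prod>i<n. g \<nu> (V i \<omega>))}
          \<le> ennreal (1 / c) * (\<integral>\<^sup>+\<omega>. ennreal (\<Prod>i<n. g \<nu> (V i \<omega>)) * indicator (space M) \<omega> \<partial>M)"
        by (rule nn_integral_Markov_inequality) (use meas in auto)
      also have "(\<integral>\<^sup>+\<omega>. ennreal (\<Prod>i<n. g \<nu> (V i \<omega>)) * indicator (space M) \<omega> \<partial>M)
          = (\<integral>\<^sup>+\<omega>. ennreal (\<Prod>i<n. g \<nu> (V i \<omega>)) \<partial>M)"
        by (intro nn_integral_cong) auto
      finally show ?thesis .
    qed
    also have "\<dots> \<le> ennreal (1 / c) * ennreal (\<rho> ^ n)" using int by (intro mult_left_mono) auto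
    also have "\<dots> = ennreal (\<rho> ^ n / c)" using \<rho>(2) c by (simp add: ennreal_mult'[symmetric])
    finally show ?thesis using \<rho>(2) c by (simp add: M.emeasure_eq_measure)
  qed
  have "measure M E \<le> (\<Sum>\<nu>\<in>S. measure M (A \<nu>))"
    unfolding E by (intro M.finite_measure_subadditive_finite S image_subsetI A_sets)
  also have "\<dots> \<le> (\<Sum>\<nu>\<in>S. \<rho> ^ n / c)" by (rule sum_mono) (rule A_le)
  finally show "measure M E \<le> card S * \<rho> ^ n / c" by simp
qed

lemma iid_union_bound:
  assumes iid: "iid_sample n M Q V" and B: "B \<in> sets Q"
  defines "E \<equiv> {\<omega> \<in> space M. \<exists>i<n. V i \<omega> \<in> B}"
  shows "E \<in> sets M" "measure M E \<le> n * measure Q B"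
proof -
  interpret M: prob_space M using iid by (simp add: iid_sample_def)
  have V: "V i \<in> measurable M Q" if "i < n" for i
    using iid_sample_measurable[OF iid that] .
  have E: "E = (\<Union>i<n. V i -` B \<inter> space M)" by (auto simp: E_def)
  have sets: "V i -` B \<inter> space M \<in> sets M" if "i < n" for i
    using measurable_sets[OF V[OF that] B] .
  show "E \<in> sets M" unfolding E by (intro sets.finite_UN) (use sets in auto)
  have "measure M E \<le> (\<Sum>i<n. measure M (V i -` B \<inter> space M))"
    unfolding E by (intro M.finite_measure_subadditive_finite image_subsetI sets) auto
  also have "\<dots> = (\<Sum>i<n. measure Q B)"
  proof (rule sum.cong[OF refl])
    fix i assume "i \<in> {..<n}"
    hence i: "i < n" by simp
    have "measure (distr M Q (V i)) B = measure M (V i -` B \<inter> space M)"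
      using V[OF i] B by (rule measure_distr)
    moreover have "distr M Q (V i) = Q" using iid i unfolding iid_sample_def by blast
    ultimately show "measure M (V i -` B \<inter> space M) = measure Q B" by metis
  qed
  finally show "measure M E \<le> n * measure Q B" by simp
qed

section \<open>The law of one observation under the null\<close>

text \<open>
  The regression coefficients of \<open>U = (X', D)'\<close>, so that \<open>X'\<alpha> + D \<beta>\<close> is one inner product.
\<close>

definition coef :: "real^'q \<Rightarrow> real \<Rightarrow> real^('q::finite + unit)" where
  "coef \<alpha> \<beta> = (\<chi> k. case k of Inl i \<Rightarrow> \<alpha> $ i | Inr _ \<Rightarrow> \<beta>)"

lemma sum_UNIV_plus_unit:
  "(\<Sum>k\<in>(UNIV :: ('q::finite + unit) set). f k) = (\<Sum>i\<in>UNIV. f (Inl i)) + f (Inr ())"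
proof -
  have "(UNIV :: ('q + unit) set) = UNIV <+> UNIV" by (simp add: UNIV_Plus_UNIV)
  hence "(\<Sum>k\<in>(UNIV :: ('q + unit) set). f k) = (\<Sum>k\<in>UNIV <+> UNIV. f k)" by simp
  also have "\<dots> = (\<Sum>i\<in>UNIV. f (Inl i)) + f (Inr ())" by (subst sum.Plus) (auto simp: UNIV_unit)
  finally show ?thesis .
qed

lemma obs_U_inner_coef: "obs_U v \<bullet> coef \<alpha> \<beta> = obs_X v \<bullet> \<alpha> + obs_D v * \<beta>"
  by (simp add: inner_vec_def obs_U_def coef_def sum_UNIV_plus_unit)

lemma coef_diff: "coef (\<alpha> - \<alpha>') (\<beta> - \<beta>') = coef \<alpha> \<beta> - coef \<alpha>' \<beta>'"
  by (simp add: coef_def vec_eq_iff split: sum.split)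

lemma coef_eq_0_iff: "coef \<alpha> \<beta> = 0 \<longleftrightarrow> \<alpha> = 0 \<and> \<beta> = 0"
  by (auto simp: coef_def vec_eq_iff split: sum.splits)

lemma norm_coef_le: "norm (coef \<alpha> \<beta>) \<le> norm \<alpha> + \<bar>\<beta>\<bar>"
proof -
  have "(norm (coef \<alpha> \<beta>))\<^sup>2 = (norm \<alpha>)\<^sup>2 + \<beta>\<^sup>2"
    unfolding power2_norm_eq_inner
    by (simp add: inner_vec_def coef_def sum_UNIV_plus_unit power2_eq_square)
  also have "\<dots> \<le> (norm \<alpha> + \<bar>\<beta>\<bar>)\<^sup>2" by (simp add: power2_sum)
  finally show ?thesis by (rule power2_le_imp_le) simp
qed

lemma measurable_obs [measurable]:
  "obs_Y \<in> borel_measurable (obs_space d)" "obs_X \<in> borel_measurable (obs_space d)"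
  "obs_D \<in> borel_measurable (obs_space d)" "obs_Z \<in> measurable (obs_space d) (Rvec_borel d)"
  "obs_eps \<in> borel_measurable (obs_space d)"
  "obs_delta \<in> measurable (obs_space d) (count_space UNIV)"
  unfolding obs_Y_def obs_X_def obs_D_def obs_Z_def obs_eps_def obs_delta_def obs_space_def
  by measurable

lemma measurable_vec_lambda:
  fixes f :: "'a \<Rightarrow> 'n::finite \<Rightarrow> real"
  assumes "\<And>k. (\<lambda>x. f x k) \<in> borel_measurable N"
  shows "(\<lambda>x. (\<chi> k. f x k)) \<in> borel_measurable N"
proof (subst borel_measurable_euclidean_space, intro ballI)
  fix b :: "real^'n" assume "b \<in> Basis"
  then obtain k where "b = axis k 1" by (auto simp: Basis_vec_def)
  thus "(\<lambda>x. (\<chi> k. f x k) \<bullet> b) \<in> borel_measurable N" using assms by (simp add: inner_axis)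
qed

lemma measurable_obs_U [measurable]:
  "(obs_U :: ('q::finite) obs \<Rightarrow> _) \<in> borel_measurable (obs_space d)"
proof -
  have "(\<lambda>v :: 'q obs. (\<chi> k :: 'q + unit. case k of Inl i \<Rightarrow> obs_X v $ i | Inr _ \<Rightarrow> obs_D v)) \<in> borel_measurable (obs_space d)"
  proof (rule measurable_vec_lambda)
    fix k :: "'q + unit"
    show "(\<lambda>v :: 'q obs. case k of Inl i \<Rightarrow> obs_X v $ i | Inr _ \<Rightarrow> obs_D v) \<in> borel_measurable (obs_space d)"
    proof (cases k)
      case (Inl i)
      have "(\<lambda>v. obs_X v \<bullet> axis i 1) \<in> borel_measurable (obs_space d)" by measurable
      thus ?thesis using Inl by (simp add: inner_axis)
    next
      case (Inr j)
      thus ?thesis by simp measurable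
    qed
  qed
  thus ?thesis unfolding obs_U_def[abs_def] .
qed

lemma measurable_dotp [measurable (raw)]:
  assumes "z \<in> measurable N (Rvec_borel d)"
  shows "(\<lambda>v. dotp d (z v) \<gamma>) \<in> borel_measurable N"
proof -
  have "(\<lambda>v. z v j) \<in> borel_measurable N" if "j < d" for j
    using measurable_compose[OF assms[unfolded Rvec_borel_def] measurable_component_singleton[of j "{..<d}" "\<lambda>_. borel"]]
      that by simp
  thus ?thesis unfolding dotp_def by (intro borel_measurable_sum borel_measurable_times) auto
qed

lemma measurable_logistic [measurable]: "logistic \<in> borel_measurable borel"
  unfolding logistic_def by measurable

abbreviation noise :: "real \<Rightarrow> real measure" where
  "noise s \<equiv> density lborel (\<lambda>x. ennreal (gauss s x))"

definition obs_W :: "('q::finite) obs \<Rightarrow> (real^'q) \<times> real \<times> (nat \<Rightarrow> real) \<times> bool" where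
  "obs_W v = (obs_X v, obs_D v, obs_Z v, obs_delta v)"

abbreviation regressor_space :: "nat \<Rightarrow> ((real^'q::finite) \<times> real \<times> (nat \<Rightarrow> real) \<times> bool) measure" where
  "regressor_space d \<equiv> borel \<Otimes>\<^sub>M borel \<Otimes>\<^sub>M Rvec_borel d \<Otimes>\<^sub>M count_space UNIV"

lemma measurable_obs_W [measurable]: "obs_W \<in> measurable (obs_space d) (regressor_space d)"
  unfolding obs_W_def[abs_def] by measurable

text \<open>
  The mixture density at an observation, written with the noise \<open>\<epsilon>\<close> in place of \<open>Y\<close>: the component means
  become \<open>U'(b - b\<^sub>0)\<close> for the two coefficient vectors \<open>b\<close>.
\<close>

definition obs_mix :: "nat \<Rightarrow> real^'q \<Rightarrow> real \<Rightarrow> 'q param \<Rightarrow> (nat \<Rightarrow> real) \<Rightarrow> ('q::finite) obs \<Rightarrow> real" where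
  "obs_mix d a0 b0 = (\<lambda>(\<alpha>, \<beta>, lam, s) \<gamma> v. mix (logistic (dotp d (obs_Z v) \<gamma>)) s
     (obs_U v \<bullet> coef (\<alpha> - a0) (\<beta> + lam - b0)) (obs_U v \<bullet> coef (\<alpha> - a0) (\<beta> - b0)) (obs_eps v))"

lemma mix_density_eq_obs_mix:
  assumes "obs_Y v = obs_U v \<bullet> coef a0 b0 + obs_eps v"
  shows "mix_density d \<theta> \<gamma> v = obs_mix d a0 b0 \<theta> \<gamma> v"
proof (cases \<theta>)
  case (fields \<alpha> \<beta> lam s)
  show ?thesis unfolding fields mix_density_def obs_mix_def mix_def prod.case assms obs_U_inner_coef
    by (simp add: inner_diff_right algebra_simps)
qed

abbreviation sigma2 where "sigma2 \<theta> \<equiv> snd (snd (snd \<theta>))"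

text \<open>
  Square roots make the mean strictly less than one away from the truth, while the ratio itself always has
  mean one. The mean of \<open>root_lr\<close> is the Hellinger affinity of the two conditional densities.
\<close>

definition root_lr :: "nat \<Rightarrow> real^'q \<Rightarrow> real \<Rightarrow> real \<Rightarrow> 'q param \<Rightarrow> (nat \<Rightarrow> real) \<Rightarrow> ('q::finite) obs \<Rightarrow> real" where
  "root_lr d a0 b0 s0 \<theta> \<gamma> v = sqrt (obs_mix d a0 b0 \<theta> \<gamma> v / gauss s0 (obs_eps v))"

lemma measurable_obs_mix [measurable]: "obs_mix d a0 b0 \<theta> \<gamma> \<in> borel_measurable (obs_space d)"
  unfolding obs_mix_def by (cases \<theta>) simp

lemma measurable_root_lr [measurable]: "root_lr d a0 b0 s0 \<theta> \<gamma> \<in> borel_measurable (obs_space d)"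
  unfolding root_lr_def[abs_def] by measurable

lemma obs_mix_pos: "0 < sigma2 \<theta> \<Longrightarrow> 0 < obs_mix d a0 b0 \<theta> \<gamma> v"
  using logistic_bounds by (cases \<theta>) (auto simp: obs_mix_def intro!: mix_pos less_imp_le)

lemma root_lr_pos: "0 < s0 \<Longrightarrow> 0 < sigma2 \<theta> \<Longrightarrow> 0 < root_lr d a0 b0 s0 \<theta> \<gamma> v"
  by (simp add: root_lr_def obs_mix_pos normal_density_pos)

lemma root_lr_nonneg: "0 < s0 \<Longrightarrow> 0 < sigma2 \<theta> \<Longrightarrow> 0 \<le> root_lr d a0 b0 s0 \<theta> \<gamma> v"
  using root_lr_pos less_imp_le by blast

context
  fixes d :: nat and alpha0 :: "real^'q::finite" and beta0 s0 :: real and gamma0 :: "nat \<Rightarrow> real"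
    and Q :: "'q obs measure"
  assumes model: "regime_model d alpha0 beta0 0 s0 gamma0 Q" and s0: "0 < s0"
begin

lemma regime_prob: "prob_space Q" and regime_sets: "sets Q = sets (obs_space d)"
  using model by (auto simp: regime_model_def)

lemma regime_outcome: "AE v in Q. obs_Y v = obs_U v \<bullet> coef alpha0 beta0 + obs_eps v"
  using model by (auto simp: regime_model_def obs_U_inner_coef)

lemma regime_noise: "distr Q borel obs_eps = noise s0"
proof -
  have "distributed Q lborel obs_eps (\<lambda>x. ennreal (gauss s0 x))"
    using model by (simp add: regime_model_def Let_def)
  hence "distr Q lborel obs_eps = noise s0" by (simp add: distributed_def)
  thus ?thesis by (simp cong: distr_cong)
qed

text \<open>
  Independence of generated sigma-algebras, turned into a product law for any statistic \<open>h\<close> of the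
  regressors and the noise.
\<close>

lemma regime_product_law:
  assumes h[measurable]: "h \<in> measurable (regressor_space d) K"
  shows "distr Q (K \<Otimes>\<^sub>M borel) (\<lambda>v. (h (obs_W v), obs_eps v))
    = distr Q K (\<lambda>v. h (obs_W v)) \<Otimes>\<^sub>M noise s0"
proof -
  interpret Q: prob_space Q by (rule regime_prob)
  note [measurable_cong] = regime_sets
  have hW[measurable]: "(\<lambda>v. h (obs_W v)) \<in> measurable Q K" by measurable
  have eps[measurable]: "obs_eps \<in> borel_measurable Q" by measurable
  have pair[measurable]: "(\<lambda>v. (h (obs_W v), obs_eps v)) \<in> measurable Q (K \<Otimes>\<^sub>M borel)" by measurable
  have pN: "prob_space (noise s0)" using s0 by (intro prob_space_normal_density) simp
  have pK: "prob_space (distr Q K (\<lambda>v. h (obs_W v)))" by (rule Q.prob_space_distr[OF hW])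
  have ind: "Q.indep_set (sets (vimage_algebra (space Q) obs_eps borel))
       (sets (vimage_algebra (space Q) obs_W (regressor_space d)))"
    using model by (simp add: regime_model_def Let_def obs_W_def[abs_def])
  show ?thesis
  proof (rule pair_measure_eqI[symmetric])
    show "sigma_finite_measure (distr Q K (\<lambda>v. h (obs_W v)))"
      using pK by (simp add: prob_space.axioms(1) finite_measure.axioms(1))
    show "sigma_finite_measure (noise s0)"
      using pN by (simp add: prob_space.axioms(1) finite_measure.axioms(1))
    show "sets (distr Q K (\<lambda>v. h (obs_W v)) \<Otimes>\<^sub>M noise s0)
        = sets (distr Q (K \<Otimes>\<^sub>M borel) (\<lambda>v. (h (obs_W v), obs_eps v)))"
      by (simp cong: sets_pair_measure_cong)
    fix A B assume "A \<in> sets (distr Q K (\<lambda>v. h (obs_W v)))" "B \<in> sets (noise s0)"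
    hence A[measurable]: "A \<in> sets K" and B[measurable]: "B \<in> sets borel" by auto
    define a where "a = (\<lambda>v. h (obs_W v)) -` A \<inter> space Q"
    define b where "b = obs_eps -` B \<inter> space Q"
    have "a = obs_W -` (h -` A \<inter> space (regressor_space d)) \<inter> space Q"
    proof -
      have "obs_W v \<in> space (regressor_space d)" if "v \<in> space Q" for v
        using measurable_space[of obs_W Q "regressor_space d" v] that by simp
      thus ?thesis unfolding a_def by blast
    qed
    moreover have "h -` A \<inter> space (regressor_space d) \<in> sets (regressor_space d)"
      by (rule measurable_sets[OF h A])
    ultimately have "a \<in> sets (vimage_algebra (space Q) obs_W (regressor_space d))"
      by (simp only: in_vimage_algebra)
    moreover have "b \<in> sets (vimage_algebra (space Q) obs_eps borel)"
      unfolding b_def by (rule in_vimage_algebra[OF B])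
    ultimately have "Q.prob (b \<inter> a) = Q.prob b * Q.prob a" using Q.indep_setD[OF ind] by blast
    hence "emeasure Q (b \<inter> a) = emeasure Q b * emeasure Q a"
      by (simp add: Q.emeasure_eq_measure ennreal_mult)
    moreover have "emeasure (noise s0) B = emeasure Q b"
      unfolding regime_noise[symmetric] b_def by (rule emeasure_distr[OF eps B])
    moreover have "emeasure (distr Q K (\<lambda>v. h (obs_W v))) A = emeasure Q a"
      unfolding a_def by (rule emeasure_distr[OF hW A])
    moreover have "emeasure (distr Q (K \<Otimes>\<^sub>M borel) (\<lambda>v. (h (obs_W v), obs_eps v))) (A \<times> B)
        = emeasure Q (b \<inter> a)"
      by (subst emeasure_distr[OF pair]) (auto simp: a_def b_def intro!: arg_cong[where f = "emeasure Q"])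
    ultimately show "emeasure (distr Q K (\<lambda>v. h (obs_W v))) A * emeasure (noise s0) B
        = emeasure (distr Q (K \<Otimes>\<^sub>M borel) (\<lambda>v. (h (obs_W v), obs_eps v))) (A \<times> B)"
      by (simp add: mult.commute)
  qed
qed

lemma regime_nn_integral:
  assumes h[measurable]: "h \<in> measurable (regressor_space d) K"
    and f[measurable]: "f \<in> borel_measurable (K \<Otimes>\<^sub>M borel)"
  shows "(\<integral>\<^sup>+v. f (h (obs_W v), obs_eps v) \<partial>Q)
    = (\<integral>\<^sup>+t. (\<integral>\<^sup>+e. ennreal (gauss s0 e) * f (t, e) \<partial>lborel) \<partial>distr Q K (\<lambda>v. h (obs_W v)))"
proof -
  note [measurable_cong] = regime_sets
  have pN: "prob_space (noise s0)" using s0 by (intro prob_space_normal_density) simp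
  then interpret N: sigma_finite_measure "noise s0"
    by (simp add: prob_space.axioms(1) finite_measure.axioms(1))
  have "(\<integral>\<^sup>+v. f (h (obs_W v), obs_eps v) \<partial>Q)
      = (\<integral>\<^sup>+x. f x \<partial>distr Q (K \<Otimes>\<^sub>M borel) (\<lambda>v. (h (obs_W v), obs_eps v)))"
    by (subst nn_integral_distr) measurable
  also have "\<dots> = (\<integral>\<^sup>+x. f x \<partial>(distr Q K (\<lambda>v. h (obs_W v)) \<Otimes>\<^sub>M noise s0))"
    by (simp add: regime_product_law[OF h])
  also have "\<dots> = (\<integral>\<^sup>+t. (\<integral>\<^sup>+e. f (t, e) \<partial>noise s0) \<partial>distr Q K (\<lambda>v. h (obs_W v)))"
    by (rule N.nn_integral_fst[symmetric]) measurable
  also have "\<dots> = (\<integral>\<^sup>+t. (\<integral>\<^sup>+e. ennreal (gauss s0 e) * f (t, e) \<partial>lborel) \<partial>distr Q K (\<lambda>v. h (obs_W v)))"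
  proof (intro nn_integral_cong nn_integral_density)
    fix t assume t: "t \<in> space (distr Q K (\<lambda>v. h (obs_W v)))"
    show "(\<lambda>e. ennreal (gauss s0 e)) \<in> borel_measurable lborel" by measurable
    have "(\<lambda>e. f (t, e)) \<in> borel_measurable borel" using t by simp
    thus "(\<lambda>e. f (t, e)) \<in> borel_measurable lborel" by simp
  qed
  finally show ?thesis .
qed

text \<open>
  Given the regressors, the noise density cancels the denominator and the remaining mixture integrates
  to one.
\<close>

lemma nn_integral_likelihood_ratio:
  assumes s: "0 < sigma2 \<theta>"
  shows "(\<integral>\<^sup>+v. ennreal (obs_mix d alpha0 beta0 \<theta> \<gamma> v / gauss s0 (obs_eps v)) \<partial>Q) = 1"
proof -
  obtain \<alpha> \<beta> lam s where \<theta>: "\<theta> = (\<alpha>, \<beta>, lam, s)" by (cases \<theta>)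
  interpret Q: prob_space Q by (rule regime_prob)
  note [measurable_cong] = regime_sets
  define m where "m = (\<lambda>(x, D, z, b :: bool). \<lambda>e. mix (logistic (dotp d z \<gamma>)) s
    (x \<bullet> (\<alpha> - alpha0) + D * (\<beta> + lam - beta0)) (x \<bullet> (\<alpha> - alpha0) + D * (\<beta> - beta0)) e)"
  define f where "f = (\<lambda>(t, e). ennreal (m t e / gauss s0 e))"
  have f[measurable]: "f \<in> borel_measurable (regressor_space d \<Otimes>\<^sub>M borel)"
    unfolding f_def m_def split_beta' by measurable
  have "(\<integral>\<^sup>+v. ennreal (obs_mix d alpha0 beta0 \<theta> \<gamma> v / gauss s0 (obs_eps v)) \<partial>Q)
      = (\<integral>\<^sup>+v. f (obs_W v, obs_eps v) \<partial>Q)"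
    by (simp add: f_def m_def obs_W_def obs_mix_def \<theta> obs_U_inner_coef)
  also have "\<dots> = (\<integral>\<^sup>+t. (\<integral>\<^sup>+e. ennreal (gauss s0 e) * f (t, e) \<partial>lborel)
      \<partial>distr Q (regressor_space d) (\<lambda>v. obs_W v))"
    by (rule regime_nn_integral[OF measurable_ident_sets[OF refl] f])
  also have "\<dots> = (\<integral>\<^sup>+t. 1 \<partial>distr Q (regressor_space d) (\<lambda>v. obs_W v))"
  proof (rule nn_integral_cong)
    fix t
    have "ennreal (gauss s0 e) * f (t, e) = ennreal (m t e)" for e
      using normal_density_pos[of "sqrt s0" 0 e] s0
      by (simp add: f_def ennreal_mult'[symmetric])
    moreover have "(\<integral>\<^sup>+e. ennreal (m t e) \<partial>lborel) = 1"
      using s logistic_bounds less_imp_le unfolding m_def \<theta> split_beta'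
      by (intro nn_integral_mix) auto
    ultimately show "(\<integral>\<^sup>+e. ennreal (gauss s0 e) * f (t, e) \<partial>lborel) = 1" by simp
  qed
  also have "\<dots> = 1"
    using prob_space.emeasure_space_1[OF Q.prob_space_distr[of obs_W "regressor_space d"]] by simp
  finally show ?thesis .
qed

lemma nn_integral_root_lr_le_1:
  assumes s: "0 < sigma2 \<theta>"
  shows "(\<integral>\<^sup>+v. ennreal (root_lr d alpha0 beta0 s0 \<theta> \<gamma> v) \<partial>Q) \<le> 1"
proof -
  interpret Q: prob_space Q by (rule regime_prob)
  note [measurable_cong] = regime_sets
  define r where "r v = obs_mix d alpha0 beta0 \<theta> \<gamma> v / gauss s0 (obs_eps v)" for v
  have r[measurable]: "r \<in> borel_measurable Q" unfolding r_def[abs_def] by measurable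
  have r0: "0 \<le> r v" for v unfolding r_def using obs_mix_pos[OF s] by (simp add: less_imp_le)
  have "(\<integral>\<^sup>+v. ennreal (root_lr d alpha0 beta0 s0 \<theta> \<gamma> v) \<partial>Q)
      \<le> (\<integral>\<^sup>+v. ennreal (1 / 2) + ennreal (1 / 2) * ennreal (r v) \<partial>Q)"
  proof (rule nn_integral_mono)
    fix v
    have "sqrt (1 * r v) \<le> (1 + r v) / 2" by (rule arith_geo_mean_sqrt) (use r0 in auto)
    hence "ennreal (sqrt (r v)) \<le> ennreal ((1 + r v) / 2)" by (intro ennreal_leI) simp
    also have "(1 + r v) / 2 = 1 / 2 + 1 / 2 * r v" by simp
    also have "ennreal (1 / 2 + 1 / 2 * r v) = ennreal (1 / 2) + ennreal (1 / 2 * r v)"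
      by (rule ennreal_plus) (use r0 in auto)
    also have "ennreal (1 / 2 * r v) = ennreal (1 / 2) * ennreal (r v)"
      by (rule ennreal_mult) (use r0 in auto)
    finally show "ennreal (root_lr d alpha0 beta0 s0 \<theta> \<gamma> v)
        \<le> ennreal (1 / 2) + ennreal (1 / 2) * ennreal (r v)" by (simp add: root_lr_def r_def)
  qed
  also have "\<dots> = ennreal (1 / 2) + ennreal (1 / 2) * (\<integral>\<^sup>+v. ennreal (r v) \<partial>Q)"
    by (subst nn_integral_add) (auto simp: nn_integral_cmult Q.emeasure_space_1)
  also have "(\<integral>\<^sup>+v. ennreal (r v) \<partial>Q) = 1"
    unfolding r_def by (rule nn_integral_likelihood_ratio[OF s])
  also have "ennreal (1 / 2) + ennreal (1 / 2) * 1 = 1"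
    using ennreal_plus[of "1 / 2" "1 / 2"] by simp
  finally show ?thesis .
qed

lemma regime_U_nn_integral:
  assumes f[measurable]: "f \<in> borel_measurable (borel \<Otimes>\<^sub>M borel)"
  shows "(\<integral>\<^sup>+v. f (obs_U v, obs_eps v) \<partial>Q)
    = (\<integral>\<^sup>+u. (\<integral>\<^sup>+e. ennreal (gauss s0 e) * f (u, e) \<partial>lborel) \<partial>distr Q borel obs_U)"
proof -
  define h :: "(real^'q) \<times> real \<times> (nat \<Rightarrow> real) \<times> bool \<Rightarrow> real^('q + unit)" where
    "h t = obs_U (0, fst t, fst (snd t), fst (snd (snd t)), 0, True)" for t
  have "(\<lambda>t. (0, fst t, fst (snd t), fst (snd (snd t)), 0, True)) \<in> measurable (regressor_space d) (obs_space d)"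
    unfolding obs_space_def by measurable
  hence h: "h \<in> measurable (regressor_space d) borel"
    unfolding h_def[abs_def] by (rule measurable_compose[OF _ measurable_obs_U])
  have eq: "h (obs_W v) = obs_U v" for v
    by (cases v) (auto simp: h_def obs_W_def obs_U_def obs_X_def obs_D_def obs_Z_def vec_eq_iff split: sum.split)
  show ?thesis using regime_nn_integral[OF h f] unfolding eq .
qed

end

section \<open>The affinity gap for equal weights\<close>

lemma continuous_AE_lborel_eq:
  fixes f g :: "real \<Rightarrow> real"
  assumes "continuous_on UNIV f" "continuous_on UNIV g" "AE x in lborel. f x = g x"
  shows "f x = g x"
proof -
  have op: "open {x. f x \<noteq> g x}"
    using assms(1,2) by (intro open_Collect_neq)
  have "{x. f x \<noteq> g x} \<in> null_sets lborel"
    using assms(3) op by (subst AE_iff_null_sets) auto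
  hence "negligible {x. f x \<noteq> g x}"
    by (simp add: negligible_iff_null_sets null_sets_completionI)
  hence "{x. f x \<noteq> g x} = {}" using op open_not_negligible by blast
  thus ?thesis by blast
qed

lemma continuous_mix: "0 < s \<Longrightarrow> continuous_on UNIV (\<lambda>e. mix w s a b e)"
  unfolding mix_def normal_density_def by (intro continuous_intros) auto

text \<open>
  The root likelihood ratio at \<open>\<gamma> = 0\<close>, where both weights are \<open>1/2\<close>, as a function of \<open>(U, \<epsilon>)\<close>. The law of this
  pair is the same for all \<open>n\<close>, in contrast to that of \<open>Z\<close>.
\<close>

definition half_root_lr :: "real^'q \<Rightarrow> real \<Rightarrow> real \<Rightarrow> 'q param \<Rightarrow> (real^('q::finite + unit)) \<times> real \<Rightarrow> real" where
  "half_root_lr a0 b0 s0 \<theta> x = sqrt (mix (1/2) (sigma2 \<theta>)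
       (fst x \<bullet> coef (fst \<theta> - a0) (fst (snd \<theta>) + fst (snd (snd \<theta>)) - b0))
       (fst x \<bullet> coef (fst \<theta> - a0) (fst (snd \<theta>) - b0)) (snd x) / gauss s0 (snd x))"

lemma logistic_0: "logistic 0 = 1 / 2" by (simp add: logistic_def)

lemma root_lr_zero_coefficient:
  "(\<And>j. j < d \<Longrightarrow> \<gamma> j = 0) \<Longrightarrow> root_lr d a0 b0 s0 \<theta> \<gamma> v = half_root_lr a0 b0 s0 \<theta> (obs_U v, obs_eps v)"
  by (cases \<theta>) (simp add: root_lr_def half_root_lr_def obs_mix_def dotp_def logistic_0)

lemma measurable_half_root_lr [measurable]: "half_root_lr a0 b0 s0 \<theta> \<in> borel_measurable (borel \<Otimes>\<^sub>M borel)"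
  unfolding half_root_lr_def[abs_def] by measurable

text \<open>
  An envelope for variances bounded below. It is integrable because \<open>exp (\<epsilon>\<^sup>2 / (4 s0))\<close> has the finite
  mean \<open>\<surd>2\<close> under the noise law.
\<close>

lemma half_root_lr_le:
  assumes "0 < s1" "s1 \<le> sigma2 \<theta>" "0 < s0"
  shows "half_root_lr a0 b0 s0 \<theta> (u, e) \<le> sqrt (sqrt (s0 / s1)) * exp (e\<^sup>2 / (4 * s0))"
proof -
  let ?s = "sigma2 \<theta>"
  have "mix (1/2) ?s x y e \<le> 1 / sqrt (2 * pi * s1)" for x y
  proof -
    have "mix (1/2) ?s x y e \<le> 1 / sqrt (2 * pi * ?s)" using assms by (intro mix_le) auto
    also have "\<dots> \<le> 1 / sqrt (2 * pi * s1)" using assms by (intro divide_left_mono) auto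
    finally show ?thesis .
  qed
  hence "mix (1/2) ?s x y e / gauss s0 e
      \<le> (1 / sqrt (2 * pi * s1)) / gauss s0 e" for x y
    by (intro divide_right_mono) auto
  also have "(1 / sqrt (2 * pi * s1)) / gauss s0 e
      = sqrt (s0 / s1) * (exp (e\<^sup>2 / (4 * s0)))\<^sup>2"
    unfolding normal_density_var[OF assms(3)] power2_eq_square exp_add[symmetric]
    by (simp add: real_sqrt_mult real_sqrt_divide exp_minus field_simps)
  finally have "half_root_lr a0 b0 s0 \<theta> (u, e) \<le> sqrt (sqrt (s0 / s1) * (exp (e\<^sup>2 / (4 * s0)))\<^sup>2)"
    unfolding half_root_lr_def by simp
  thus ?thesis by (simp add: real_sqrt_mult)
qed

lemma nn_integral_exp_square_noise:
  assumes "0 < s0"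
  shows "(\<integral>\<^sup>+e. ennreal (gauss s0 e) * ennreal (exp (e\<^sup>2 / (4 * s0))) \<partial>lborel) = ennreal (sqrt 2)"
proof -
  have "gauss s0 e * exp (e\<^sup>2 / (4 * s0)) = sqrt 2 * gauss (2 * s0) e" for e
  proof -
    have s2: "0 < 2 * s0" using assms by simp
    have "exp (- e\<^sup>2 / (2 * s0)) * exp (e\<^sup>2 / (4 * s0)) = exp (- e\<^sup>2 / (2 * (2 * s0)))"
      using assms by (simp add: exp_add[symmetric] field_simps)
    moreover have "sqrt (2 * pi * (2 * s0)) = sqrt 2 * sqrt (2 * pi * s0)"
      by (simp add: real_sqrt_mult)
    ultimately show ?thesis
      unfolding normal_density_var[OF assms] normal_density_var[OF s2] by simp
  qed
  hence "ennreal (gauss s0 e) * ennreal (exp (e\<^sup>2 / (4 * s0)))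
      = ennreal (sqrt 2) * ennreal (gauss (2 * s0) (e - 0))" for e
    by (simp add: ennreal_mult'[symmetric])
  thus ?thesis using assms
    by (simp only: nn_integral_cmult nn_integral_normal_density_shift[of "2 * s0"] measurable_lborel1
        borel_measurable_normal_density) (subst nn_integral_cmult, auto simp: nn_integral_normal_density_shift[of "2 * s0" 0, simplified])
qed

context
  fixes P :: "(real^('q::finite + unit)) measure" and a0 :: "real^'q" and b0 s0 :: real
  assumes P: "prob_space P" and P_sets: "sets P = sets borel" and s0: "0 < s0"
    and nondegenerate: "\<And>c. c \<noteq> 0 \<Longrightarrow> \<not> (AE u in P. u \<bullet> c = 0)"
begin

private abbreviation "PN \<equiv> P \<Otimes>\<^sub>M noise s0"

lemma prob_PN: "prob_space PN"
proof -
  have "prob_space (noise s0)" using s0 by (intro prob_space_normal_density) simp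
  then interpret pair_prob_space P "noise s0"
    using P by (simp add: pair_prob_space_def pair_sigma_finite_def prob_space.axioms(1)
      finite_measure.axioms(1) prob_space_imp_sigma_finite)
  show ?thesis by unfold_locales
qed

lemma sets_PN: "sets PN = sets (borel \<Otimes>\<^sub>M borel)"
  using P_sets by (intro sets_pair_measure_cong) auto

lemma nn_integral_PN:
  assumes f: "f \<in> borel_measurable (borel \<Otimes>\<^sub>M borel)"
  shows "(\<integral>\<^sup>+x. f x \<partial>PN) = (\<integral>\<^sup>+u. (\<integral>\<^sup>+e. ennreal (gauss s0 e) * f (u, e) \<partial>lborel) \<partial>P)"
proof -
  have "prob_space (noise s0)" using s0 by (intro prob_space_normal_density) simp
  then interpret N: sigma_finite_measure "noise s0"
    by (simp add: prob_space.axioms(1) finite_measure.axioms(1))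
  have fP[measurable]: "f \<in> borel_measurable PN" using f measurable_cong_sets[OF sets_PN refl] by auto
  have "(\<integral>\<^sup>+x. f x \<partial>PN) = (\<integral>\<^sup>+u. (\<integral>\<^sup>+e. f (u, e) \<partial>noise s0) \<partial>P)"
    by (rule N.nn_integral_fst[symmetric, OF fP])
  also have "\<dots> = (\<integral>\<^sup>+u. (\<integral>\<^sup>+e. ennreal (gauss s0 e) * f (u, e) \<partial>lborel) \<partial>P)"
  proof (intro nn_integral_cong nn_integral_density)
    fix u :: "real^('q + unit)"
    show "(\<lambda>e. ennreal (gauss s0 e)) \<in> borel_measurable lborel" by measurable
    have "(\<lambda>e. f (u, e)) \<in> borel_measurable borel" using f by simp
    thus "(\<lambda>e. f (u, e)) \<in> borel_measurable lborel" by simp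
  qed
  finally show ?thesis .
qed

lemma measurable_PN: "f \<in> borel_measurable (borel \<Otimes>\<^sub>M borel) \<Longrightarrow> f \<in> borel_measurable PN"
  using measurable_cong_sets[OF sets_PN refl] by auto

lemma envelope_integrable: "integrable PN (\<lambda>x. C * exp ((snd x)\<^sup>2 / (4 * s0)))"
proof -
  have "integrable PN (\<lambda>x. exp ((snd x)\<^sup>2 / (4 * s0)))"
  proof (rule integrableI_bounded)
    show "(\<lambda>x. exp ((snd x)\<^sup>2 / (4 * s0))) \<in> borel_measurable PN"
      by (rule measurable_PN) measurable
    have "(\<integral>\<^sup>+x. ennreal (exp ((snd x)\<^sup>2 / (4 * s0))) \<partial>PN) = (\<integral>\<^sup>+u. ennreal (sqrt 2) \<partial>P)"
      using nn_integral_exp_square_noise[OF s0] by (subst nn_integral_PN) auto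
    also have "\<dots> < \<infinity>" using prob_space.emeasure_space_1[OF P] by simp
    finally show "(\<integral>\<^sup>+x. ennreal (norm (exp ((snd x)\<^sup>2 / (4 * s0)))) \<partial>PN) < \<infinity>" by simp
  qed
  thus ?thesis by simp
qed

lemma half_root_lr_nonneg: "0 < sigma2 \<theta> \<Longrightarrow> 0 \<le> half_root_lr a0 b0 s0 \<theta> x"
  unfolding half_root_lr_def by (intro real_sqrt_ge_zero divide_nonneg_nonneg mix_nonneg) auto

lemma half_root_lr_integrable:
  assumes "0 < sigma2 \<theta>"
  shows "integrable PN (half_root_lr a0 b0 s0 \<theta>)"
proof (rule Bochner_Integration.integrable_bound[OF envelope_integrable])
  show "half_root_lr a0 b0 s0 \<theta> \<in> borel_measurable PN" by (rule measurable_PN) measurable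
  show "AE x in PN. norm (half_root_lr a0 b0 s0 \<theta> x)
      \<le> norm (sqrt (sqrt (s0 / sigma2 \<theta>)) * exp ((snd x)\<^sup>2 / (4 * s0)))"
  proof (rule AE_I2)
    fix x :: "(real^('q + unit)) \<times> real"
    show "norm (half_root_lr a0 b0 s0 \<theta> x)
      \<le> norm (sqrt (sqrt (s0 / sigma2 \<theta>)) * exp ((snd x)\<^sup>2 / (4 * s0)))"
      using half_root_lr_le[OF assms order_refl s0, of a0 b0 "fst x" "snd x"] half_root_lr_nonneg[OF assms, of x]
      by simp
  qed
qed

definition affinity :: "'q param \<Rightarrow> real" where
  "affinity \<theta> = (\<integral>x. half_root_lr a0 b0 s0 \<theta> x \<partial>PN)"

lemma continuous_on_coef [continuous_intros]:
  fixes f :: "'c::topological_space \<Rightarrow> real^'q"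
  assumes "continuous_on S f" "continuous_on S g"
  shows "continuous_on S (\<lambda>x. coef (f x) (g x))"
  unfolding coef_def
proof (rule continuous_on_vec_lambda)
  fix k :: "'q + unit"
  show "continuous_on S (\<lambda>x. case k of Inl i \<Rightarrow> f x $ i | Inr _ \<Rightarrow> g x)"
    using assms by (cases k) (auto intro!: continuous_intros)
qed

lemma continuous_on_half_root_lr:
  assumes "\<And>\<theta>. \<theta> \<in> K \<Longrightarrow> 0 < sigma2 \<theta>"
  shows "continuous_on K (\<lambda>\<theta>. half_root_lr a0 b0 s0 \<theta> x)"
  unfolding half_root_lr_def mix_def normal_density_def using s0 assms
  by (intro continuous_intros) (auto simp: less_imp_neq[symmetric])

lemma continuous_on_affinity:
  assumes s1: "0 < s1" "\<And>\<theta>. \<theta> \<in> K \<Longrightarrow> s1 \<le> sigma2 \<theta>"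
  shows "continuous_on K affinity"
  unfolding continuous_on_sequentially
proof (intro allI ballI impI)
  fix \<theta> :: "nat \<Rightarrow> 'q param" and t
  assume t: "t \<in> K" and "(\<forall>n. \<theta> n \<in> K) \<and> \<theta> \<longlonglongrightarrow> t"
  hence \<theta>: "\<And>n. \<theta> n \<in> K" "\<theta> \<longlonglongrightarrow> t" by auto
  have pos: "0 < sigma2 k" if "k \<in> K" for k
    using s1(1) s1(2)[OF that] by linarith
  show "(affinity \<circ> \<theta>) \<longlonglongrightarrow> affinity t"
    unfolding comp_def affinity_def
  proof (rule integral_dominated_convergence[OF _ _ envelope_integrable])
    show "half_root_lr a0 b0 s0 t \<in> borel_measurable PN" by (rule measurable_PN) measurable
    show "half_root_lr a0 b0 s0 (\<theta> n) \<in> borel_measurable PN" for n by (rule measurable_PN) measurable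
    show "AE x in PN. (\<lambda>n. half_root_lr a0 b0 s0 (\<theta> n) x) \<longlonglongrightarrow> half_root_lr a0 b0 s0 t x"
      using continuous_on_half_root_lr[OF pos] t \<theta>
      unfolding continuous_on_sequentially comp_def by (intro AE_I2) blast
    show "AE x in PN. norm (half_root_lr a0 b0 s0 (\<theta> n) x) \<le> sqrt (sqrt (s0 / s1)) * exp ((snd x)\<^sup>2 / (4 * s0))" for n
    proof (rule AE_I2)
      fix x :: "(real^('q + unit)) \<times> real"
      show "norm (half_root_lr a0 b0 s0 (\<theta> n) x) \<le> sqrt (sqrt (s0 / s1)) * exp ((snd x)\<^sup>2 / (4 * s0))"
        using half_root_lr_le[OF s1(1) s1(2)[OF \<theta>(1)[of n]] s0, of a0 b0 "fst x" "snd x"]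
          half_root_lr_nonneg[OF pos[OF \<theta>(1)[of n]], of x] by simp
    qed
  qed
qed

text \<open>
  With \<open>G\<close> the root likelihood ratio, \<open>E (G - 1)\<^sup>2 = 2 - 2 E G\<close> because \<open>E G\<^sup>2 = 1\<close>. Affinity one therefore
  forces the two densities to agree almost everywhere, and the identification lemma applies to almost every
  value of \<open>U\<close>. Nondegeneracy of \<open>U\<close> turns vanishing component means into equality of the coefficients.
\<close>

lemma affinity_lt_1:
  assumes s: "0 < sigma2 \<theta>" and ne: "\<theta> \<noteq> (a0, b0, 0, s0)"
  shows "affinity \<theta> < 1"
proof (rule ccontr)
  assume "\<not> affinity \<theta> < 1"
  interpret PN: prob_space PN by (rule prob_PN)
  obtain \<alpha> \<beta> lam s where \<theta>: "\<theta> = (\<alpha>, \<beta>, lam, s)" by (cases \<theta>)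
  have s': "0 < s" using s \<theta> by simp
  define c1 c2 where "c1 = coef (\<alpha> - a0) (\<beta> + lam - b0)" and "c2 = coef (\<alpha> - a0) (\<beta> - b0)"
  define m where "m = (\<lambda>x :: (real^('q + unit)) \<times> real. mix (1/2) s (fst x \<bullet> c1) (fst x \<bullet> c2) (snd x))"
  define G where "G = half_root_lr a0 b0 s0 \<theta>"
  have Gm[measurable]: "G \<in> borel_measurable PN" unfolding G_def by (rule measurable_PN) measurable
  have m_borel[measurable]: "m \<in> borel_measurable (borel \<Otimes>\<^sub>M borel)" unfolding m_def by measurable
  have m0: "0 \<le> m x" for x unfolding m_def by (intro mix_nonneg) auto
  have G2: "(G x)\<^sup>2 = m x / gauss s0 (snd x)" for x
    using m0[of x] by (simp add: G_def half_root_lr_def \<theta> m_def c1_def c2_def)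
  have int2: "(\<integral>\<^sup>+x. ennreal ((G x)\<^sup>2) \<partial>PN) = 1"
  proof -
    have "(\<integral>\<^sup>+x. ennreal ((G x)\<^sup>2) \<partial>PN) = (\<integral>\<^sup>+u. (\<integral>\<^sup>+e. ennreal (gauss s0 e)
        * ennreal (m (u, e) / gauss s0 e) \<partial>lborel) \<partial>P)"
      unfolding G2 by (subst nn_integral_PN) auto
    also have "\<dots> = (\<integral>\<^sup>+u. 1 \<partial>P)"
    proof (rule nn_integral_cong)
      fix u
      have "ennreal (gauss s0 e) * ennreal (m (u, e) / gauss s0 e)
          = ennreal (mix (1/2) s (u \<bullet> c1) (u \<bullet> c2) e)" for e
        using normal_density_pos[of "sqrt s0" 0 e] s0 by (simp add: m_def ennreal_mult'[symmetric])
      thus "(\<integral>\<^sup>+e. ennreal (gauss s0 e)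
          * ennreal (m (u, e) / gauss s0 e) \<partial>lborel) = 1"
        using nn_integral_mix[OF s', of "1/2"] by simp
    qed
    also have "\<dots> = 1" using prob_space.emeasure_space_1[OF P] by simp
    finally show ?thesis .
  qed
  have intG: "integrable PN G" unfolding G_def by (rule half_root_lr_integrable[OF s])
  have intG2: "integrable PN (\<lambda>x. (G x)\<^sup>2)"
    using int2 by (intro integrableI_bounded) auto
  have "ennreal (\<integral>x. (G x)\<^sup>2 \<partial>PN) = 1"
    using int2 intG2 by (subst nn_integral_eq_integral[symmetric]) auto
  hence "(\<integral>x. (G x)\<^sup>2 \<partial>PN) = 1" by (metis ennreal_eq_1)
  hence "(\<integral>x. (G x - 1)\<^sup>2 \<partial>PN) = 2 - 2 * affinity \<theta>"
    using intG intG2 PN.prob_space by (simp add: power2_diff affinity_def G_def)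
  hence le0: "(\<integral>x. (G x - 1)\<^sup>2 \<partial>PN) \<le> 0" using \<open>\<not> affinity \<theta> < 1\<close> by simp
  have int1: "integrable PN (\<lambda>x. (G x - 1)\<^sup>2)"
    unfolding power2_diff using intG intG2 by (intro Bochner_Integration.integrable_add Bochner_Integration.integrable_diff) auto
  have "0 \<le> (\<integral>x. (G x - 1)\<^sup>2 \<partial>PN)" by simp
  hence "(\<integral>x. (G x - 1)\<^sup>2 \<partial>PN) = 0" using le0 by linarith
  hence "AE x in PN. (G x - 1)\<^sup>2 = 0"
    using integral_nonneg_eq_0_iff_AE[OF int1] by simp
  hence ae: "AE x in PN. m x = gauss s0 (snd x)"
  proof eventually_elim
    case (elim x)
    hence "(G x)\<^sup>2 = 1" by simp
    thus ?case using normal_density_pos[of "sqrt s0" 0 "snd x"] s0 unfolding G2 by simp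
  qed
  have pN: "prob_space (noise s0)" using s0 by (intro prob_space_normal_density) simp
  interpret PsN: pair_sigma_finite P "noise s0"
    using P pN by (simp add: pair_sigma_finite_def prob_space_imp_sigma_finite)
  have "AE u in P. AE e in noise s0. m (u, e) = gauss s0 e"
    using PsN.AE_pair[OF ae] by simp
  hence ident: "AE u in P. s = s0 \<and> u \<bullet> c1 = 0 \<and> u \<bullet> c2 = 0"
  proof eventually_elim
    case (elim u)
    hence "AE e in lborel. mix (1/2) s (u \<bullet> c1) (u \<bullet> c2) e = gauss s0 e"
      using s0 by (simp add: AE_density m_def normal_density_pos)
    hence "mix (1/2) s (u \<bullet> c1) (u \<bullet> c2) e = gauss s0 e" for e
      using s0 by (intro continuous_AE_lborel_eq continuous_mix[OF s'])
        (auto simp: normal_density_def intro!: continuous_intros)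
    thus ?case by (rule mix_half_identifiable[OF s' s0])
  qed
  hence "AE u in P. u \<bullet> c1 = 0" "AE u in P. u \<bullet> c2 = 0" by auto
  hence "c1 = 0" "c2 = 0" using nondegenerate by blast+
  hence "\<alpha> = a0" "\<beta> = b0" "lam = 0" by (auto simp: c1_def c2_def coef_eq_0_iff)
  moreover have "s = s0"
  proof -
    interpret P: prob_space P by (rule P)
    have "AE u in P. s = s0" using ident by auto
    thus ?thesis by simp
  qed
  ultimately show False using ne \<theta> by simp
qed

lemma nn_integral_affinity:
  assumes "0 < sigma2 \<theta>"
  shows "(\<integral>\<^sup>+u. (\<integral>\<^sup>+e. ennreal (gauss s0 e) * ennreal (half_root_lr a0 b0 s0 \<theta> (u, e)) \<partial>lborel) \<partial>P)
    = ennreal (affinity \<theta>)"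
proof -
  have "(\<integral>\<^sup>+x. ennreal (half_root_lr a0 b0 s0 \<theta> x) \<partial>PN) = ennreal (affinity \<theta>)"
    unfolding affinity_def using half_root_lr_integrable[OF assms] half_root_lr_nonneg[OF assms]
    by (intro nn_integral_eq_integral) auto
  thus ?thesis by (subst (asm) nn_integral_PN) auto
qed

text \<open>
  The affinity is continuous by dominated convergence, so it attains its maximum on a compact set, and that maximum
  is less than one when the set omits the true parameter.
\<close>

lemma affinity_gap:
  assumes K: "compact K" "\<And>\<theta>. \<theta> \<in> K \<Longrightarrow> 0 < sigma2 \<theta>" "(a0, b0, 0, s0) \<notin> K"
  obtains \<rho> where "0 \<le> \<rho>" "\<rho> < 1"
    "\<And>\<theta>. \<theta> \<in> K \<Longrightarrow> (\<integral>\<^sup>+u. (\<integral>\<^sup>+e. ennreal (gauss s0 e)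
        * ennreal (half_root_lr a0 b0 s0 \<theta> (u, e)) \<partial>lborel) \<partial>P) \<le> ennreal \<rho>"
proof (cases "K = {}")
  case True
  thus thesis using that[of 0] by auto
next
  case False
  have "\<exists>k\<in>K. \<forall>\<theta>\<in>K. sigma2 k \<le> sigma2 \<theta>"
    by (rule continuous_attains_inf[OF K(1) False]) (intro continuous_intros)
  then obtain k where k: "k \<in> K" "\<And>\<theta>. \<theta> \<in> K \<Longrightarrow> sigma2 k \<le> sigma2 \<theta>" by blast
  have "continuous_on K affinity" by (rule continuous_on_affinity[OF K(2)[OF k(1)] k(2)])
  then obtain m where m: "m \<in> K" "\<And>\<theta>. \<theta> \<in> K \<Longrightarrow> affinity \<theta> \<le> affinity m"
    using continuous_attains_sup[OF K(1) False] by blast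
  have "affinity m < 1" using m(1) K by (intro affinity_lt_1) auto
  moreover have "0 \<le> affinity m" unfolding affinity_def
    using half_root_lr_nonneg[OF K(2)[OF m(1)]] by (intro integral_nonneg_AE AE_I2)
  ultimately show thesis
    using that[of "affinity m"] m(2) K(2) by (auto simp: nn_integral_affinity intro: ennreal_leI)
qed

end

section \<open>Deterministic bounds on the log-likelihood\<close>

definition log_lik :: "nat \<Rightarrow> nat \<Rightarrow> real^'q \<Rightarrow> real \<Rightarrow> (nat \<Rightarrow> ('q::finite) obs) \<Rightarrow> 'q param \<Rightarrow> (nat \<Rightarrow> real) \<Rightarrow> real" where
  "log_lik n d a0 b0 v \<theta> \<gamma> = (\<Sum>i<n. ln (obs_mix d a0 b0 \<theta> \<gamma> (v i)))"

definition log_lik0 :: "nat \<Rightarrow> real \<Rightarrow> (nat \<Rightarrow> ('q::finite) obs) \<Rightarrow> real" where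
  "log_lik0 n s0 v = (\<Sum>i<n. ln (gauss s0 (obs_eps (v i))))"

lemma ln_normal_density:
  assumes "0 < s"
  shows "ln (gauss s x) = - ln (2 * pi * s) / 2 - x\<^sup>2 / (2 * s)"
proof -
  have "ln (gauss s x) = - x\<^sup>2 / (2 * s) - ln (sqrt (2 * pi * s))"
    unfolding normal_density_var[OF assms] using assms by (subst ln_div) auto
  thus ?thesis using assms by (simp add: ln_sqrt)
qed

lemma log_lik0_ge:
  assumes "0 < s0" "(\<Sum>i<n. (obs_eps (v i))\<^sup>2) \<le> 4 * s0 * n"
  shows "- n * ln (2 * pi * s0) / 2 - 2 * n \<le> log_lik0 n s0 v"
proof -
  have "log_lik0 n s0 v = - n * ln (2 * pi * s0) / 2 - (\<Sum>i<n. (obs_eps (v i))\<^sup>2) / (2 * s0)"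
    using assms(1) by (simp add: log_lik0_def ln_normal_density sum_subtractf sum_divide_distrib sum_negf)
  moreover have "(\<Sum>i<n. (obs_eps (v i))\<^sup>2) / (2 * s0) \<le> 2 * n"
    using assms by (simp add: divide_simps mult_ac)
  ultimately show ?thesis by linarith
qed

lemma log_lik_eq_log_lik0_add:
  assumes "0 < s0" "0 < sigma2 \<theta>"
  shows "log_lik n d a0 b0 v \<theta> \<gamma> = log_lik0 n s0 v + 2 * ln (\<Prod>i<n. root_lr d a0 b0 s0 \<theta> \<gamma> (v i))"
proof -
  have "ln (\<Prod>i<n. root_lr d a0 b0 s0 \<theta> \<gamma> (v i)) = (\<Sum>i<n. ln (root_lr d a0 b0 s0 \<theta> \<gamma> (v i)))"
    using root_lr_pos[OF assms] by (intro ln_prod) (auto simp: less_imp_neq[symmetric])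
  also have "\<dots> = (\<Sum>i<n. (ln (obs_mix d a0 b0 \<theta> \<gamma> (v i)) - ln (gauss s0 (obs_eps (v i)))) / 2)"
  proof (rule sum.cong[OF refl])
    fix i
    have "0 < obs_mix d a0 b0 \<theta> \<gamma> (v i)" "0 < gauss s0 (obs_eps (v i))"
      using obs_mix_pos[OF assms(2)] normal_density_pos[of "sqrt s0"] assms(1) by auto
    thus "ln (root_lr d a0 b0 s0 \<theta> \<gamma> (v i))
        = (ln (obs_mix d a0 b0 \<theta> \<gamma> (v i)) - ln (gauss s0 (obs_eps (v i)))) / 2"
      unfolding root_lr_def by (subst ln_sqrt) (simp_all add: ln_div)
  qed
  also have "\<dots> = (log_lik n d a0 b0 v \<theta> \<gamma> - log_lik0 n s0 v) / 2"
    by (simp add: log_lik_def log_lik0_def sum_divide_distrib[symmetric] sum_subtractf)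
  finally show ?thesis by simp
qed

lemma ln_obs_mix_le:
  assumes s: "0 < sigma2 \<theta>"
  shows "ln (obs_mix d a0 b0 \<theta> \<gamma> v) \<le> - ln (2 * pi * sigma2 \<theta>) / 2"
proof -
  let ?s = "sigma2 \<theta>"
  have "obs_mix d a0 b0 \<theta> \<gamma> v \<le> 1 / sqrt (2 * pi * ?s)"
    unfolding obs_mix_def split_beta' using logistic_bounds s by (intro mix_le) (auto intro: less_imp_le)
  hence "ln (obs_mix d a0 b0 \<theta> \<gamma> v) \<le> ln (1 / sqrt (2 * pi * ?s))"
    using obs_mix_pos[OF s] s by (subst ln_le_cancel_iff) auto
  also have "\<dots> = - ln (2 * pi * ?s) / 2" using s by (simp add: ln_div ln_sqrt)
  finally show ?thesis .
qed

lemma ln_obs_mix_le_away: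
  assumes s: "0 < s" and \<kappa>: "0 \<le> \<kappa>"
    and away: "\<kappa> \<le> \<bar>obs_eps v - obs_U v \<bullet> coef (\<alpha> - a0) (\<beta> + lam - b0)\<bar>"
      "\<kappa> \<le> \<bar>obs_eps v - obs_U v \<bullet> coef (\<alpha> - a0) (\<beta> - b0)\<bar>"
  shows "ln (obs_mix d a0 b0 (\<alpha>, \<beta>, lam, s) \<gamma> v) \<le> - ln (2 * pi * s) / 2 - \<kappa>\<^sup>2 / (2 * s)"
proof -
  have "obs_mix d a0 b0 (\<alpha>, \<beta>, lam, s) \<gamma> v \<le> exp (- \<kappa>\<^sup>2 / (2 * s)) / sqrt (2 * pi * s)"
    unfolding obs_mix_def prod.case using logistic_bounds assms
    by (intro mix_le_away) (auto intro: less_imp_le)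
  hence "ln (obs_mix d a0 b0 (\<alpha>, \<beta>, lam, s) \<gamma> v) \<le> ln (exp (- \<kappa>\<^sup>2 / (2 * s)) / sqrt (2 * pi * s))"
    using obs_mix_pos[of "(\<alpha>, \<beta>, lam, s)"] s by (subst ln_le_cancel_iff) auto
  also have "\<dots> = - ln (2 * pi * s) / 2 - \<kappa>\<^sup>2 / (2 * s)" using s by (simp add: ln_div ln_sqrt)
  finally show ?thesis .
qed

lemma log_lik_le:
  assumes "0 < sigma2 \<theta>"
  shows "log_lik n d a0 b0 v \<theta> \<gamma> \<le> - n * ln (2 * pi * sigma2 \<theta>) / 2"
proof -
  have "log_lik n d a0 b0 v \<theta> \<gamma> \<le> (\<Sum>i<n. - ln (2 * pi * sigma2 \<theta>) / 2)"
    unfolding log_lik_def by (intro sum_mono ln_obs_mix_le assms)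
  thus ?thesis by simp
qed

definition small_resid :: "nat \<Rightarrow> (nat \<Rightarrow> ('q::finite) obs) \<Rightarrow> real \<Rightarrow> real^('q + unit) \<Rightarrow> nat set" where
  "small_resid n v \<kappa> c = {i. i < n \<and> \<bar>obs_eps (v i) - obs_U (v i) \<bullet> c\<bar> < \<kappa>}"

text \<open>
  An observation whose residuals from both regimes are at least \<open>\<kappa>\<close> loses \<open>\<kappa>\<^sup>2 / (2 s)\<close> against the trivial
  bound \<open>- ln (2 \<pi> s) / 2\<close>. If each regime has at most \<open>n / 4\<close> small residuals, at least half of the
  observations lose this much, which rules out \<open>s\<close> near zero.
\<close>

lemma log_lik_le_small_resid:
  assumes s: "0 < s" and \<kappa>: "0 \<le> \<kappa>"
    and few: "real (card (small_resid n v \<kappa> (coef (\<alpha> - a0) (\<beta> + lam - b0)))) \<le> n / 4"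
      "real (card (small_resid n v \<kappa> (coef (\<alpha> - a0) (\<beta> - b0)))) \<le> n / 4"
  shows "log_lik n d a0 b0 v (\<alpha>, \<beta>, lam, s) \<gamma> \<le> n * (- ln (2 * pi * s) / 2 - \<kappa>\<^sup>2 / (4 * s))"
proof -
  define B where "B = small_resid n v \<kappa> (coef (\<alpha> - a0) (\<beta> + lam - b0)) \<union> small_resid n v \<kappa> (coef (\<alpha> - a0) (\<beta> - b0))"
  have B: "B \<subseteq> {..<n}" by (auto simp: B_def small_resid_def)
  have "card B \<le> card (small_resid n v \<kappa> (coef (\<alpha> - a0) (\<beta> + lam - b0)))
      + card (small_resid n v \<kappa> (coef (\<alpha> - a0) (\<beta> - b0)))"
    unfolding B_def by (rule card_Un_le)
  hence cB: "real (card B) \<le> n / 2" using few by linarith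
  have "log_lik n d a0 b0 v (\<alpha>, \<beta>, lam, s) \<gamma>
      \<le> (\<Sum>i<n. - ln (2 * pi * s) / 2 - (if i \<in> B then 0 else \<kappa>\<^sup>2 / (2 * s)))"
    unfolding log_lik_def
  proof (rule sum_mono)
    fix i assume i: "i \<in> {..<n}"
    show "ln (obs_mix d a0 b0 (\<alpha>, \<beta>, lam, s) \<gamma> (v i))
        \<le> - ln (2 * pi * s) / 2 - (if i \<in> B then 0 else \<kappa>\<^sup>2 / (2 * s))"
    proof (cases "i \<in> B")
      case True
      thus ?thesis using ln_obs_mix_le[of "(\<alpha>, \<beta>, lam, s)"] s by simp
    next
      case False
      hence "\<kappa> \<le> \<bar>obs_eps (v i) - obs_U (v i) \<bullet> coef (\<alpha> - a0) (\<beta> + lam - b0)\<bar>"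
        "\<kappa> \<le> \<bar>obs_eps (v i) - obs_U (v i) \<bullet> coef (\<alpha> - a0) (\<beta> - b0)\<bar>"
        using i by (auto simp: B_def small_resid_def)
      thus ?thesis using ln_obs_mix_le_away[OF s \<kappa>] False by simp
    qed
  qed
  also have "\<dots> = - n * ln (2 * pi * s) / 2 - (\<Sum>i\<in>{..<n} - B. \<kappa>\<^sup>2 / (2 * s))"
  proof -
    have "(\<Sum>i<n. if i \<in> B then 0 else \<kappa>\<^sup>2 / (2 * s)) = (\<Sum>i\<in>{..<n} - B. \<kappa>\<^sup>2 / (2 * s))"
      by (simp add: sum.If_cases Diff_eq)
    thus ?thesis by (simp add: sum_subtractf)
  qed
  also have "(\<Sum>i\<in>{..<n} - B. \<kappa>\<^sup>2 / (2 * s)) = (n - card B) * (\<kappa>\<^sup>2 / (2 * s))"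
    using B by (simp add: card_Diff_subset finite_subset of_nat_diff card_mono[of "{..<n}" B, simplified])
  also have "- n * ln (2 * pi * s) / 2 - (n - card B) * (\<kappa>\<^sup>2 / (2 * s))
      \<le> - n * ln (2 * pi * s) / 2 - (n / 2) * (\<kappa>\<^sup>2 / (2 * s))"
    using cB s by (intro diff_left_mono mult_right_mono) auto
  also have "\<dots> = n * (- ln (2 * pi * s) / 2 - \<kappa>\<^sup>2 / (4 * s))" by (simp add: algebra_simps)
  finally show ?thesis .
qed

lemma norm_coef_param_le:
  fixes s :: real
  shows
  "norm (coef (\<alpha> - a0) (\<beta> + lam - b0)) \<le> 3 * norm (\<alpha>, \<beta>, lam, s) + norm a0 + \<bar>b0\<bar>" (is ?A)
  "norm (coef (\<alpha> - a0) (\<beta> - b0)) \<le> 3 * norm (\<alpha>, \<beta>, lam, s) + norm a0 + \<bar>b0\<bar>" (is ?B)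
proof -
  let ?N = "norm (\<alpha>, \<beta>, lam, s)"
  have n: "norm \<alpha> \<le> ?N" "norm (\<beta>, lam, s) \<le> ?N" using norm_fst_le[of \<alpha> "(\<beta>, lam, s)"] norm_snd_le[of "(\<beta>, lam, s)" \<alpha>] by auto
  have n': "\<bar>\<beta>\<bar> \<le> norm (\<beta>, lam, s)" "norm (lam, s) \<le> norm (\<beta>, lam, s)"
    using norm_fst_le[of \<beta> "(lam, s)"] norm_snd_le[of "(lam, s)" \<beta>] by auto
  have n'': "\<bar>lam\<bar> \<le> norm (lam, s)" using norm_fst_le[of lam s] by auto
  have "norm (\<alpha> - a0) \<le> norm \<alpha> + norm a0" by (rule norm_triangle_ineq4)
  thus ?A ?B using norm_coef_le[of "\<alpha> - a0" "\<beta> + lam - b0"] norm_coef_le[of "\<alpha> - a0" "\<beta> - b0"] n n' n''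
    by linarith+
qed

lemma param_dist_components:
  assumes "dist (\<alpha>, \<beta>, lam, s) (\<alpha>', \<beta>', lam', s') \<le> \<eta>"
  shows "norm (\<alpha> - \<alpha>') \<le> \<eta>" "\<bar>\<beta> - \<beta>'\<bar> \<le> \<eta>" "\<bar>lam - lam'\<bar> \<le> \<eta>" "\<bar>s - s'\<bar> \<le> \<eta>"
proof -
  let ?x = "(\<alpha>, \<beta>, lam, s)" and ?y = "(\<alpha>', \<beta>', lam', s')"
  have 1: "dist \<alpha> \<alpha>' \<le> dist ?x ?y" using dist_fst_le[of ?x ?y] by simp
  have 2: "dist (\<beta>, lam, s) (\<beta>', lam', s') \<le> dist ?x ?y" using dist_snd_le[of ?x ?y] by simp
  have 3: "dist \<beta> \<beta>' \<le> dist (\<beta>, lam, s) (\<beta>', lam', s')"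
    using dist_fst_le[of "(\<beta>, lam, s)" "(\<beta>', lam', s')"] by simp
  have 4: "dist (lam, s) (lam', s') \<le> dist (\<beta>, lam, s) (\<beta>', lam', s')"
    using dist_snd_le[of "(\<beta>, lam, s)" "(\<beta>', lam', s')"] by simp
  have 5: "dist lam lam' \<le> dist (lam, s) (lam', s')" using dist_fst_le[of "(lam, s)" "(lam', s')"] by simp
  have 6: "dist s s' \<le> dist (lam, s) (lam', s')" using dist_snd_le[of "(lam, s)" "(lam', s')"] by simp
  show "norm (\<alpha> - \<alpha>') \<le> \<eta>" "\<bar>\<beta> - \<beta>'\<bar> \<le> \<eta>" "\<bar>lam - lam'\<bar> \<le> \<eta>" "\<bar>s - s'\<bar> \<le> \<eta>"
    using assms 1 2 3 4 5 6 by (auto simp: dist_norm)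
qed

text \<open>
  The accumulated change of the log-likelihood over a grid cell of diameter \<open>n\<^sup>-\<^sup>3\<close>, for parameters of norm at
  most \<open>L\<close> with variance at least \<open>s1\<close> and observations bounded by \<open>n\<close>. The number \<open>\<Lambda>\<close> bounds the residuals
  divided by \<open>n\<close>.
\<close>

definition lip_const :: "real^'q::finite \<Rightarrow> real \<Rightarrow> real \<Rightarrow> real \<Rightarrow> real" where
  "lip_const a0 b0 L s1 = (let \<Lambda> = 3 * L + norm a0 + \<bar>b0\<bar> + 1 in 1 / s1 + 3 * \<Lambda> / s1 + \<Lambda>\<^sup>2 / s1\<^sup>2)"

text \<open>
  One observation contributes at most a constant multiple of \<open>n\<^sup>2\<close> times the mesh, from squared residuals of order \<open>n\<^sup>2\<close>;
  with mesh \<open>n\<^sup>-\<^sup>3\<close> the sum over the sample stays bounded.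
\<close>

lemma log_lik_param_lipschitz:
  fixes \<theta> t :: "('q::finite) param"
  assumes n: "1 \<le> n" and s1: "0 < s1" "s1 \<le> sigma2 \<theta>" "s1 \<le> sigma2 t"
    and L: "norm \<theta> \<le> L" "norm t \<le> L" and dist: "dist \<theta> t \<le> 1 / real n ^ 3"
    and v: "\<And>i. i < n \<Longrightarrow> \<bar>obs_eps (v i)\<bar> \<le> n" "\<And>i. i < n \<Longrightarrow> norm (obs_U (v i)) \<le> n"
  shows "log_lik n d a0 b0 v \<theta> \<gamma> \<le> log_lik n d a0 b0 v t \<gamma> + lip_const a0 b0 L s1"
proof -
  obtain \<alpha> \<beta> lam s where \<theta>: "\<theta> = (\<alpha>, \<beta>, lam, s)" by (cases \<theta>)
  obtain \<alpha>' \<beta>' lam' s' where t: "t = (\<alpha>', \<beta>', lam', s')" by (cases t)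
  define \<Lambda> where "\<Lambda> = 3 * L + norm a0 + \<bar>b0\<bar> + 1"
  define \<eta> where "\<eta> = 1 / real n ^ 3"
  define E where "E = \<eta> / s1 + (n * \<Lambda>) * (n * (3 * \<eta>)) / s1 + (n * \<Lambda>)\<^sup>2 * \<eta> / s1\<^sup>2"
  have "0 \<le> L" using L(1) norm_ge_zero[of \<theta>] by linarith
  hence \<Lambda>1: "1 \<le> \<Lambda>" by (simp add: \<Lambda>_def)
  have comp: "norm (\<alpha> - \<alpha>') \<le> \<eta>" "\<bar>\<beta> - \<beta>'\<bar> \<le> \<eta>" "\<bar>lam - lam'\<bar> \<le> \<eta>" "\<bar>s - s'\<bar> \<le> \<eta>"
    using param_dist_components[of \<alpha> \<beta> lam s \<alpha>' \<beta>' lam' s' \<eta>] dist unfolding \<theta> t \<eta>_def by auto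
  have res: "\<bar>obs_eps (v i) - obs_U (v i) \<bullet> c\<bar> \<le> n * \<Lambda>" if i: "i < n" and c: "norm c \<le> \<Lambda> - 1" for i c
  proof -
    have "\<bar>obs_U (v i) \<bullet> c\<bar> \<le> norm (obs_U (v i)) * norm c" by (rule Cauchy_Schwarz_ineq2)
    also have "\<dots> \<le> n * (\<Lambda> - 1)" using v(2)[OF i] c by (intro mult_mono) auto
    finally show ?thesis using v(1)[OF i] by (simp add: algebra_simps)
  qed
  have diff: "\<bar>obs_U (v i) \<bullet> c - obs_U (v i) \<bullet> c'\<bar> \<le> n * (3 * \<eta>)"
    if i: "i < n" and c: "norm (c - c') \<le> 3 * \<eta>" for i c c'
  proof -
    have "\<bar>obs_U (v i) \<bullet> (c - c')\<bar> \<le> norm (obs_U (v i)) * norm (c - c')" by (rule Cauchy_Schwarz_ineq2)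
    also have "\<dots> \<le> n * (3 * \<eta>)" using v(2)[OF i] c by (intro mult_mono) auto
    finally show ?thesis by (simp add: inner_diff_right)
  qed
  have c\<theta>: "norm (coef (\<alpha> - a0) (\<beta> + lam - b0)) \<le> \<Lambda> - 1" "norm (coef (\<alpha> - a0) (\<beta> - b0)) \<le> \<Lambda> - 1"
    using norm_coef_param_le[where \<alpha> = \<alpha> and ?a0.0 = a0 and \<beta> = \<beta> and lam = lam and ?b0.0 = b0 and s = s] L(1) by (auto simp: \<Lambda>_def \<theta>)
  have ct: "norm (coef (\<alpha>' - a0) (\<beta>' + lam' - b0)) \<le> \<Lambda> - 1" "norm (coef (\<alpha>' - a0) (\<beta>' - b0)) \<le> \<Lambda> - 1"
    using norm_coef_param_le[where \<alpha> = \<alpha>' and ?a0.0 = a0 and \<beta> = \<beta>' and lam = lam' and ?b0.0 = b0 and s = s'] L(2) by (auto simp: \<Lambda>_def t)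
  have d1: "norm (coef (\<alpha> - a0) (\<beta> + lam - b0) - coef (\<alpha>' - a0) (\<beta>' + lam' - b0)) \<le> 3 * \<eta>"
    using norm_coef_le[of "\<alpha> - a0 - (\<alpha>' - a0)" "\<beta> + lam - b0 - (\<beta>' + lam' - b0)"] comp
    unfolding coef_diff[symmetric] by (simp add: coef_diff[symmetric])
  have d2: "norm (coef (\<alpha> - a0) (\<beta> - b0) - coef (\<alpha>' - a0) (\<beta>' - b0)) \<le> 3 * \<eta>"
    using norm_coef_le[of "\<alpha> - a0 - (\<alpha>' - a0)" "\<beta> - b0 - (\<beta>' - b0)"] comp
    unfolding coef_diff[symmetric] by (simp add: coef_diff[symmetric])
  have pos: "0 < sigma2 \<theta>" "0 < sigma2 t" using s1 by auto
  have "log_lik n d a0 b0 v \<theta> \<gamma> \<le> (\<Sum>i<n. ln (obs_mix d a0 b0 t \<gamma> (v i)) + E)"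
    unfolding log_lik_def
  proof (rule sum_mono)
    fix i assume "i \<in> {..<n}"
    hence i: "i < n" by simp
    have "obs_mix d a0 b0 \<theta> \<gamma> (v i) \<le> exp E * obs_mix d a0 b0 t \<gamma> (v i)"
      unfolding obs_mix_def \<theta> t prod.case E_def
      using s1 comp(4) logistic_bounds less_imp_le res[OF i] diff[OF i] c\<theta> ct d1 d2
      by (intro mix_param_lipschitz[OF s1(1)]) (auto simp: \<theta> t)
    hence "ln (obs_mix d a0 b0 \<theta> \<gamma> (v i)) \<le> ln (exp E * obs_mix d a0 b0 t \<gamma> (v i))"
      using obs_mix_pos[OF pos(1)] obs_mix_pos[OF pos(2)] by (subst ln_le_cancel_iff) auto
    also have "\<dots> = ln (obs_mix d a0 b0 t \<gamma> (v i)) + E"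
      using obs_mix_pos[OF pos(2), of d a0 b0 \<gamma> "v i"] by (simp add: ln_mult)
    finally show "ln (obs_mix d a0 b0 \<theta> \<gamma> (v i)) \<le> ln (obs_mix d a0 b0 t \<gamma> (v i)) + E" .
  qed
  also have "\<dots> = log_lik n d a0 b0 v t \<gamma> + n * E" by (simp add: log_lik_def sum.distrib)
  also have "n * E \<le> lip_const a0 b0 L s1"
  proof -
    have n0: "0 < real n" using n by simp
    have "n * E = (n * \<eta>) / s1 + 3 * \<Lambda> / s1 * (n ^ 3 * \<eta>) + \<Lambda>\<^sup>2 / s1\<^sup>2 * (n ^ 3 * \<eta>)"
      by (simp add: E_def field_simps power2_eq_square power3_eq_cube)
    also have "n ^ 3 * \<eta> = 1" using n0 by (simp add: \<eta>_def)
    also have "n * \<eta> / s1 \<le> 1 / s1"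
    proof (rule divide_right_mono)
      have "real n ^ 1 \<le> real n ^ 3" using n by (intro power_increasing) auto
      thus "n * \<eta> \<le> 1" using n0 by (simp add: \<eta>_def)
    qed (use s1 in simp)
    finally show ?thesis by (simp add: lip_const_def \<Lambda>_def Let_def)
  qed
  finally show ?thesis by simp
qed

lemma log_lik_coefficient_lipschitz:
  assumes s: "0 < sigma2 \<theta>"
  shows "log_lik n d a0 b0 v \<theta> \<gamma> \<le> log_lik n d a0 b0 v \<theta> \<gamma>' + (\<Sum>i<n. \<bar>dotp d (obs_Z (v i)) \<gamma> - dotp d (obs_Z (v i)) \<gamma>'\<bar>)"
  unfolding log_lik_def sum.distrib[symmetric]
proof (rule sum_mono)
  fix i
  let ?x = "dotp d (obs_Z (v i)) \<gamma>" and ?y = "dotp d (obs_Z (v i)) \<gamma>'"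
  have "obs_mix d a0 b0 \<theta> \<gamma> (v i) \<le> exp \<bar>?x - ?y\<bar> * obs_mix d a0 b0 \<theta> \<gamma>' (v i)"
    unfolding obs_mix_def split_beta' by (rule mix_logistic_lipschitz)
  hence "ln (obs_mix d a0 b0 \<theta> \<gamma> (v i)) \<le> ln (exp \<bar>?x - ?y\<bar> * obs_mix d a0 b0 \<theta> \<gamma>' (v i))"
    using obs_mix_pos[OF s] by (subst ln_le_cancel_iff) auto
  also have "\<dots> = ln (obs_mix d a0 b0 \<theta> \<gamma>' (v i)) + \<bar>?x - ?y\<bar>"
    using obs_mix_pos[OF s, of d a0 b0 \<gamma>' "v i"] by (simp add: ln_mult)
  finally show "ln (obs_mix d a0 b0 \<theta> \<gamma> (v i)) \<le> ln (obs_mix d a0 b0 \<theta> \<gamma>' (v i)) + \<bar>?x - ?y\<bar>" .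
qed

lemma abs_dotp_le: "(\<And>j. j < d \<Longrightarrow> \<bar>z j\<bar> \<le> K) \<Longrightarrow> \<bar>dotp d z \<gamma>\<bar> \<le> K * l1norm d \<gamma>"
proof -
  assume z: "\<And>j. j < d \<Longrightarrow> \<bar>z j\<bar> \<le> K"
  have "\<bar>dotp d z \<gamma>\<bar> \<le> (\<Sum>j<d. \<bar>z j * \<gamma> j\<bar>)" unfolding dotp_def by (rule sum_abs)
  also have "\<dots> \<le> (\<Sum>j<d. K * \<bar>\<gamma> j\<bar>)"
    using z by (intro sum_mono) (simp add: abs_mult mult_right_mono)
  finally show ?thesis by (simp add: l1norm_def sum_distrib_left)
qed

text \<open>
  The basic inequality: the estimator is compared with the true \<open>\<theta>\<^sub>0\<close> and \<open>\<gamma> = 0\<close>. At \<open>\<lambda> = 0\<close> both components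
  coincide, so the likelihood there is the true one although \<open>\<gamma>\<^sub>0\<close> is arbitrary.
\<close>

lemma pen_mle_likelihood:
  fixes \<theta> :: "('q::finite) param"
  assumes mle: "is_pen_mle n d p (param_space A B u) v \<theta> \<gamma>"
    and true: "a0 \<in> A" "b0 \<in> B" "0 \<le> u" "0 < s0"
    and outcome: "\<And>i. i < n \<Longrightarrow> obs_Y (v i) = obs_U (v i) \<bullet> coef a0 b0 + obs_eps (v i)"
  shows "\<theta> \<in> param_space A B u" "log_lik0 n s0 v + p * l1norm d \<gamma> \<le> log_lik n d a0 b0 v \<theta> \<gamma>"
proof -
  have loglik_eq: "loglik n d v t g = log_lik n d a0 b0 v t g" for t :: "'q param" and g
    unfolding loglik_def log_lik_def by (intro sum.cong) (simp_all add: mix_density_eq_obs_mix[OF outcome])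
  define \<gamma>0 where "\<gamma>0 = (\<lambda>j\<in>{..<d}. 0 :: real)"
  have "\<theta> \<in> param_space A B u \<and> \<not> pen_loglik n d p v \<theta> \<gamma> < pen_loglik n d p v (a0, b0, 0, s0) \<gamma>0"
  proof -
    have "(a0, b0, 0, s0) \<in> param_space A B u" "\<gamma>0 \<in> Rvec d"
      using true by (auto simp: param_space_def Rvec_def \<gamma>0_def)
    thus ?thesis using mle unfolding is_pen_mle_def is_arg_max_def by fastforce
  qed
  moreover have "pen_loglik n d p v (a0, b0, 0, s0) \<gamma>0 = log_lik0 n s0 v"
  proof -
    have "coef (0 :: real^'q) 0 = 0" by (simp add: coef_eq_0_iff)
    hence "obs_mix d a0 b0 (a0, b0, 0, s0) \<gamma>0 w = gauss s0 (obs_eps w)" for w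
      by (simp add: obs_mix_def mix_def algebra_simps)
    thus ?thesis by (simp add: pen_loglik_def loglik_eq l1norm_def \<gamma>0_def log_lik_def log_lik0_def)
  qed
  ultimately show "\<theta> \<in> param_space A B u" "log_lik0 n s0 v + p * l1norm d \<gamma> \<le> log_lik n d a0 b0 v \<theta> \<gamma>"
    by (auto simp: pen_loglik_def loglik_eq)
qed

section \<open>The sample under the null\<close>

text \<open>
  The data without the estimator: the bounds derived here hold for the sample alone and serve every candidate
  parameter at once.
\<close>

locale null_regime_sequence =
  fixes M :: "nat \<Rightarrow> 'a measure" and Q :: "nat \<Rightarrow> ('q::finite) obs measure"
    and V :: "nat \<Rightarrow> nat \<Rightarrow> 'a \<Rightarrow> 'q obs" and d :: "nat \<Rightarrow> nat"
    and a0 :: "real^'q" and b0 s0 :: real and gamma0 :: "nat \<Rightarrow> nat \<Rightarrow> real"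
  assumes dim: "\<forall>n\<ge>2. 2 \<le> d n"
    and s0: "0 < s0"
    and model: "\<forall>n\<ge>2. regime_model (d n) a0 b0 0 s0 (gamma0 n) (Q n)"
    and U_law: "\<forall>n\<ge>2. \<forall>m\<ge>2. distr (Q n) borel obs_U = distr (Q m) borel obs_U"
    and sample: "\<forall>n\<ge>2. iid_sample n (M n) (Q n) (V n)"
    and U_moment: "\<forall>n\<ge>2. integrable (Q n) (\<lambda>v. norm (obs_U v) ^ 10)"
    and U_pos_def: "\<forall>n\<ge>2. pos_definite (second_moment (Q n) obs_U)"
    and Z_tail: "\<exists>K>0. \<exists>C>0. \<forall>n\<ge>2. \<forall>j<d n. \<forall>t>0.
        measure (Q n) {v \<in> space (Q n). \<bar>obs_Z v j\<bar> > t} \<le> K * exp (- C * t\<^sup>2)"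
begin

definition PU :: "(real^('q + unit)) measure" where "PU = distr (Q 2) borel obs_U"

lemma PU_eq: "2 \<le> n \<Longrightarrow> distr (Q n) borel obs_U = PU"
  unfolding PU_def using U_law by blast

lemma Q_prob: "2 \<le> n \<Longrightarrow> prob_space (Q n)"
  using regime_prob model s0 by blast

lemma Q_sets: "2 \<le> n \<Longrightarrow> sets (Q n) = sets (obs_space (d n))"
  using regime_sets model s0 by blast

lemma Q_measurable: "2 \<le> n \<Longrightarrow> f \<in> measurable (obs_space (d n)) N \<Longrightarrow> f \<in> measurable (Q n) N"
  using measurable_cong_sets[OF Q_sets refl] by auto

lemma M_prob: "2 \<le> n \<Longrightarrow> prob_space (M n)"
  using sample unfolding iid_sample_def by blast

lemma Q_iid: "2 \<le> n \<Longrightarrow> iid_sample n (M n) (Q n) (V n)"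
  using sample by blast

lemma PU_prob: "prob_space PU"
  unfolding PU_def using Q_prob[of 2] Q_measurable[OF _ measurable_obs_U, of 2]
  by (intro prob_space.prob_space_distr) auto

lemma PU_sets: "sets PU = sets borel" by (simp add: PU_def)

lemma Q_U_nn_integral:
  assumes "2 \<le> n" and f: "f \<in> borel_measurable (borel \<Otimes>\<^sub>M borel)"
  shows "(\<integral>\<^sup>+v. f (obs_U v, obs_eps v) \<partial>Q n)
    = (\<integral>\<^sup>+u. (\<integral>\<^sup>+e. ennreal (gauss s0 e) * f (u, e) \<partial>lborel) \<partial>PU)"
proof -
  have m: "regime_model (d n) a0 b0 0 s0 (gamma0 n) (Q n)" using model assms(1) by blast
  show ?thesis using regime_U_nn_integral[OF m s0 f] unfolding PU_eq[OF assms(1)] .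
qed

lemma PU_moment: "integrable PU (\<lambda>u. norm u ^ 10)"
proof -
  have "integrable (Q 2) (\<lambda>v. norm (obs_U v) ^ 10)" using U_moment by simp
  thus ?thesis unfolding PU_def
    by (subst integrable_distr_eq[OF Q_measurable[OF _ measurable_obs_U]]) auto
qed

lemma PU_power_integrable:
  assumes "k \<le> 10"
  shows "integrable PU (\<lambda>u. norm u ^ k)"
proof (rule Bochner_Integration.integrable_bound)
  interpret P: prob_space PU by (rule PU_prob)
  show "integrable PU (\<lambda>u. 1 + norm u ^ 10)" using PU_moment by simp
  show "(\<lambda>u. norm u ^ k) \<in> borel_measurable PU" by (simp add: PU_def)
  show "AE u in PU. norm (norm u ^ k) \<le> norm (1 + norm u ^ 10)"
  proof (rule AE_I2)
    fix u :: "real^('q + unit)"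
    show "norm (norm u ^ k) \<le> norm (1 + norm u ^ 10)"
    proof (cases "norm u \<le> 1")
      case True
      hence "norm u ^ k \<le> 1" by (simp add: power_le_one)
      thus ?thesis by (simp add: add_nonneg_nonneg add_increasing2)
    next
      case False
      hence "norm u ^ k \<le> norm u ^ 10" using assms by (intro power_increasing) auto
      thus ?thesis by simp
    qed
  qed
qed

text \<open>
  If \<open>U'c\<close> vanished almost surely then so would \<open>E[U U'] c\<close>, against positive definiteness.
\<close>

lemma PU_nondegenerate:
  assumes c: "c \<noteq> 0"
  shows "\<not> (AE u in PU. u \<bullet> c = 0)"
proof
  assume ae: "AE u in PU. u \<bullet> c = 0"
  have m[measurable]: "obs_U \<in> borel_measurable (Q 2)" by (rule Q_measurable[OF _ measurable_obs_U]) simp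
  have ae2: "AE v in Q 2. obs_U v \<bullet> c = 0"
    using ae unfolding PU_def by (subst (asm) AE_distr_iff) (auto intro!: borel_measurable_continuous_onI continuous_intros)
  have intU: "integrable (Q 2) (\<lambda>v. obs_U v $ i * obs_U v $ j)" for i j
  proof (rule Bochner_Integration.integrable_bound)
    have "integrable PU (\<lambda>u. norm u ^ 2)" by (rule PU_power_integrable) simp
    thus "integrable (Q 2) (\<lambda>v. norm (obs_U v) ^ 2)"
      unfolding PU_def by (subst (asm) integrable_distr_eq[OF m]) auto
    have "(\<lambda>v. obs_U v \<bullet> axis k 1) \<in> borel_measurable (Q 2)" for k by measurable
    hence "(\<lambda>v. obs_U v $ k) \<in> borel_measurable (Q 2)" for k by (simp add: inner_axis)
    thus "(\<lambda>v. obs_U v $ i * obs_U v $ j) \<in> borel_measurable (Q 2)" by (intro borel_measurable_times) auto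
    show "AE v in Q 2. norm (obs_U v $ i * obs_U v $ j) \<le> norm (norm (obs_U v) ^ 2)"
    proof (rule AE_I2)
      fix v :: "'q obs"
      have "\<bar>obs_U v $ i\<bar> * \<bar>obs_U v $ j\<bar> \<le> norm (obs_U v) * norm (obs_U v)"
        by (intro mult_mono component_le_norm_cart) auto
      thus "norm (obs_U v $ i * obs_U v $ j) \<le> norm (norm (obs_U v) ^ 2)"
        by (simp add: abs_mult power2_eq_square)
    qed
  qed
  have "(second_moment (Q 2) obs_U *v c) $ i = 0" for i
  proof -
    have "(second_moment (Q 2) obs_U *v c) $ i = (\<Sum>j\<in>UNIV. (\<integral>v. obs_U v $ i * obs_U v $ j \<partial>Q 2) * c $ j)"
      by (simp add: matrix_vector_mult_def second_moment_def)
    also have "\<dots> = (\<integral>v. (\<Sum>j\<in>UNIV. obs_U v $ i * obs_U v $ j * c $ j) \<partial>Q 2)"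
      using intU by (subst Bochner_Integration.integral_sum) auto
    also have "\<dots> = (\<integral>v. obs_U v $ i * (obs_U v \<bullet> c) \<partial>Q 2)"
      by (simp add: inner_vec_def sum_distrib_left mult_ac)
    also have "\<dots> = 0"
    proof (rule integral_eq_zero_AE)
      show "AE v in Q 2. obs_U v $ i * (obs_U v \<bullet> c) = 0" using ae2 by eventually_elim simp
    qed
    finally show ?thesis .
  qed
  hence "second_moment (Q 2) obs_U *v c = 0" by (simp add: vec_eq_iff)
  hence "c \<bullet> (second_moment (Q 2) obs_U *v c) = 0" by simp
  moreover have "pos_definite (second_moment (Q 2) obs_U)" using U_pos_def by simp
  ultimately show False using c unfolding pos_definite_def by force
qed

text \<open>
  The product of the variables \<open>exp (\<epsilon>\<^sub>i\<^sup>2 / (4 s0))\<close> has mean \<open>(\<surd>2)\<^sup>n\<close>, which is exponentially smaller than \<open>e\<^sup>n\<close>.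
\<close>

lemma whp_noise_sum: "whp M (\<lambda>n \<omega>. (\<Sum>i<n. (obs_eps (V n i \<omega>))\<^sup>2) \<le> 4 * s0 * n)"
proof (rule whpI)
  define g where "g = (\<lambda>(_::unit) v :: 'q obs. exp ((obs_eps v)\<^sup>2 / (4 * s0)))"
  define E where "E n = {\<omega> \<in> space (M n). \<exists>\<nu>\<in>{()}. exp (real n) \<le> (\<Prod>i<n. g \<nu> (V n i \<omega>))}" for n
  show "\<forall>\<^sub>F n in sequentially. E n \<in> sets (M n) \<and> measure (M n) (E n) \<le> card {()} * sqrt 2 ^ n / exp (real n) \<and>
      (AE \<omega> in M n. \<omega> \<notin> E n \<longrightarrow> (\<Sum>i<n. (obs_eps (V n i \<omega>))\<^sup>2) \<le> 4 * s0 * n)"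
    using eventually_ge_at_top[of 2]
  proof eventually_elim
    case (elim n)
    have g_int: "(\<integral>\<^sup>+v. ennreal (g () v) \<partial>Q n) = ennreal (sqrt 2)"
    proof -
      have "(\<integral>\<^sup>+v. ennreal (g () v) \<partial>Q n) = (\<integral>\<^sup>+u. ennreal (sqrt 2) \<partial>PU)"
        using nn_integral_exp_square_noise[OF s0]
          Q_U_nn_integral[OF elim, of "\<lambda>x. ennreal (exp ((snd x)\<^sup>2 / (4 * s0)))"]
        by (simp add: g_def)
      thus ?thesis using prob_space.emeasure_space_1[OF PU_prob] by simp
    qed
    have g_meas: "g \<nu> \<in> borel_measurable (Q n)" for \<nu>
      by (rule Q_measurable[OF elim]) (simp add: g_def)
    have g_nonneg: "0 \<le> g \<nu> v" for \<nu> v by (simp add: g_def)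
    note tail = iid_product_tail[OF Q_iid[OF elim], of "{()}" g "sqrt 2" "exp (real n)"]
    have 1: "E n \<in> sets (M n)" "measure (M n) (E n) \<le> card {()} * sqrt 2 ^ n / exp (real n)"
      unfolding E_def by (rule tail; use g_int g_meas g_nonneg in simp)+
    have "(\<Sum>i<n. (obs_eps (V n i \<omega>))\<^sup>2) \<le> 4 * s0 * n" if "\<omega> \<in> space (M n)" "\<omega> \<notin> E n" for \<omega>
    proof -
      have "(\<Prod>i<n. g () (V n i \<omega>)) < exp (real n)" using that by (auto simp: E_def)
      also have "(\<Prod>i<n. g () (V n i \<omega>)) = exp ((\<Sum>i<n. (obs_eps (V n i \<omega>))\<^sup>2) / (4 * s0))"
        by (simp add: g_def exp_sum sum_divide_distrib)
      finally show ?thesis using s0 by (simp add: field_simps)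
    qed
    thus ?case using 1 by (intro conjI AE_I2) auto
  qed
  have "sqrt 2 < exp 1"
  proof -
    have "sqrt 2 < 2" by (simp add: real_sqrt_less_iff[of 2 4, simplified])
    thus ?thesis using exp_ge_add_one_self[of "1::real"] by linarith
  qed
  hence "(\<lambda>n. (sqrt 2 / exp 1) ^ n) \<longlonglongrightarrow> 0"
    by (intro LIMSEQ_realpow_zero) (auto simp: divide_simps)
  moreover have "card {()} * sqrt 2 ^ n / exp (real n) = (sqrt 2 / exp 1) ^ n" for n
    by (simp add: power_divide exp_of_nat_mult[symmetric])
  ultimately show "(\<lambda>n. card {()} * sqrt 2 ^ n / exp (real n)) \<longlonglongrightarrow> 0" by simp
qed

lemma whp_U_bound: "whp M (\<lambda>n \<omega>. \<forall>i<n. norm (obs_U (V n i \<omega>)) \<le> n)"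
proof (rule whpI)
  define m where "m = (\<integral>u. norm u ^ 2 \<partial>PU)"
  define B where "B n = {v \<in> space (Q n). real n \<le> norm (obs_U v)}" for n
  define E where "E n = {\<omega> \<in> space (M n). \<exists>i<n. V n i \<omega> \<in> B n}" for n
  show "\<forall>\<^sub>F n in sequentially. E n \<in> sets (M n) \<and> measure (M n) (E n) \<le> m / n \<and>
      (AE \<omega> in M n. \<omega> \<notin> E n \<longrightarrow> (\<forall>i<n. norm (obs_U (V n i \<omega>)) \<le> n))"
    using eventually_ge_at_top[of 2]
  proof eventually_elim
    case (elim n)
    have m[measurable]: "obs_U \<in> borel_measurable (Q n)" by (rule Q_measurable[OF elim measurable_obs_U])
    have B[measurable]: "B n \<in> sets (Q n)" unfolding B_def by measurable
    interpret Q: prob_space "Q n" by (rule Q_prob[OF elim])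
    have int: "integrable (Q n) (\<lambda>v. norm (obs_U v) ^ 2)" and eq: "(\<integral>v. norm (obs_U v) ^ 2 \<partial>Q n) = m"
      using PU_power_integrable[of 2] PU_eq[OF elim] unfolding m_def PU_eq[OF elim, symmetric]
      by (auto simp: integrable_distr_eq[OF m] integral_distr[OF m])
    have "measure (Q n) (B n) \<le> measure (Q n) {v \<in> space (Q n). (real n)\<^sup>2 \<le> norm (obs_U v) ^ 2}"
      by (rule Q.finite_measure_mono) (auto simp: B_def power_mono)
    also have "\<dots> \<le> m / (real n)\<^sup>2"
      using integral_Markov_inequality_measure[OF int, of "{}" "(real n)\<^sup>2"] elim by (simp add: eq)
    finally have "n * measure (Q n) (B n) \<le> n * (m / (real n)\<^sup>2)" by (intro mult_left_mono) auto
    hence "n * measure (Q n) (B n) \<le> m / n" using elim by (simp add: power2_eq_square)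
    hence 1: "E n \<in> sets (M n)" "measure (M n) (E n) \<le> m / n"
      using iid_union_bound[OF Q_iid[OF elim] B, folded E_def] by (blast, linarith)
    have "norm (obs_U (V n i \<omega>)) \<le> n" if "\<omega> \<in> space (M n)" "\<omega> \<notin> E n" "i < n" for \<omega> i
    proof -
      have "V n i \<omega> \<in> space (Q n)"
        by (rule measurable_space[OF iid_sample_measurable[OF Q_iid[OF elim] that(3)] that(1)])
      thus ?thesis using that unfolding E_def B_def by force
    qed
    thus ?case using 1 by (intro conjI AE_I2) auto
  qed
  show "(\<lambda>n. m / n) \<longlonglongrightarrow> 0" by real_asymp
qed

text \<open>
  Up to a constant, the maximum of \<open>n d\<close> sub-Gaussian variables.
\<close>

definition Zscale :: "nat \<Rightarrow> real" where "Zscale n = sqrt (ln n + ln (d n))"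

lemma whp_Z_bound:
  obtains C where "0 < C" "whp M (\<lambda>n \<omega>. \<forall>i<n. \<forall>j<d n. \<bar>obs_Z (V n i \<omega>) j\<bar> \<le> C * Zscale n)"
proof -
  obtain K C where KC: "0 < K" "0 < C" "\<And>n j t. 2 \<le> n \<Longrightarrow> j < d n \<Longrightarrow> 0 < t \<Longrightarrow>
        measure (Q n) {v \<in> space (Q n). \<bar>obs_Z v j\<bar> > t} \<le> K * exp (- C * t\<^sup>2)"
    using Z_tail by blast
  \<comment> \<open>With this scale each tail is at most \<open>K / (n d)\<^sup>2\<close>, against a union over \<open>n d\<close> variables.\<close>
  define C' where "C' = sqrt (2 / C)"
  have C': "0 < C'" using KC by (simp add: C'_def)
  define B where "B n = (\<Union>j<d n. {v \<in> space (Q n). C' * Zscale n < \<bar>obs_Z v j\<bar>})" for n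
  define E where "E n = {\<omega> \<in> space (M n). \<exists>i<n. V n i \<omega> \<in> B n}" for n
  have "whp M (\<lambda>n \<omega>. \<forall>i<n. \<forall>j<d n. \<bar>obs_Z (V n i \<omega>) j\<bar> \<le> C' * Zscale n)"
  proof (rule whpI)
    show "\<forall>\<^sub>F n in sequentially. E n \<in> sets (M n) \<and> measure (M n) (E n) \<le> K / n \<and>
        (AE \<omega> in M n. \<omega> \<notin> E n \<longrightarrow> (\<forall>i<n. \<forall>j<d n. \<bar>obs_Z (V n i \<omega>) j\<bar> \<le> C' * Zscale n))"
      using eventually_ge_at_top[of 2]
    proof eventually_elim
      case (elim n)
      interpret Q: prob_space "Q n" by (rule Q_prob[OF elim])
      have d2: "2 \<le> d n" using dim elim by blast
      have lpos: "0 < ln (real n)" "0 < ln (real (d n))" using elim d2 by auto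
      hence Zpos: "0 < Zscale n" "(Zscale n)\<^sup>2 = ln n + ln (d n)" by (auto simp: Zscale_def)
      have Zm: "{v \<in> space (Q n). C' * Zscale n < \<bar>obs_Z v j\<bar>} \<in> sets (Q n)" if "j < d n" for j
      proof -
        have "(\<lambda>v. obs_Z v j) \<in> borel_measurable (Q n)"
          using that measurable_compose[OF Q_measurable[OF elim measurable_obs(4), unfolded Rvec_borel_def]
              measurable_component_singleton[of j "{..<d n}" "\<lambda>_. borel"]] by simp
        thus ?thesis by measurable
      qed
      have B: "B n \<in> sets (Q n)" unfolding B_def by (intro sets.finite_UN) (use Zm in auto)
      have "measure (Q n) (B n) \<le> (\<Sum>j<d n. measure (Q n) {v \<in> space (Q n). C' * Zscale n < \<bar>obs_Z v j\<bar>})"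
        unfolding B_def by (intro Q.finite_measure_subadditive_finite) (use Zm in auto)
      also have "\<dots> \<le> (\<Sum>j<d n. K * exp (- C * (C' * Zscale n)\<^sup>2))"
        by (intro sum_mono KC(3)[OF elim]) (use C' Zpos in auto)
      also have "- C * (C' * Zscale n)\<^sup>2 = - 2 * ln n - 2 * ln (d n)"
        using KC(2) by (simp add: power_mult_distrib C'_def Zpos(2))
      also have "exp (- 2 * ln n - 2 * ln (d n)) = 1 / ((real n)\<^sup>2 * (real (d n))\<^sup>2)"
      proof -
        have "exp (- 2 * ln n - 2 * ln (d n)) = 1 / (exp (ln n) ^ 2 * exp (ln (d n)) ^ 2)"
          by (simp add: exp_diff exp_minus exp_double[symmetric] divide_inverse)
        thus ?thesis using elim d2 by simp
      qed
      also have "(\<Sum>j<d n. K * (1 / ((real n)\<^sup>2 * (real (d n))\<^sup>2))) = (K / (real n)\<^sup>2) * (1 / d n)"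
        using d2 by (simp add: power2_eq_square)
      also have "\<dots> \<le> (K / (real n)\<^sup>2) * 1" using KC(1) d2 by (intro mult_left_mono) auto
      finally have "n * measure (Q n) (B n) \<le> n * (K / (real n)\<^sup>2)" by (intro mult_left_mono) auto
      hence "n * measure (Q n) (B n) \<le> K / n" using elim by (simp add: power2_eq_square)
      hence 1: "E n \<in> sets (M n)" "measure (M n) (E n) \<le> K / n"
        using iid_union_bound[OF Q_iid[OF elim] B, folded E_def] by (blast, linarith)
      have "\<bar>obs_Z (V n i \<omega>) j\<bar> \<le> C' * Zscale n"
        if "\<omega> \<in> space (M n)" "\<omega> \<notin> E n" "i < n" "j < d n" for \<omega> i j
      proof -
        have "V n i \<omega> \<in> space (Q n)"
          by (rule measurable_space[OF iid_sample_measurable[OF Q_iid[OF elim] that(3)] that(1)])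
        thus ?thesis using that unfolding E_def B_def by force
      qed
      thus ?case using 1 by (intro conjI AE_I2) auto
    qed
    show "(\<lambda>n. K / n) \<longlonglongrightarrow> 0" by real_asymp
  qed
  thus thesis using C' that by blast
qed

lemma near_zero_noise_le:
  assumes "0 \<le> r"
  shows "(\<integral>\<^sup>+e. ennreal (gauss s0 e) * indicator {e. \<bar>e - a\<bar> < r} e \<partial>lborel)
    \<le> ennreal (2 * r / sqrt (2 * pi * s0))"
proof -
  have "(\<integral>\<^sup>+e. ennreal (gauss s0 e) * indicator {e. \<bar>e - a\<bar> < r} e \<partial>lborel)
      \<le> (\<integral>\<^sup>+e. ennreal (1 / sqrt (2 * pi * s0)) * indicator {a - r..a + r} e \<partial>lborel)"
  proof (rule nn_integral_mono)
    fix e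
    have "gauss s0 e \<le> 1 / sqrt (2 * pi * s0)"
      using s0 by (simp add: normal_density_var divide_right_mono)
    thus "ennreal (gauss s0 e) * indicator {e. \<bar>e - a\<bar> < r} e
        \<le> ennreal (1 / sqrt (2 * pi * s0)) * indicator {a - r..a + r} e"
      by (intro mult_mono ennreal_leI) (auto simp: indicator_def)
  qed
  also have "\<dots> = ennreal (1 / sqrt (2 * pi * s0)) * ennreal (2 * r)"
    using assms by (simp add: nn_integral_cmult_indicator)
  also have "\<dots> = ennreal (2 * r / sqrt (2 * pi * s0))"
    using assms s0 by (subst ennreal_mult[symmetric]) auto
  finally show ?thesis .
qed

text \<open>
  Uniformity in \<open>c\<close> comes from a finite \<open>\<kappa>\<close>-net: if \<open>\<bar>\<epsilon> - U'c\<bar> < \<kappa>\<close> and \<open>c'\<close> is within \<open>\<kappa>\<close> of \<open>c\<close>, then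
  \<open>\<bar>\<epsilon> - U'c'\<bar> < \<kappa> (1 + \<parallel>U\<parallel>)\<close>, an event whose probability is at most of order \<open>\<kappa>\<close> because the noise density is
  bounded. The enlarged window keeps the indicator bounded, so one moment of \<open>U\<close> suffices.
\<close>

lemma whp_few_small_residuals:
  obtains \<kappa> where "0 < \<kappa>"
    "whp M (\<lambda>n \<omega>. \<forall>c. norm c \<le> L \<longrightarrow> card (small_resid n (\<lambda>i. V n i \<omega>) \<kappa> c) \<le> n / 4)"
proof -
  define m1 where "m1 = (\<integral>u. norm u ^ 1 \<partial>PU)"
  have m1: "0 \<le> m1" unfolding m1_def by simp
  \<comment> \<open>The window has expected probability at most \<open>1/80\<close>, so weight \<open>81\<close> inside it and \<open>1\<close> outside gives mean at most \<open>2\<close>; since \<open>81 = 3\<^sup>4\<close>, more than \<open>n / 4\<close> hits push the product above \<open>3\<^sup>n\<close>.\<close>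
  define \<kappa> where "\<kappa> = sqrt (2 * pi * s0) / (160 * (1 + m1))"
  have \<kappa>: "0 < \<kappa>" using s0 m1 by (simp add: \<kappa>_def)
  define g where "g c v = (if \<bar>obs_eps v - obs_U v \<bullet> c\<bar> < \<kappa> * (1 + norm (obs_U v)) then 81 else 1 :: real)"
    for c and v :: "'q obs"
  have g_le: "(\<integral>\<^sup>+v. ennreal (g c v) \<partial>Q n) \<le> ennreal 2" if n: "2 \<le> n" for c n
  proof -
    define D where "D u = {e. \<bar>e - u \<bullet> c\<bar> < \<kappa> * (1 + norm u)}" for u
    have "(\<integral>\<^sup>+v. ennreal (g c v) \<partial>Q n)
        = (\<integral>\<^sup>+v. (\<lambda>x. ennreal (if \<bar>snd x - fst x \<bullet> c\<bar> < \<kappa> * (1 + norm (fst x)) then 81 else 1))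
            (obs_U v, obs_eps v) \<partial>Q n)"
      by (simp add: g_def)
    also have "\<dots> = (\<integral>\<^sup>+u. (\<integral>\<^sup>+e. ennreal (gauss s0 e) *
          (\<lambda>x. ennreal (if \<bar>snd x - fst x \<bullet> c\<bar> < \<kappa> * (1 + norm (fst x)) then 81 else 1)) (u, e) \<partial>lborel) \<partial>PU)"
      by (rule Q_U_nn_integral[OF n]) measurable
    also have "\<dots> = (\<integral>\<^sup>+u. (\<integral>\<^sup>+e. ennreal (gauss s0 e) *
          ennreal (if \<bar>e - u \<bullet> c\<bar> < \<kappa> * (1 + norm u) then 81 else 1) \<partial>lborel) \<partial>PU)"
      by (simp only: fst_conv snd_conv)
    also have "\<dots> \<le> (\<integral>\<^sup>+u. 1 + ennreal (1 / (1 + m1)) * ennreal (1 + norm u) \<partial>PU)"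
    proof (rule nn_integral_mono)
      fix u :: "real^('q + unit)"
      have 81: "ennreal 81 = 1 + ennreal 80" using ennreal_plus[of 1 80] by simp
      have [measurable]: "D u \<in> sets borel" unfolding D_def by measurable
      have "(\<integral>\<^sup>+e. ennreal (gauss s0 e) *
            ennreal (if \<bar>e - u \<bullet> c\<bar> < \<kappa> * (1 + norm u) then 81 else 1) \<partial>lborel)
          = (\<integral>\<^sup>+e. ennreal (gauss s0 (e - 0))
            + ennreal 80 * (ennreal (gauss s0 e) * indicator (D u) e) \<partial>lborel)"
      proof (rule nn_integral_cong)
        fix e
        show "ennreal (gauss s0 e) * ennreal (if \<bar>e - u \<bullet> c\<bar> < \<kappa> * (1 + norm u) then 81 else 1)
            = ennreal (gauss s0 (e - 0))
              + ennreal 80 * (ennreal (gauss s0 e) * indicator (D u) e)"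
          by (cases "\<bar>e - u \<bullet> c\<bar> < \<kappa> * (1 + norm u)") (simp_all only: D_def indicator_def mem_Collect_eq
            if_True if_False 81 diff_zero distrib_left mult.right_neutral mult_zero_right add_0_right ennreal_1
            of_bool_eq mult.commute[of _ "ennreal 80"])
      qed
      also have "\<dots> = 1 + ennreal 80 * (\<integral>\<^sup>+e. ennreal (gauss s0 e) * indicator (D u) e \<partial>lborel)"
        using nn_integral_normal_density_shift[OF s0, of 0]
        by (subst nn_integral_add) (auto simp: nn_integral_cmult)
      also have "\<dots> \<le> 1 + ennreal 80 * ennreal (2 * (\<kappa> * (1 + norm u)) / sqrt (2 * pi * s0))"
        unfolding D_def using \<kappa> by (intro add_left_mono mult_left_mono near_zero_noise_le) auto
      also have "ennreal 80 * ennreal (2 * (\<kappa> * (1 + norm u)) / sqrt (2 * pi * s0))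
          = ennreal (80 * (2 * (\<kappa> * (1 + norm u)) / sqrt (2 * pi * s0)))"
        using \<kappa> s0 by (subst ennreal_mult) auto
      also have "80 * (2 * (\<kappa> * (1 + norm u)) / sqrt (2 * pi * s0)) = 1 / (1 + m1) * (1 + norm u)"
      proof -
        have S: "0 < sqrt (2 * pi * s0)" using s0 by simp
        have key: "80 * (2 * (S / (160 * t) * x) / S) = 1 / t * x" if "0 < S" "0 < t" for S t x :: real
          using that by (simp add: field_simps)
        show ?thesis unfolding \<kappa>_def by (rule key) (use S m1 in auto)
      qed
      also have "ennreal (1 / (1 + m1) * (1 + norm u)) = ennreal (1 / (1 + m1)) * ennreal (1 + norm u)"
        using m1 by (intro ennreal_mult) auto
      finally show "(\<integral>\<^sup>+e. ennreal (gauss s0 e) *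
            ennreal (if \<bar>e - u \<bullet> c\<bar> < \<kappa> * (1 + norm u) then 81 else 1) \<partial>lborel)
          \<le> 1 + ennreal (1 / (1 + m1)) * ennreal (1 + norm u)" .
    qed
    also have "\<dots> = 1 + ennreal (1 / (1 + m1)) * (\<integral>\<^sup>+u. ennreal (1 + norm u) \<partial>PU)"
    proof -
      have "(\<lambda>u. ennreal (1 + norm u)) \<in> borel_measurable PU" by (simp add: PU_def)
      thus ?thesis using prob_space.emeasure_space_1[OF PU_prob]
        by (subst nn_integral_add) (auto simp: nn_integral_cmult)
    qed
    also have "(\<integral>\<^sup>+u. ennreal (1 + norm u) \<partial>PU) = ennreal (1 + m1)"
    proof -
      interpret P: prob_space PU by (rule PU_prob)
      have int: "integrable PU (\<lambda>u. norm u)" using PU_power_integrable[of 1] by simp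
      have "(\<integral>u. 1 + norm u \<partial>PU) = 1 + m1"
        using int P.prob_space by (simp add: m1_def)
      thus ?thesis using int by (subst nn_integral_eq_integral) auto
    qed
    also have "1 + ennreal (1 / (1 + m1)) * ennreal (1 + m1) = ennreal 2"
      using m1 ennreal_plus[of 1 1] by (subst ennreal_mult[symmetric]) auto
    finally show ?thesis .
  qed
  have pos: "0 \<le> max L 0" "0 < \<kappa> / DIM(real^('q + unit))" using \<kappa> by simp_all
  obtain T :: "(real^('q + unit)) set" where T: "finite T"
    "\<And>x. norm x \<le> max L 0 \<Longrightarrow> \<exists>t\<in>T. dist x t \<le> DIM(real^('q + unit)) * (\<kappa> / DIM(real^('q + unit)))"
    using finite_grid_cover[where 'a = "real^('q + unit)", OF pos] by blast
  have T': "\<exists>t\<in>T. dist x t \<le> \<kappa>" if "norm x \<le> L" for x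
  proof -
    have "norm x \<le> max L 0" using that by simp
    from T(2)[OF this] show ?thesis by simp
  qed
  define E where "E n = {\<omega> \<in> space (M n). \<exists>\<nu>\<in>T. 3 ^ n \<le> (\<Prod>i<n. g \<nu> (V n i \<omega>))}" for n
  have "whp M (\<lambda>n \<omega>. \<forall>c. norm c \<le> L \<longrightarrow> card (small_resid n (\<lambda>i. V n i \<omega>) \<kappa> c) \<le> n / 4)"
  proof (rule whpI)
    show "\<forall>\<^sub>F n in sequentially. E n \<in> sets (M n) \<and> measure (M n) (E n) \<le> real (card T) * 2 ^ n / 3 ^ n \<and>
        (AE \<omega> in M n. \<omega> \<notin> E n \<longrightarrow> (\<forall>c. norm c \<le> L \<longrightarrow> card (small_resid n (\<lambda>i. V n i \<omega>) \<kappa> c) \<le> n / 4))"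
      using eventually_ge_at_top[of 2]
    proof eventually_elim
      case (elim n)
      have g_meas: "g \<nu> \<in> borel_measurable (Q n)" for \<nu>
        by (rule Q_measurable[OF elim]) (simp add: g_def[abs_def])
      have g_nonneg: "0 \<le> g \<nu> v" for \<nu> v by (simp add: g_def)
      note tail = iid_product_tail[OF Q_iid[OF elim] T(1), of g 2 "3 ^ n"]
      have 1: "E n \<in> sets (M n)" "measure (M n) (E n) \<le> real (card T) * 2 ^ n / 3 ^ n"
        unfolding E_def by (rule tail; (rule g_meas g_nonneg g_le[OF elim] | simp))+
      have "card (small_resid n (\<lambda>i. V n i \<omega>) \<kappa> c) \<le> real n / 4"
        if \<omega>: "\<omega> \<in> space (M n)" "\<omega> \<notin> E n" and c: "norm c \<le> L" for \<omega> c
      proof -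
        obtain t where t: "t \<in> T" "dist c t \<le> \<kappa>" using T'[OF c] by blast
        define S where "S = small_resid n (\<lambda>i. V n i \<omega>) \<kappa> c"
        have S: "S \<subseteq> {..<n}" by (auto simp: S_def small_resid_def)
        have hit: "g t (V n i \<omega>) = 81" if "i \<in> S" for i
        proof -
          let ?v = "V n i \<omega>"
          have "\<bar>obs_U ?v \<bullet> (c - t)\<bar> \<le> norm (obs_U ?v) * norm (c - t)" by (rule Cauchy_Schwarz_ineq2)
          also have "\<dots> \<le> norm (obs_U ?v) * \<kappa>" using t(2) by (intro mult_left_mono) (auto simp: dist_norm)
          finally have "\<bar>obs_U ?v \<bullet> c - obs_U ?v \<bullet> t\<bar> \<le> \<kappa> * norm (obs_U ?v)"
            by (simp add: inner_diff_right mult.commute)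
          moreover have "\<bar>obs_eps ?v - obs_U ?v \<bullet> c\<bar> < \<kappa>" using that by (simp add: S_def small_resid_def)
          ultimately have "\<bar>obs_eps ?v - obs_U ?v \<bullet> t\<bar> < \<kappa> * (1 + norm (obs_U ?v))"
            by (simp add: distrib_left)
          thus ?thesis by (simp add: g_def)
        qed
        have "(3::real) ^ (4 * card S) = (\<Prod>i\<in>S. 81)" by (simp add: power_mult)
        also have "\<dots> = (\<Prod>i\<in>S. g t (V n i \<omega>))" using hit by (intro prod.cong) auto
        also have "\<dots> \<le> (\<Prod>i<n. g t (V n i \<omega>))"
          using S by (intro prod_mono2) (auto simp: g_def)
        also have "\<dots> < 3 ^ n" using \<omega> t(1) by (force simp: E_def)
        finally have "4 * card S < n" by (simp add: power_less_imp_less_exp)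
        thus ?thesis by (simp add: S_def)
      qed
      thus ?case using 1 by (intro conjI AE_I2) auto
    qed
    have "(\<lambda>n. real (card T) * (2 / 3 :: real) ^ n) \<longlonglongrightarrow> real (card T) * 0"
      by (intro tendsto_mult tendsto_const LIMSEQ_realpow_zero) auto
    thus "(\<lambda>n. real (card T) * 2 ^ n / 3 ^ n :: real) \<longlonglongrightarrow> 0" by (simp add: power_divide)
  qed
  thus thesis using \<kappa> that by blast
qed

end

section \<open>Rates\<close>

definition l1_rate :: "(nat \<Rightarrow> nat) \<Rightarrow> nat \<Rightarrow> real" where
  "l1_rate d n = real n powr (-1/4) * (ln (real (d n)) * ln (real n)) powr (-1/2)"

text \<open>
  Up to a constant, the logarithm of the size of the net: \<open>ln n\<close> for the grid in \<open>\<theta>\<close>, and \<open>m ln d\<close> for the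
  sparse vectors with \<open>m\<close> of order \<open>n\<^sup>2 (ln n + ln d) / p\<^sup>2\<close>.
\<close>

abbreviation net_cost :: "(nat \<Rightarrow> nat) \<Rightarrow> (nat \<Rightarrow> real) \<Rightarrow> nat \<Rightarrow> real" where
  "net_cost d p n \<equiv> 1 + ln n + (n\<^sup>2 * (ln n + ln (d n)) / (p n)\<^sup>2 + 1) * ln (d n)"

text \<open>
  Write \<open>a\<^sub>n\<close> for the null sequence of the rate condition and \<open>q = n\<^sup>1\<^sup>/\<^sup>4\<close>. Then
  \<open>n\<^sup>2 ln d / p\<^sup>2 = a\<^sub>n q / \<surd>(ln n)\<close>, so the net cost is of order \<open>q\<^sup>2\<close>, and
  \<open>q\<^sup>3 \<surd>(ln d ln n) / p \<le> \<surd>a\<^sub>n\<close>.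
\<close>

lemma penalty_rate_tendsto_0:
  fixes d :: "nat \<Rightarrow> nat" and p :: "nat \<Rightarrow> real"
  assumes dim: "\<forall>n\<ge>2. 2 \<le> d n" and p: "\<forall>n\<ge>2. 0 < p n"
    and rate: "(\<lambda>n. real n powr (7/4) * sqrt (ln (real n)) * ln (real (d n)) / (p n)\<^sup>2) \<longlonglongrightarrow> 0"
    and log_dim: "(\<lambda>n. ln (real (d n)) / real n powr (1/4)) \<longlonglongrightarrow> 0" and c: "0 \<le> c"
  shows "(\<lambda>n. c * net_cost d p n / p n / l1_rate d n) \<longlonglongrightarrow> 0"
proof (rule tendsto_sandwich[OF _ _ tendsto_const])
  define a where "a n = real n powr (7/4) * sqrt (ln (real n)) * ln (real (d n)) / (p n)\<^sup>2" for n
  have "(\<lambda>n. 5 * c * sqrt (a n)) \<longlonglongrightarrow> 5 * c * sqrt 0"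
    using rate unfolding a_def by (intro tendsto_intros)
  thus "(\<lambda>n. 5 * c * sqrt (a n)) \<longlonglongrightarrow> 0" by simp
  have "\<forall>\<^sub>F n in sequentially. a n < 1" using order_tendstoD(2)[OF rate, of 1] by (simp add: a_def)
  moreover have "\<forall>\<^sub>F n in sequentially. ln (real (d n)) / real n powr (1/4) < 1"
    using order_tendstoD(2)[OF log_dim, of 1] by simp
  moreover have "\<forall>\<^sub>F n in sequentially. ln (real n) \<le> real n powr (1/4)" by real_asymp
  moreover have "\<forall>\<^sub>F n in sequentially. 1 \<le> ln (real n)" by real_asymp
  moreover have "\<forall>\<^sub>F n::nat in sequentially. 2 \<le> n" by (rule eventually_ge_at_top)
  ultimately have both: "\<forall>\<^sub>F n in sequentially.
      0 \<le> c * net_cost d p n / p n / l1_rate d n \<and>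
      c * net_cost d p n / p n / l1_rate d n \<le> 5 * c * sqrt (a n)"
  proof eventually_elim
    case (elim n)
    define N x y P where "N = real n" and "x = ln N" and "y = ln (real (d n))" and "P = p n"
    define q where "q = N powr (1/4)"
    have N: "2 \<le> N" "0 < N" and P: "0 < P" and y: "0 < y" and x: "1 \<le> x"
      using elim p dim by (force simp: N_def P_def y_def x_def)+
    have q: "1 \<le> q" "x \<le> q" "y \<le> q" "0 < q"
    proof -
      show "1 \<le> q" unfolding q_def using N by (intro ge_one_powr_ge_zero) auto
      show "0 < q" unfolding q_def using N by simp
      show "x \<le> q" "y \<le> q" using elim \<open>0 < q\<close> by (auto simp: x_def y_def N_def q_def divide_simps split: if_splits)
    qed
    have q4: "N = q ^ 4" unfolding q_def using N by (simp add: powr_realpow[symmetric] powr_powr)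
    have q7: "N powr (7/4) = q ^ 7" unfolding q_def using N by (simp add: powr_realpow[symmetric] powr_powr)
    have a: "a n = q ^ 7 * sqrt x * y / P\<^sup>2" "a n < 1" "0 \<le> a n"
      using elim y P q x unfolding a_def by (auto simp: q7[unfolded N_def] N_def x_def y_def P_def)
    have sx: "1 \<le> sqrt x" "sqrt x \<le> x" "0 < sqrt x" using x by (auto simp: real_le_lsqrt power2_eq_square)
    have l1: "N\<^sup>2 * (x + y) / P\<^sup>2 * y \<le> 2 * q\<^sup>2"
    proof -
      have "N\<^sup>2 * (x + y) / P\<^sup>2 * y = (q ^ 7 * sqrt x * y / P\<^sup>2) * (q * (x + y) / sqrt x)"
        unfolding q4 using sx P by (simp add: field_simps eval_nat_numeral)
      also have "\<dots> \<le> 1 * (q * (x + y) / 1)"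
      proof (rule mult_mono)
        show "q * (x + y) / sqrt x \<le> q * (x + y) / 1" using sx x y q by (intro divide_left_mono) auto
      qed (use a x y q in auto)
      also have "\<dots> \<le> q * (q + q)" using q x y by simp
      finally show ?thesis by (simp add: power2_eq_square)
    qed
    define r where "r = 1 + x + (N\<^sup>2 * (x + y) / P\<^sup>2 + 1) * y"
    have qq: "q \<le> q\<^sup>2" "1 \<le> q\<^sup>2"
      using q mult_left_mono[of 1 q q] one_le_power[of q 2] by (auto simp: power2_eq_square)
    have r_eq: "r = 1 + x + (N\<^sup>2 * (x + y) / P\<^sup>2 * y + y)" unfolding r_def by (simp add: distrib_right)
    have r: "r \<le> 5 * q\<^sup>2" using r_eq l1 q(2,3) qq by linarith
    have "0 \<le> N\<^sup>2 * (x + y) / P\<^sup>2 * y" using x y by simp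
    hence r0: "0 \<le> r" using r_eq x y by linarith
    have rate_eq: "l1_rate d n = 1 / (q * sqrt (y * x))"
    proof -
      have "N powr - (1/4) = 1 / q" unfolding q_def by (rule powr_minus_divide)
      moreover have "(y * x) powr - (1/2) = 1 / sqrt (y * x)"
        using x y by (subst powr_minus_divide) (simp add: powr_half_sqrt)
      ultimately show ?thesis
        unfolding l1_rate_def minus_divide_left[symmetric] by (simp add: N_def x_def y_def)
    qed
    have target: "c * r / P / l1_rate d n = c * (r * (q * sqrt (y * x) / P))"
      unfolding rate_eq by simp
    have "q ^ 3 * sqrt (y * x) / P \<le> sqrt (a n)"
    proof (rule real_le_rsqrt)
      have "(q ^ 3 * sqrt (y * x) / P)\<^sup>2 = q ^ 6 * (y * x) / P\<^sup>2"
        using x y by (simp add: power_divide power_mult_distrib power_mult[symmetric])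
      also have "\<dots> = (q ^ 6 * y / P\<^sup>2 * sqrt x) * sqrt x" using x by (simp add: field_simps)
      also have "\<dots> \<le> (q ^ 6 * y / P\<^sup>2 * sqrt x) * q"
        using sx q y by (intro mult_left_mono) auto
      also have "\<dots> = a n" unfolding a by (simp add: field_simps eval_nat_numeral)
      finally show "(q ^ 3 * sqrt (y * x) / P)\<^sup>2 \<le> a n" .
    qed
    moreover have "r * (q * sqrt (y * x) / P) \<le> 5 * q\<^sup>2 * (q * sqrt (y * x) / P)"
      using r q x y P by (intro mult_right_mono) auto
    moreover have "5 * q\<^sup>2 * (q * sqrt (y * x) / P) = 5 * (q ^ 3 * sqrt (y * x) / P)"
      by (simp add: eval_nat_numeral)
    ultimately have "r * (q * sqrt (y * x) / P) \<le> 5 * sqrt (a n)" by linarith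
    hence "c * (r * (q * sqrt (y * x) / P)) \<le> c * (5 * sqrt (a n))" using c by (intro mult_left_mono) auto
    moreover have "0 \<le> c * (r * (q * sqrt (y * x) / P))" using c r0 q x y P by simp
    ultimately have "0 \<le> c * r / P / l1_rate d n \<and> c * r / P / l1_rate d n \<le> 5 * c * sqrt (a n)"
      unfolding target by simp
    thus ?case by (simp add: r_def N_def P_def x_def y_def)
  qed
  show "\<forall>\<^sub>F n in sequentially. 0 \<le> c * net_cost d p n / p n / l1_rate d n"
    "\<forall>\<^sub>F n in sequentially. c * net_cost d p n / p n / l1_rate d n \<le> 5 * c * sqrt (a n)"
    using both by (auto elim: eventually_mono)
qed

lemma Zscale_mult_l1_rate_le:
  assumes "3 \<le> n" "2 \<le> d n"
  shows "sqrt (ln n + ln (d n)) * l1_rate d n \<le> 2 * real n powr (-1/4)"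
proof -
  define x y where "x = ln (real n)" and "y = ln (real (d n))"
  have "1/2 \<le> ln (2::real)" using ln2_ge_two_thirds by simp
  moreover have "ln 2 \<le> x" "ln 2 \<le> y" using assms by (auto simp: x_def y_def)
  ultimately have xy: "1/2 \<le> x" "1/2 \<le> y" by auto
  have "x + y \<le> 2\<^sup>2 * (y * x)"
  proof -
    have "0 \<le> (x - 1/2) * y + (y - 1/2) * x" using xy by (intro add_nonneg_nonneg mult_nonneg_nonneg) auto
    thus ?thesis by (simp add: algebra_simps)
  qed
  hence "sqrt (x + y) \<le> sqrt (2\<^sup>2 * (y * x))" by (rule real_sqrt_le_mono)
  also have "\<dots> = 2 * sqrt (y * x)" by (simp only: real_sqrt_mult real_sqrt_abs)
  finally have "sqrt (x + y) / sqrt (y * x) \<le> 2" using xy by (simp add: divide_simps)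
  hence "(sqrt (x + y) / sqrt (y * x)) * real n powr (-1/4) \<le> 2 * real n powr (-1/4)"
    by (intro mult_right_mono) auto
  moreover have "l1_rate d n = real n powr (-1/4) / sqrt (y * x)"
  proof -
    have "(y * x) powr - (1/2) = 1 / sqrt (y * x)"
      using xy by (subst powr_minus_divide) (simp add: powr_half_sqrt)
    thus ?thesis unfolding l1_rate_def minus_divide_left[symmetric] by (simp add: x_def y_def)
  qed
  ultimately show ?thesis by (simp add: x_def y_def)
qed

text \<open>
  The profile tends to minus infinity at both ends of \<open>(0, \<infinity>)\<close>: the quadratic loss dominates at zero, the
  logarithm at infinity.
\<close>

lemma profile_variance_bounds:
  assumes \<kappa>: "0 < \<kappa>"
  obtains slo shi :: real where "0 < slo"
    "\<And>s. 0 < s \<Longrightarrow> C \<le> - ln (2 * pi * s) / 2 - \<kappa>\<^sup>2 / (4 * s) \<Longrightarrow> slo \<le> s \<and> s \<le> shi"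
proof -
  define h where "h s = - ln (2 * pi * s) / 2 - \<kappa>\<^sup>2 / (4 * s)" for s :: real
  have "filterlim h at_bot (at_right 0)" unfolding h_def using \<kappa> by real_asymp
  hence "\<forall>\<^sub>F s in at_right 0. h s < C" by (simp add: filterlim_at_bot_dense)
  then obtain slo where slo: "0 < slo" "\<And>s. 0 < s \<Longrightarrow> s < slo \<Longrightarrow> h s < C"
    by (auto simp: eventually_at_right_field)
  have "filterlim h at_bot at_top" unfolding h_def using \<kappa> by real_asymp
  hence "\<forall>\<^sub>F s in at_top. h s < C" by (simp add: filterlim_at_bot_dense)
  then obtain shi where shi: "\<And>s. shi \<le> s \<Longrightarrow> h s < C"
    by (auto simp: eventually_at_top_linorder)
  show thesis using that[of slo shi] slo shi unfolding h_def by (meson linorder_not_le less_imp_le)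
qed

lemma power_times_geometric_tendsto_0:
  fixes x :: real
  assumes "0 \<le> x" "x < 1"
  shows "(\<lambda>n. real n ^ k * x ^ n) \<longlonglongrightarrow> 0"
proof (cases "x = 0")
  case True
  have "\<forall>\<^sub>F n in sequentially. real n ^ k * x ^ n = 0"
    using eventually_gt_at_top[of 0] by eventually_elim (simp add: True)
  thus ?thesis by (rule tendsto_eventually)
next
  case False
  define K l where "K = real k" and "l = ln x"
  have l: "l < 0" using assms False by (simp add: l_def)
  have "(\<lambda>n. exp (K * ln (real n) + l * real n)) \<longlonglongrightarrow> 0" using l by real_asymp
  moreover have "\<forall>\<^sub>F n in sequentially. exp (K * ln (real n) + l * real n) = real n ^ k * x ^ n"
    using eventually_gt_at_top[of 0]
  proof eventually_elim
    case (elim n)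
    have "exp (K * ln (real n)) = real n ^ k" using elim by (simp add: K_def exp_of_nat_mult)
    moreover have "exp (l * real n) = x ^ n" using assms False by (simp add: l_def exp_of_nat2_mult)
    ultimately show ?case by (simp add: exp_add)
  qed
  ultimately show ?thesis by (rule Lim_transform_eventually)
qed

section \<open>The penalized maximum likelihood estimator\<close>

locale pen_mle_sequence = null_regime_sequence M Q V d a0 b0 s0 gamma0
  for M :: "nat \<Rightarrow> 'a measure" and Q :: "nat \<Rightarrow> ('q::finite) obs measure"
    and V :: "nat \<Rightarrow> nat \<Rightarrow> 'a \<Rightarrow> 'q obs" and d :: "nat \<Rightarrow> nat"
    and a0 :: "real^'q" and b0 s0 :: real and gamma0 :: "nat \<Rightarrow> nat \<Rightarrow> real" +
  fixes p :: "nat \<Rightarrow> real" and A :: "(real^'q) set" and B :: "real set" and u :: real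
    and \<theta>_hat :: "nat \<Rightarrow> 'a \<Rightarrow> 'q param" and \<gamma>_hat :: "nat \<Rightarrow> 'a \<Rightarrow> nat \<Rightarrow> real"
  assumes penalty_pos: "\<forall>n\<ge>2. 0 < p n"
    and param_bounded: "bounded A" "bounded B" and param_true: "a0 \<in> A" "b0 \<in> B" "0 < u"
    and penalty_rate: "(\<lambda>n. real n powr (7/4) * sqrt (ln (real n)) * ln (real (d n)) / (p n)\<^sup>2) \<longlonglongrightarrow> 0"
    and log_dim: "(\<lambda>n. ln (real (d n)) / real n powr (1/4)) \<longlonglongrightarrow> 0"
    and est: "\<forall>\<^sub>F n in sequentially. AE \<omega> in M n.
        is_pen_mle n (d n) (p n) (param_space A B u) (\<lambda>i. V n i \<omega>) (\<theta>_hat n \<omega>) (\<gamma>_hat n \<omega>)"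
begin

abbreviation \<sigma>2_hat :: "nat \<Rightarrow> 'a \<Rightarrow> real" where "\<sigma>2_hat n \<omega> \<equiv> snd (snd (snd (\<theta>_hat n \<omega>)))"
abbreviation l1_hat :: "nat \<Rightarrow> 'a \<Rightarrow> real" where "l1_hat n \<omega> \<equiv> l1norm (d n) (\<gamma>_hat n \<omega>)"
abbreviation L_n :: "nat \<Rightarrow> 'a \<Rightarrow> 'q param \<Rightarrow> (nat \<Rightarrow> real) \<Rightarrow> real" where
  "L_n n \<omega> \<equiv> log_lik n (d n) a0 b0 (\<lambda>i. V n i \<omega>)"
abbreviation L0_n :: "nat \<Rightarrow> 'a \<Rightarrow> real" where "L0_n n \<omega> \<equiv> log_lik0 n s0 (\<lambda>i. V n i \<omega>)"

lemma whp_estimator: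
  "whp M (\<lambda>n \<omega>. \<theta>_hat n \<omega> \<in> param_space A B u \<and>
    L0_n n \<omega> + p n * l1_hat n \<omega> \<le> L_n n \<omega> (\<theta>_hat n \<omega>) (\<gamma>_hat n \<omega>))"
proof (rule whp_AE)
  show "\<forall>\<^sub>F n in sequentially. AE \<omega> in M n. \<theta>_hat n \<omega> \<in> param_space A B u \<and>
    L0_n n \<omega> + p n * l1_hat n \<omega> \<le> L_n n \<omega> (\<theta>_hat n \<omega>) (\<gamma>_hat n \<omega>)"
    using est eventually_ge_at_top[of 2]
  proof eventually_elim
    case (elim n)
    have m: "regime_model (d n) a0 b0 0 s0 (gamma0 n) (Q n)" using model elim by blast
    have "AE \<omega> in M n. \<forall>i<n. obs_Y (V n i \<omega>) = obs_U (V n i \<omega>) \<bullet> coef a0 b0 + obs_eps (V n i \<omega>)"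
      by (rule iid_sample_AE[OF Q_iid[OF elim(2)] regime_outcome[OF m s0]])
    with elim(1) show ?case
    proof eventually_elim
      case (elim \<omega>)
      thus ?case using pen_mle_likelihood[OF elim(1) param_true(1,2) less_imp_le[OF param_true(3)] s0] by blast
    qed
  qed
qed

text \<open>
  The penalty is nonnegative, so the estimator has at least the true likelihood, which is at least
  \<open>n (- ln (2 \<pi> s0) / 2 - 2)\<close>. The bound for few small residuals then confines the estimated variance to a compact
  interval inside \<open>(0, \<infinity>)\<close>; the other components are bounded by assumption.
\<close>

lemma whp_param_bounds:
  obtains L slo where "0 < slo" "0 < L"
    "whp M (\<lambda>n \<omega>. norm (\<theta>_hat n \<omega>) \<le> L \<and> slo \<le> \<sigma>2_hat n \<omega>)"
proof -
  obtain LA where LA: "\<And>\<alpha>. \<alpha> \<in> A \<Longrightarrow> norm \<alpha> \<le> LA" using param_bounded(1) unfolding bounded_iff by blast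
  obtain LB where LB: "\<And>\<beta>. \<beta> \<in> B \<Longrightarrow> norm \<beta> \<le> LB" using param_bounded(2) unfolding bounded_iff by blast
  define Lc where "Lc = LA + norm a0 + LB + u + \<bar>b0\<bar>"
  obtain \<kappa> where \<kappa>: "0 < \<kappa>"
    "whp M (\<lambda>n \<omega>. \<forall>c. norm c \<le> Lc \<longrightarrow> card (small_resid n (\<lambda>i. V n i \<omega>) \<kappa> c) \<le> n / 4)"
    by (rule whp_few_small_residuals[of Lc]) blast
  obtain slo shi where s: "0 < slo" "\<And>s. 0 < s \<Longrightarrow>
      - ln (2 * pi * s0) / 2 - 2 \<le> - ln (2 * pi * s) / 2 - \<kappa>\<^sup>2 / (4 * s) \<Longrightarrow> slo \<le> s \<and> s \<le> shi"
    by (rule profile_variance_bounds[OF \<kappa>(1), of "- ln (2 * pi * s0) / 2 - 2"]) blast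
  define L where "L = LA + LB + u + \<bar>shi\<bar> + 1"
  have LAB: "0 \<le> LA" "0 \<le> LB" using LA[OF param_true(1)] LB[OF param_true(2)] norm_ge_zero order_trans by blast+
  have "whp M (\<lambda>n \<omega>. norm (\<theta>_hat n \<omega>) \<le> L \<and> slo \<le> \<sigma>2_hat n \<omega>)"
  proof (rule whp_mono[OF whp_conj[OF whp_estimator whp_conj[OF whp_noise_sum \<kappa>(2)]]])
    show "\<forall>\<^sub>F n in sequentially. \<forall>\<omega>. (\<theta>_hat n \<omega> \<in> param_space A B u \<and>
        L0_n n \<omega> + p n * l1_hat n \<omega> \<le> L_n n \<omega> (\<theta>_hat n \<omega>) (\<gamma>_hat n \<omega>)) \<and>
        (\<Sum>i<n. (obs_eps (V n i \<omega>))\<^sup>2) \<le> 4 * s0 * n \<and>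
        (\<forall>c. norm c \<le> Lc \<longrightarrow> card (small_resid n (\<lambda>i. V n i \<omega>) \<kappa> c) \<le> n / 4) \<longrightarrow>
        norm (\<theta>_hat n \<omega>) \<le> L \<and> slo \<le> \<sigma>2_hat n \<omega>"
      using eventually_ge_at_top[of 2]
    proof (eventually_elim, intro allI impI, elim conjE)
      fix n \<omega> assume n: "2 \<le> n" and \<theta>: "\<theta>_hat n \<omega> \<in> param_space A B u"
        and like: "L0_n n \<omega> + p n * l1_hat n \<omega> \<le> L_n n \<omega> (\<theta>_hat n \<omega>) (\<gamma>_hat n \<omega>)"
        and eps: "(\<Sum>i<n. (obs_eps (V n i \<omega>))\<^sup>2) \<le> 4 * s0 * n"
        and few: "\<forall>c. norm c \<le> Lc \<longrightarrow> card (small_resid n (\<lambda>i. V n i \<omega>) \<kappa> c) \<le> n / 4"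
      obtain \<alpha> \<beta> lam \<tau> where th: "\<theta>_hat n \<omega> = (\<alpha>, \<beta>, lam, \<tau>)" by (cases "\<theta>_hat n \<omega>")
      have par: "\<alpha> \<in> A" "\<beta> \<in> B" "0 \<le> lam" "lam \<le> u" "0 < \<tau>"
        using \<theta> by (auto simp: th param_space_def)
      have nrm: "norm \<alpha> \<le> LA" "\<bar>\<beta>\<bar> \<le> LB" using LA[OF par(1)] LB[OF par(2)] by auto
      have "norm (\<alpha> - a0) \<le> norm \<alpha> + norm a0" by (rule norm_triangle_ineq4)
      hence "norm (coef (\<alpha> - a0) (\<beta> + lam - b0)) \<le> Lc" "norm (coef (\<alpha> - a0) (\<beta> - b0)) \<le> Lc"
        using norm_coef_le[of "\<alpha> - a0" "\<beta> + lam - b0"] norm_coef_le[of "\<alpha> - a0" "\<beta> - b0"] nrm par(3,4)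
        unfolding Lc_def by linarith+
      hence "L_n n \<omega> (\<alpha>, \<beta>, lam, \<tau>) (\<gamma>_hat n \<omega>) \<le> n * (- ln (2 * pi * \<tau>) / 2 - \<kappa>\<^sup>2 / (4 * \<tau>))"
        using few \<kappa>(1) by (intro log_lik_le_small_resid[OF par(5)]) auto
      moreover have "0 \<le> p n * l1_hat n \<omega>"
      proof (rule mult_nonneg_nonneg)
        show "0 \<le> p n" using penalty_pos n less_imp_le by blast
      qed (simp add: l1norm_def sum_nonneg)
      moreover have "n * (- ln (2 * pi * s0) / 2 - 2) \<le> L0_n n \<omega>"
        using log_lik0_ge[OF s0 eps] by (simp add: algebra_simps)
      ultimately have "n * (- ln (2 * pi * s0) / 2 - 2) \<le> n * (- ln (2 * pi * \<tau>) / 2 - \<kappa>\<^sup>2 / (4 * \<tau>))"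
        using like th by auto
      hence "- ln (2 * pi * s0) / 2 - 2 \<le> - ln (2 * pi * \<tau>) / 2 - \<kappa>\<^sup>2 / (4 * \<tau>)"
        by (rule mult_left_le_imp_le) (use n in simp)
      hence \<tau>: "slo \<le> \<tau>" "\<tau> \<le> shi" using s(2)[OF par(5)] by auto
      have "norm (\<alpha>, \<beta>, lam, \<tau>) \<le> norm \<alpha> + (norm \<beta> + (norm lam + norm \<tau>))"
        by (meson norm_Pair_le add_left_mono order_trans)
      hence "norm (\<alpha>, \<beta>, lam, \<tau>) \<le> L"
        using nrm par \<tau> unfolding L_def real_norm_def by linarith
      thus "norm (\<theta>_hat n \<omega>) \<le> L \<and> slo \<le> \<sigma>2_hat n \<omega>" using \<tau> by (simp add: th)
    qed
  qed
  thus thesis using that[of slo L] s(1) LAB param_true(3) by (simp add: L_def add_nonneg_pos)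
qed

definition good_sample :: "real \<Rightarrow> nat \<Rightarrow> 'a \<Rightarrow> bool" where
  "good_sample C n \<omega> \<longleftrightarrow> (\<forall>i<n. \<bar>obs_eps (V n i \<omega>)\<bar> \<le> n \<and> norm (obs_U (V n i \<omega>)) \<le> n \<and>
     (\<forall>j<d n. \<bar>obs_Z (V n i \<omega>) j\<bar> \<le> C * Zscale n))"

lemma whp_good_sample:
  obtains C where "0 < C" "whp M (good_sample C)"
proof -
  obtain C where C: "0 < C" "whp M (\<lambda>n \<omega>. \<forall>i<n. \<forall>j<d n. \<bar>obs_Z (V n i \<omega>) j\<bar> \<le> C * Zscale n)"
    by (rule whp_Z_bound)
  have "whp M (good_sample C)"
  proof (rule whp_mono[OF whp_conj[OF whp_noise_sum whp_conj[OF whp_U_bound C(2)]]])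
    have "\<forall>\<^sub>F n in sequentially. 4 * s0 * real n \<le> (real n)\<^sup>2" using s0 by real_asymp
    thus "\<forall>\<^sub>F n in sequentially. \<forall>\<omega>. (\<Sum>i<n. (obs_eps (V n i \<omega>))\<^sup>2) \<le> 4 * s0 * n \<and>
        (\<forall>i<n. norm (obs_U (V n i \<omega>)) \<le> n) \<and>
        (\<forall>i<n. \<forall>j<d n. \<bar>obs_Z (V n i \<omega>) j\<bar> \<le> C * Zscale n) \<longrightarrow> good_sample C n \<omega>"
    proof (eventually_elim, intro allI impI, elim conjE)
      fix n \<omega> assume n: "4 * s0 * real n \<le> (real n)\<^sup>2" and sum: "(\<Sum>i<n. (obs_eps (V n i \<omega>))\<^sup>2) \<le> 4 * s0 * n"
        and rest: "\<forall>i<n. norm (obs_U (V n i \<omega>)) \<le> n" "\<forall>i<n. \<forall>j<d n. \<bar>obs_Z (V n i \<omega>) j\<bar> \<le> C * Zscale n"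
      have "\<bar>obs_eps (V n i \<omega>)\<bar> \<le> n" if "i < n" for i
      proof -
        have "(obs_eps (V n i \<omega>))\<^sup>2 \<le> (\<Sum>i<n. (obs_eps (V n i \<omega>))\<^sup>2)"
          using that by (intro member_le_sum) auto
        hence "\<bar>obs_eps (V n i \<omega>)\<bar>\<^sup>2 \<le> (real n)\<^sup>2" using sum n by simp
        thus ?thesis by (rule power2_le_imp_le) simp
      qed
      thus "good_sample C n \<omega>" using rest unfolding good_sample_def by blast
    qed
  qed
  thus thesis using C(1) that by blast
qed

text \<open>
  Net points may leave the parameter space, in particular their \<open>\<lambda>\<close> may be negative: only a positive variance
  matters for the likelihood ratio to have mean one. The slack \<open>L + 1\<close> and \<open>slo / 2\<close> absorbs the mesh.
\<close>

lemma theta_net: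
  fixes L slo :: real
  assumes L: "0 < L" and slo: "0 < slo"
  obtains S :: "nat \<Rightarrow> 'q param set" where
    "\<And>n. finite (S n)" "\<And>n t. t \<in> S n \<Longrightarrow> norm t \<le> L + 1 \<and> slo / 2 \<le> sigma2 t"
    "\<forall>\<^sub>F n in sequentially. real (card (S n)) \<le> real n ^ (4 * DIM('q param))"
    "\<forall>\<^sub>F n in sequentially. \<forall>\<theta>. norm \<theta> \<le> L \<and> slo \<le> sigma2 \<theta> \<longrightarrow>
        (\<exists>t\<in>S n. dist \<theta> t \<le> 1 / real n ^ 3)"
proof -
  define D where "D = real DIM('q param)"
  have D: "1 \<le> D" unfolding D_def by (simp add: DIM_positive Suc_leI)
  have "\<exists>T :: 'q param set. 1 \<le> n \<longrightarrow> finite T \<and> real (card T) \<le> (2 * L * D * real n ^ 3 + 3) ^ DIM('q param) \<and>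
      (\<forall>x. norm x \<le> L \<longrightarrow> (\<exists>t\<in>T. dist x t \<le> 1 / real n ^ 3))" for n
  proof (cases "1 \<le> n")
    case True
    hence pos: "0 \<le> L" "0 < 1 / (D * real n ^ 3)" using L D by auto
    obtain T :: "'q param set" where T: "finite T"
      "real (card T) \<le> (2 * L / (1 / (D * real n ^ 3)) + 3) ^ DIM('q param)"
      "\<And>x. norm x \<le> L \<Longrightarrow> \<exists>t\<in>T. dist x t \<le> DIM('q param) * (1 / (D * real n ^ 3))"
      using finite_grid_cover[where 'a = "'q param", OF pos] by blast
    have "DIM('q param) * (1 / (D * real n ^ 3)) = 1 / real n ^ 3" using D unfolding D_def[symmetric] by simp
    hence "\<forall>x. norm x \<le> L \<longrightarrow> (\<exists>t\<in>T. dist x t \<le> 1 / real n ^ 3)" using T(3) by simp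
    moreover have "2 * L / (1 / (D * real n ^ 3)) = 2 * L * D * real n ^ 3" by simp
    ultimately show ?thesis using T(1,2) by (metis (no_types, lifting))
  qed simp
  then obtain T :: "nat \<Rightarrow> 'q param set" where T: "\<And>n. 1 \<le> n \<Longrightarrow> finite (T n)"
    "\<And>n. 1 \<le> n \<Longrightarrow> real (card (T n)) \<le> (2 * L * D * real n ^ 3 + 3) ^ DIM('q param)"
    "\<And>n x. 1 \<le> n \<Longrightarrow> norm x \<le> L \<Longrightarrow> \<exists>t\<in>T n. dist x t \<le> 1 / real n ^ 3"
    by metis
  define S where "S n = (if 1 \<le> n then {t \<in> T n. norm t \<le> L + 1 \<and> slo / 2 \<le> sigma2 t} else {})" for n
  show thesis
  proof
    show "finite (S n)" for n using T(1) by (simp add: S_def)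
    show "norm t \<le> L + 1 \<and> slo / 2 \<le> sigma2 t" if "t \<in> S n" for n t
      using that by (simp add: S_def split: if_splits)
    have "\<forall>\<^sub>F n in sequentially. 2 * L * D * real n ^ 3 + 3 \<le> real n ^ 4" using L D by real_asymp
    thus "\<forall>\<^sub>F n in sequentially. real (card (S n)) \<le> real n ^ (4 * DIM('q param))"
      using eventually_ge_at_top[of 1]
    proof eventually_elim
      case (elim n)
      have "card (S n) \<le> card (T n)" using T(1)[OF elim(2)] elim(2) unfolding S_def by (auto intro!: card_mono)
      hence "real (card (S n)) \<le> (2 * L * D * real n ^ 3 + 3) ^ DIM('q param)" using T(2)[OF elim(2)] by linarith
      also have "\<dots> \<le> (real n ^ 4) ^ DIM('q param)" using elim(1) L D by (intro power_mono) auto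
      finally show ?case by (simp only: power_mult)
    qed
    have "\<forall>\<^sub>F n in sequentially. 1 / real n ^ 3 \<le> min 1 (slo / 2)"
    proof -
      have "\<forall>\<^sub>F n in sequentially. 1 / real n ^ 3 \<le> 1" by real_asymp
      moreover have "\<forall>\<^sub>F n in sequentially. 1 / real n ^ 3 \<le> slo / 2" using slo by real_asymp
      ultimately show ?thesis by eventually_elim simp
    qed
    thus "\<forall>\<^sub>F n in sequentially. \<forall>\<theta>. norm \<theta> \<le> L \<and> slo \<le> sigma2 \<theta> \<longrightarrow>
        (\<exists>t\<in>S n. dist \<theta> t \<le> 1 / real n ^ 3)"
      using eventually_ge_at_top[of 1]
    proof (eventually_elim, intro allI impI, elim conjE)
      fix n and \<theta> :: "'q param" assume small: "1 / real n ^ 3 \<le> min 1 (slo / 2)" and n: "1 \<le> n"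
        and \<theta>: "norm \<theta> \<le> L" "slo \<le> sigma2 \<theta>"
      obtain t where t: "t \<in> T n" "dist \<theta> t \<le> 1 / real n ^ 3" using T(3)[OF n \<theta>(1)] by blast
      have "norm t \<le> norm \<theta> + dist \<theta> t" by (metis dist_commute dist_norm norm_triangle_sub)
      hence "norm t \<le> L + 1" using t(2) small \<theta>(1) by linarith
      moreover have "\<bar>sigma2 \<theta> - sigma2 t\<bar> \<le> 1 / real n ^ 3"
        using t(2) param_dist_components(4) by (metis prod.collapse)
      hence "slo / 2 \<le> sigma2 t" using small \<theta>(2) by linarith
      ultimately have "t \<in> S n" using t(1) n by (simp add: S_def)
      thus "\<exists>t\<in>S n. dist \<theta> t \<le> 1 / real n ^ 3" using t(2) by blast
    qed
  qed
qed

text \<open>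
  The least \<open>m > 0\<close>, up to rounding, for which the approximation error \<open>n R C Zscale / \<surd>m\<close> is at most \<open>p R / 2\<close>.
\<close>

definition sparsity :: "real \<Rightarrow> nat \<Rightarrow> nat" where
  "sparsity C n = nat \<lceil>(2 * real n * (C * Zscale n) / p n)\<^sup>2\<rceil> + 1"

text \<open>
  The radius of the \<open>l\<^sub>1\<close>-ball runs through the multiples \<open>r / p\<close>, because the approximation error has to be
  proportional to the actual norm of the coefficient vector and not to an a priori bound on it. The net has at most
  \<open>n\<^sup>k\<^sup>+\<^sup>2 (3 d)\<^sup>m\<close> points, and one more factor \<open>n\<close> in the threshold makes the failure probability \<open>1 / n\<close>.
\<close>

lemma whp_net_likelihood:
  fixes S :: "nat \<Rightarrow> 'q param set" and m :: "nat \<Rightarrow> nat"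
  assumes S: "\<And>n. finite (S n)" "\<And>n t. t \<in> S n \<Longrightarrow> 0 < sigma2 t"
    and card: "\<forall>\<^sub>F n in sequentially. real (card (S n)) \<le> real n ^ k"
  shows "whp M (\<lambda>n \<omega>. \<forall>t\<in>S n. \<forall>g\<in>signed_sums (d n) (m n). \<forall>r\<in>{1..n\<^sup>2}.
    L_n n \<omega> t (\<lambda>j. real r / p n / m n * g j)
      \<le> L0_n n \<omega> + 2 * ((real k + 3) * ln n + m n * ln (3 * d n)))"
proof (rule whpI)
  define I where "I n = S n \<times> signed_sums (d n) (m n) \<times> {1..n\<^sup>2}" for n
  define g where "g n = (\<lambda>(t, h, r). root_lr (d n) a0 b0 s0 t (\<lambda>j. real r / p n / m n * h j))" for n
  define N where "N n = real n ^ (k + 3) * (3 * real (d n)) ^ m n" for n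
  define E where "E n = {\<omega> \<in> space (M n). \<exists>\<nu>\<in>I n. N n \<le> (\<Prod>i<n. g n \<nu> (V n i \<omega>))}" for n
  show "\<forall>\<^sub>F n in sequentially. E n \<in> sets (M n) \<and> measure (M n) (E n) \<le> 1 / real n \<and>
      (AE \<omega> in M n. \<omega> \<notin> E n \<longrightarrow> (\<forall>t\<in>S n. \<forall>g\<in>signed_sums (d n) (m n). \<forall>r\<in>{1..n\<^sup>2}.
        L_n n \<omega> t (\<lambda>j. real r / p n / m n * g j)
          \<le> L0_n n \<omega> + 2 * ((real k + 3) * ln n + m n * ln (3 * d n))))"
    using card eventually_ge_at_top[of 2]
  proof eventually_elim
    case (elim n)
    have d2: "2 \<le> d n" using dim elim by blast
    have model_n: "regime_model (d n) a0 b0 0 s0 (gamma0 n) (Q n)" using model elim by blast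
    have Npos: "0 < N n" using elim d2 by (simp add: N_def)
    have fin: "finite (I n)" unfolding I_def using S(1) finite_signed_sums by auto
    have g_meas: "g n \<nu> \<in> borel_measurable (Q n)" for \<nu>
      by (rule Q_measurable[OF elim(2)]) (simp add: g_def split: prod.split)
    have g_nonneg: "0 \<le> g n \<nu> v" if "\<nu> \<in> I n" for \<nu> v
    proof -
      obtain t h r where \<nu>: "\<nu> = (t, h, r)" by (cases \<nu>)
      hence "t \<in> S n" using that by (simp add: I_def)
      thus ?thesis unfolding g_def \<nu> prod.case by (intro root_lr_nonneg[OF s0] S(2))
    qed
    have g_int: "(\<integral>\<^sup>+v. ennreal (g n \<nu> v) \<partial>Q n) \<le> ennreal 1" if "\<nu> \<in> I n" for \<nu>
      using that S(2) nn_integral_root_lr_le_1[OF model_n s0] by (auto simp: g_def I_def)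
    have "real (card (I n)) = real (card (S n)) * (real (card (signed_sums (d n) (m n))) * (real n)\<^sup>2)"
      unfolding I_def by (simp add: card_cartesian_product)
    also have "\<dots> \<le> real n ^ k * ((3 * real (d n)) ^ m n * (real n)\<^sup>2)"
    proof (intro mult_mono)
      show "real (card (signed_sums (d n) (m n))) \<le> (3 * real (d n)) ^ m n"
        using card_signed_sums[of "d n" "m n"] by (metis of_nat_le_iff of_nat_mult of_nat_numeral of_nat_power)
    qed (use elim in auto)
    also have "\<dots> = N n / n" using elim(2) by (simp add: N_def power_add eval_nat_numeral)
    finally have cardI: "real (card (I n)) / N n \<le> 1 / n" using Npos elim(2) by (simp add: divide_simps mult.commute)
    note tail = iid_product_tail[where g = "g n", OF Q_iid[OF elim(2)] fin g_meas g_nonneg g_int zero_le_one Npos, folded E_def]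
    have 1: "E n \<in> sets (M n)" using tail(1) by blast
    have "measure (M n) (E n) \<le> real (card (I n)) * 1 ^ n / N n" using tail(2) by blast
    hence 2: "measure (M n) (E n) \<le> 1 / n" using cardI by simp
    have "L_n n \<omega> t (\<lambda>j. real r / p n / m n * h j) \<le> L0_n n \<omega> + 2 * ((real k + 3) * ln n + m n * ln (3 * d n))"
      if \<omega>: "\<omega> \<in> space (M n)" "\<omega> \<notin> E n" and i: "t \<in> S n" "h \<in> signed_sums (d n) (m n)" "r \<in> {1..n\<^sup>2}" for \<omega> t h r
    proof -
      let ?\<gamma> = "\<lambda>j. real r / p n / m n * h j"
      have "(\<Prod>i<n. root_lr (d n) a0 b0 s0 t ?\<gamma> (V n i \<omega>)) < N n"
      proof -
        have "(t, h, r) \<in> I n" using i by (simp add: I_def)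
        hence "(\<Prod>i<n. g n (t, h, r) (V n i \<omega>)) < N n" using \<omega> unfolding E_def by (simp add: not_le[symmetric])
        thus ?thesis by (simp add: g_def)
      qed
      moreover have "0 < (\<Prod>i<n. root_lr (d n) a0 b0 s0 t ?\<gamma> (V n i \<omega>))"
        using root_lr_pos[OF s0 S(2)[OF i(1)]] by (intro prod_pos) auto
      ultimately have "ln (\<Prod>i<n. root_lr (d n) a0 b0 s0 t ?\<gamma> (V n i \<omega>)) \<le> ln (N n)" using Npos by simp
      also have "\<dots> = (real k + 3) * ln n + m n * ln (3 * d n)"
        using elim(2) d2 by (simp add: N_def ln_mult ln_realpow distrib_left)
      finally show ?thesis using log_lik_eq_log_lik0_add[OF s0 S(2)[OF i(1)]] by simp
    qed
    thus ?case using 1 2 by (intro conjI AE_I2) auto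
  qed
  show "(\<lambda>n. 1 / real n) \<longlonglongrightarrow> 0" by real_asymp
qed

text \<open>
  Let \<open>R = p \<parallel>\<gamma>\<parallel>\<^sub>1\<close> at the estimator. Moving \<open>\<theta>\<close> to the grid costs a constant, moving \<open>\<gamma>\<close> to the net costs at most
  \<open>(R + 1) / 2\<close>, and at net points the log-likelihood exceeds the true one by at most a multiple of the net cost. Since
  the basic inequality makes the total excess at least \<open>R\<close>, half of \<open>R\<close> is bounded by the net cost.
\<close>

lemma whp_l1_bound:
  obtains c where "0 < c" "whp M (\<lambda>n \<omega>. p n * l1_hat n \<omega>
    \<le> c * net_cost d p n)"
proof -
  obtain L slo where L: "0 < slo" "0 < L"
    "whp M (\<lambda>n \<omega>. norm (\<theta>_hat n \<omega>) \<le> L \<and> slo \<le> \<sigma>2_hat n \<omega>)"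
    by (rule whp_param_bounds) blast
  obtain C where C: "0 < C" "whp M (good_sample C)" by (rule whp_good_sample)
  obtain S :: "nat \<Rightarrow> 'q param set" where S: "\<And>n. finite (S n)"
    "\<And>n t. t \<in> S n \<Longrightarrow> norm t \<le> L + 1 \<and> slo / 2 \<le> sigma2 t"
    "\<forall>\<^sub>F n in sequentially. real (card (S n)) \<le> real n ^ (4 * DIM('q param))"
    "\<forall>\<^sub>F n in sequentially. \<forall>\<theta>. norm \<theta> \<le> L \<and> slo \<le> sigma2 \<theta> \<longrightarrow>
        (\<exists>t\<in>S n. dist \<theta> t \<le> 1 / real n ^ 3)"
    by (rule theta_net[OF L(2,1)]) blast
  define k where "k = 4 * DIM('q param)"
  define Ct where "Ct = lip_const a0 b0 (L + 1) (slo / 2)"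
  define c1 where "c1 = \<bar>ln (s0 / slo)\<bar> / 2 + 2"
  define m where "m n = sparsity C n" for n
  define c where "c = 4 * (real k + 3) + 12 * (4 * C\<^sup>2 + 2) + 2 * \<bar>Ct\<bar> + 1"
  have S_pos: "0 < sigma2 t" if "t \<in> S n" for n t using S(2)[OF that] L(1) by linarith
  note net = whp_net_likelihood[OF S(1) S_pos S(3)[folded k_def], where m = m]
  have "whp M (\<lambda>n \<omega>. p n * l1_hat n \<omega>
    \<le> c * net_cost d p n)"
  proof (rule whp_mono[OF whp_conj[OF whp_estimator whp_conj[OF whp_noise_sum whp_conj[OF L(3) whp_conj[OF C(2) net]]]]])
    have ev: "\<forall>\<^sub>F n in sequentially. c1 * real n + 1 \<le> (real n)\<^sup>2" by real_asymp
    show "\<forall>\<^sub>F n in sequentially. \<forall>\<omega>. (\<theta>_hat n \<omega> \<in> param_space A B u \<and>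
        L0_n n \<omega> + p n * l1_hat n \<omega> \<le> L_n n \<omega> (\<theta>_hat n \<omega>) (\<gamma>_hat n \<omega>)) \<and>
        (\<Sum>i<n. (obs_eps (V n i \<omega>))\<^sup>2) \<le> 4 * s0 * n \<and>
        (norm (\<theta>_hat n \<omega>) \<le> L \<and> slo \<le> \<sigma>2_hat n \<omega>) \<and> good_sample C n \<omega> \<and>
        (\<forall>t\<in>S n. \<forall>g\<in>signed_sums (d n) (m n). \<forall>r\<in>{1..n\<^sup>2}.
          L_n n \<omega> t (\<lambda>j. real r / p n / m n * g j)
            \<le> L0_n n \<omega> + 2 * ((real k + 3) * ln n + m n * ln (3 * d n))) \<longrightarrow>
        p n * l1_hat n \<omega> \<le> c * net_cost d p n"
      using eventually_ge_at_top[of 2] ev S(4)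
    proof (eventually_elim, intro allI impI, elim conjE)
      fix n \<omega>
      assume n: "2 \<le> n" and c1n: "c1 * real n + 1 \<le> (real n)\<^sup>2"
        and cover: "\<forall>\<theta>. norm \<theta> \<le> L \<and> slo \<le> sigma2 \<theta> \<longrightarrow> (\<exists>t\<in>S n. dist \<theta> t \<le> 1 / real n ^ 3)"
        and like: "L0_n n \<omega> + p n * l1_hat n \<omega> \<le> L_n n \<omega> (\<theta>_hat n \<omega>) (\<gamma>_hat n \<omega>)"
        and eps: "(\<Sum>i<n. (obs_eps (V n i \<omega>))\<^sup>2) \<le> 4 * s0 * n"
        and \<theta>: "norm (\<theta>_hat n \<omega>) \<le> L" "slo \<le> \<sigma>2_hat n \<omega>" and good: "good_sample C n \<omega>"
        and net: "\<forall>t\<in>S n. \<forall>g\<in>signed_sums (d n) (m n). \<forall>r\<in>{1..n\<^sup>2}.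
          L_n n \<omega> t (\<lambda>j. real r / p n / m n * g j)
            \<le> L0_n n \<omega> + 2 * ((real k + 3) * ln n + m n * ln (3 * d n))"
      have d2: "2 \<le> d n" using dim n by blast
      have pn: "0 < p n" using penalty_pos n by blast
      have \<tau>: "0 < \<sigma>2_hat n \<omega>" using \<theta>(2) L(1) by linarith
      define K where "K = C * Zscale n"
      have lnpos: "0 < ln (real n)" "0 < ln (real (d n))" using n d2 by auto
      have K: "0 < K" "K\<^sup>2 = C\<^sup>2 * (ln n + ln (d n))" using C(1) lnpos by (auto simp: K_def Zscale_def power_mult_distrib)
      define R where "R = p n * l1_hat n \<omega>"
      have R0: "0 \<le> R" unfolding R_def using pn by (auto simp: l1norm_def intro!: mult_nonneg_nonneg sum_nonneg)
      have "R \<le> c1 * n"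
      proof -
        have "L0_n n \<omega> + R \<le> - n * ln (2 * pi * \<sigma>2_hat n \<omega>) / 2"
          using like log_lik_le[OF \<tau>, of n "d n" a0 b0 "\<lambda>i. V n i \<omega>" "\<gamma>_hat n \<omega>"] by (simp add: R_def)
        also have "\<dots> \<le> - n * ln (2 * pi * slo) / 2"
          using \<theta>(2) L(1) \<tau> by (auto intro!: divide_right_mono mult_left_mono)
        finally have "R \<le> n * ((ln (2 * pi * s0) - ln (2 * pi * slo)) / 2 + 2)"
          using log_lik0_ge[OF s0 eps] by (simp add: algebra_simps diff_divide_distrib)
        also have "ln (2 * pi * s0) - ln (2 * pi * slo) = ln (s0 / slo)" using s0 L(1) by (simp add: ln_mult ln_div)
        also have "n * (ln (s0 / slo) / 2 + 2) \<le> n * c1" unfolding c1_def by (intro mult_left_mono) auto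
        finally show ?thesis by (simp add: mult.commute)
      qed
      \<comment> \<open>The grid radius \<open>r / p\<close> lies above the norm of \<open>\<gamma>\<close>, by at most \<open>1 / p\<close>; the crude bound \<open>R \<le> c1 n\<close> keeps \<open>r\<close> within \<open>n\<^sup>2\<close>.\<close>
      define r where "r = nat \<lfloor>R\<rfloor> + 1"
      have r: "R \<le> r" "r \<le> R + 1" using R0 by (auto simp: r_def) linarith+
      have "real r \<le> (real n)\<^sup>2" using r(2) \<open>R \<le> c1 * n\<close> c1n by linarith
      hence "real r \<le> real (n\<^sup>2)" by simp
      hence "r \<le> n\<^sup>2" by (simp only: of_nat_le_iff)
      moreover have r1: "1 \<le> r" by (simp add: r_def)
      ultimately have r_in: "r \<in> {1..n\<^sup>2}" by simp
      have R': "0 < real r / p n" "l1_hat n \<omega> \<le> real r / p n"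
        using pn r(1) r1 by (simp_all add: R_def pos_le_divide_eq mult.commute)
      have m0: "0 < m n" by (simp add: m_def sparsity_def)
      obtain t where t: "t \<in> S n" "dist (\<theta>_hat n \<omega>) t \<le> 1 / real n ^ 3" using cover \<theta> by blast
      have Z: "\<bar>obs_Z (V n i \<omega>) j\<bar> \<le> K" if "i < n" "j < d n" for i j
        using good that by (simp add: good_sample_def K_def)
      obtain g where g: "g \<in> signed_sums (d n) (m n)"
        "(\<Sum>i<n. \<bar>dotp (d n) (obs_Z (V n i \<omega>)) (\<gamma>_hat n \<omega>)
            - dotp (d n) (obs_Z (V n i \<omega>)) (\<lambda>j. real r / p n / m n * g j)\<bar>)
          \<le> n * (real r / p n) * K / sqrt (m n)"
        using sparse_approximation[of "d n" "m n" "real r / p n" "\<gamma>_hat n \<omega>" K n "\<lambda>i. obs_Z (V n i \<omega>)"] d2 m0 R' K(1) Z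
        by auto
      let ?\<gamma> = "\<lambda>j. real r / p n / m n * g j"
      have "L_n n \<omega> (\<theta>_hat n \<omega>) (\<gamma>_hat n \<omega>) \<le> L_n n \<omega> (\<theta>_hat n \<omega>) ?\<gamma> + n * (real r / p n) * K / sqrt (m n)"
        using log_lik_coefficient_lipschitz[OF \<tau>, of n "d n" a0 b0 "\<lambda>i. V n i \<omega>" "\<gamma>_hat n \<omega>" ?\<gamma>] g(2) by linarith
      also have "L_n n \<omega> (\<theta>_hat n \<omega>) ?\<gamma> \<le> L_n n \<omega> t ?\<gamma> + Ct"
        unfolding Ct_def using n S(2)[OF t(1)] \<theta> L(1) t(2) good
        by (intro log_lik_param_lipschitz) (auto simp: good_sample_def)
      also have "L_n n \<omega> t ?\<gamma> \<le> L0_n n \<omega> + 2 * ((real k + 3) * ln n + m n * ln (3 * d n))"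
        using net t(1) g(1) r_in by blast
      also have "n * (real r / p n) * K / sqrt (m n) \<le> (R + 1) / 2"
      proof -
        have "(2 * real n * K / p n)\<^sup>2 \<le> m n" unfolding m_def sparsity_def K_def by linarith
        hence "2 * real n * K / p n \<le> sqrt (m n)" by (rule real_le_rsqrt)
        hence "n * K / p n / sqrt (m n) \<le> 1 / 2" using m0 pn by (simp add: divide_simps mult_ac)
        hence "real r * (n * K / p n / sqrt (m n)) \<le> real r * (1 / 2)" by (intro mult_left_mono) auto
        thus ?thesis using r(2) by (simp add: field_simps)
      qed
      finally have "L_n n \<omega> (\<theta>_hat n \<omega>) (\<gamma>_hat n \<omega>)
          \<le> L0_n n \<omega> + 2 * ((real k + 3) * ln n + m n * ln (3 * d n)) + Ct + (R + 1) / 2" by simp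
      moreover have "R \<le> 4 * X + 2 * Ct + 1" if "l \<le> l0 + 2 * X + Ct + (R + 1) / 2" "l0 + R \<le> l" for X l l0
        using that by (simp add: field_simps)
      ultimately have "R \<le> 4 * ((real k + 3) * ln n + m n * ln (3 * d n)) + 2 * Ct + 1"
        using like[folded R_def] by blast
      also have "m n * ln (3 * d n) \<le> (4 * C\<^sup>2 + 2) * ((n\<^sup>2 * (ln n + ln (d n)) / (p n)\<^sup>2 + 1) * (3 * ln (d n)))"
      proof -
        have "ln (3 * d n) = ln 3 + ln (d n)" using d2 by (simp add: ln_mult)
        also have "ln (3::real) \<le> ln (2 ^ 2)" by simp
        also have "ln (2 ^ 2 :: real) = 2 * ln 2" by (subst ln_realpow) auto
        also have "ln 2 \<le> ln (d n)" using d2 by simp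
        finally have l3: "ln (3 * d n) \<le> 3 * ln (d n)" by simp
        define w where "w = n\<^sup>2 * (ln n + ln (d n)) / (p n)\<^sup>2"
        have w0: "0 \<le> w" using lnpos by (simp add: w_def)
        have "(2 * real n * K / p n)\<^sup>2 = 4 * C\<^sup>2 * w"
          by (simp add: power_divide power_mult_distrib K(2) w_def)
        hence "real (m n) \<le> 4 * C\<^sup>2 * w + 2"
          unfolding m_def sparsity_def K_def[symmetric] using w0 by (simp add: K_def[symmetric]) linarith
        also have "\<dots> \<le> (4 * C\<^sup>2 + 2) * (w + 1)" using w0 by (simp add: algebra_simps)
        finally have "m n * ln (3 * d n) \<le> ((4 * C\<^sup>2 + 2) * (w + 1)) * (3 * ln (d n))"
          using l3 w0 d2 by (intro mult_mono) auto
        thus ?thesis by (simp add: w_def mult.assoc)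
      qed
      finally have Rle: "R \<le> 4 * (real k + 3) * ln n + 12 * (4 * C\<^sup>2 + 2) * ((n\<^sup>2 * (ln n + ln (d n)) / (p n)\<^sup>2 + 1) * ln (d n))
          + (2 * \<bar>Ct\<bar> + 1)" by (simp add: algebra_simps)
      define W where "W = (n\<^sup>2 * (ln n + ln (d n)) / (p n)\<^sup>2 + 1) * ln (d n)"
      have W0: "0 \<le> W" using lnpos by (simp add: W_def)
      have "4 * (real k + 3) * ln n \<le> c * ln n" "12 * (4 * C\<^sup>2 + 2) * W \<le> c * W" "(2 * \<bar>Ct\<bar> + 1) * 1 \<le> c * 1"
        using lnpos W0 unfolding c_def by (intro mult_right_mono; simp)+
      hence "R \<le> c * (1 + ln n + W)" using Rle[folded W_def] by (simp add: distrib_left)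
      thus "p n * l1_hat n \<omega> \<le> c * net_cost d p n"
        by (simp add: R_def W_def)
    qed
  qed
  moreover have "0 < c" unfolding c_def by (intro add_nonneg_pos add_nonneg_nonneg) auto
  ultimately show thesis using that by blast
qed

lemma whp_l1_small:
  assumes e: "0 < e"
  shows "whp M (\<lambda>n \<omega>. l1_hat n \<omega> \<le> e * l1_rate d n)"
proof -
  obtain c where c: "0 < c" "whp M (\<lambda>n \<omega>. p n * l1_hat n \<omega>
    \<le> c * net_cost d p n)"
    by (rule whp_l1_bound)
  show ?thesis
  proof (rule whp_mono[OF c(2)])
    have "\<forall>\<^sub>F n in sequentially. c * net_cost d p n / p n / l1_rate d n < e"
      by (rule order_tendstoD(2)[OF penalty_rate_tendsto_0[OF dim penalty_pos penalty_rate log_dim less_imp_le[OF c(1)]] e])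
    thus "\<forall>\<^sub>F n in sequentially. \<forall>\<omega>. p n * l1_hat n \<omega>
        \<le> c * net_cost d p n \<longrightarrow> l1_hat n \<omega> \<le> e * l1_rate d n"
      using eventually_ge_at_top[of 2]
    proof eventually_elim
      case (elim n)
      have key: "l \<le> e * w" if "X / q / w < e" "q * l \<le> X" "0 < q" "0 < w" for X l q w :: real
      proof -
        have "X / q < e * w" using that(1,4) by (simp only: pos_divide_less_eq)
        moreover have "l \<le> X / q" using that(2,3) by (simp add: pos_le_divide_eq mult.commute)
        ultimately show ?thesis by linarith
      qed
      have "2 \<le> d n" using dim elim(2) by blast
      hence "0 < l1_rate d n" using elim(2) by (simp add: l1_rate_def)
      moreover have "0 < p n" using penalty_pos elim(2) by blast
      ultimately show ?case using key[OF elim(1)] by blast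
    qed
  qed
qed

text \<open>
  If the estimator were farther than \<open>e\<close> from \<open>\<theta>\<^sub>0\<close>, the neighbouring grid point \<open>t\<close> would be at distance at least
  \<open>e / 2\<close>. By the rate of \<open>\<gamma>\<close>, replacing \<open>\<gamma>\<close> by zero costs only \<open>O(n\<^sup>3\<^sup>/\<^sup>4)\<close>, so the log-likelihood of \<open>(t, 0)\<close> would be within
  \<open>o(n)\<close> of the true one, while the affinity gap puts it below by a positive multiple of \<open>n\<close>.
\<close>

lemma whp_theta_near:
  assumes e: "0 < e"
  shows "whp M (\<lambda>n \<omega>. dist (\<theta>_hat n \<omega>) (a0, b0, 0, s0) \<le> e)"
proof -
  obtain L slo where L: "0 < slo" "0 < L"
    "whp M (\<lambda>n \<omega>. norm (\<theta>_hat n \<omega>) \<le> L \<and> slo \<le> \<sigma>2_hat n \<omega>)"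
    by (rule whp_param_bounds) blast
  obtain C where C: "0 < C" "whp M (good_sample C)" by (rule whp_good_sample)
  obtain S :: "nat \<Rightarrow> 'q param set" where S: "\<And>n. finite (S n)"
    "\<And>n t. t \<in> S n \<Longrightarrow> norm t \<le> L + 1 \<and> slo / 2 \<le> sigma2 t"
    "\<forall>\<^sub>F n in sequentially. real (card (S n)) \<le> real n ^ (4 * DIM('q param))"
    "\<forall>\<^sub>F n in sequentially. \<forall>\<theta>. norm \<theta> \<le> L \<and> slo \<le> sigma2 \<theta> \<longrightarrow>
        (\<exists>t\<in>S n. dist \<theta> t \<le> 1 / real n ^ 3)"
    by (rule theta_net[OF L(2,1)]) blast
  define k where "k = 4 * DIM('q param)"
  define Ct where "Ct = lip_const a0 b0 (L + 1) (slo / 2)"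
  define F where "F = {t :: 'q param. norm t \<le> L + 1 \<and> slo / 2 \<le> sigma2 t \<and> e / 2 \<le> dist t (a0, b0, 0, s0)}"
  have F_pos: "0 < sigma2 t" if "t \<in> F" for t using that L(1) by (auto simp: F_def)
  have "compact F"
  proof -
    have "F = cball 0 (L + 1) \<inter> ({t. slo / 2 \<le> sigma2 t} \<inter> {t. e / 2 \<le> dist t (a0, b0, 0, s0)})"
      by (auto simp: F_def)
    moreover have "closed {t :: 'q param. slo / 2 \<le> sigma2 t}"
      "closed {t :: 'q param. e / 2 \<le> dist t (a0, b0, 0, s0)}"
      by (intro closed_Collect_le continuous_intros)+
    ultimately show ?thesis by (simp only:) (intro compact_Int_closed compact_cball closed_Int)
  qed
  moreover have "(a0, b0, 0, s0) \<notin> F" using e by (simp add: F_def)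
  ultimately obtain \<rho> where \<rho>: "0 \<le> \<rho>" "\<rho> < 1" "\<And>\<theta>. \<theta> \<in> F \<Longrightarrow>
      (\<integral>\<^sup>+u. (\<integral>\<^sup>+e. ennreal (gauss s0 e)
        * ennreal (half_root_lr a0 b0 s0 \<theta> (u, e)) \<partial>lborel) \<partial>PU) \<le> ennreal \<rho>"
    using affinity_gap[OF PU_prob PU_sets s0 PU_nondegenerate, of F] F_pos by blast
  \<comment> \<open>Any rate strictly between \<open>\<rho>\<close> and one leaves geometric decay for the union bound and a linear deficit for the likelihood.\<close>
  define q where "q = (1 + \<rho>) / 2"
  have q: "0 < q" "q < 1" "\<rho> < q" using \<rho> by (auto simp: q_def)
  have far: "whp M (\<lambda>n \<omega>. \<forall>t\<in>S n \<inter> F. L_n n \<omega> t (\<lambda>_. 0) \<le> L0_n n \<omega> + 2 * real n * ln q)"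
  proof (rule whpI)
    define E where "E n = {\<omega> \<in> space (M n). \<exists>t\<in>S n \<inter> F. q ^ n \<le> (\<Prod>i<n. root_lr (d n) a0 b0 s0 t (\<lambda>_. 0) (V n i \<omega>))}" for n
    show "\<forall>\<^sub>F n in sequentially. E n \<in> sets (M n) \<and> measure (M n) (E n) \<le> real n ^ k * (\<rho> / q) ^ n \<and>
        (AE \<omega> in M n. \<omega> \<notin> E n \<longrightarrow> (\<forall>t\<in>S n \<inter> F. L_n n \<omega> t (\<lambda>_. 0) \<le> L0_n n \<omega> + 2 * real n * ln q))"
      using S(3)[folded k_def] eventually_ge_at_top[of 2]
    proof eventually_elim
      case (elim n)
      let ?g = "\<lambda>t. root_lr (d n) a0 b0 s0 t (\<lambda>_. 0)"
      have g_meas: "?g t \<in> borel_measurable (Q n)" for t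
        by (rule Q_measurable[OF elim(2) measurable_root_lr])
      have g_nonneg: "0 \<le> ?g t v" if "t \<in> S n \<inter> F" for t v
        using that F_pos by (intro root_lr_nonneg[OF s0]) auto
      have g_int: "(\<integral>\<^sup>+v. ennreal (?g t v) \<partial>Q n) \<le> ennreal \<rho>" if "t \<in> S n \<inter> F" for t
      proof -
        have "(\<integral>\<^sup>+v. ennreal (?g t v) \<partial>Q n) = (\<integral>\<^sup>+v. ennreal (half_root_lr a0 b0 s0 t (obs_U v, obs_eps v)) \<partial>Q n)"
          by (simp add: root_lr_zero_coefficient)
        also have "\<dots> = (\<integral>\<^sup>+u. (\<integral>\<^sup>+e. ennreal (gauss s0 e)
            * ennreal (half_root_lr a0 b0 s0 t (u, e)) \<partial>lborel) \<partial>PU)"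
          by (rule Q_U_nn_integral[OF elim(2), of "\<lambda>x. ennreal (half_root_lr a0 b0 s0 t x)"]) measurable
        also have "\<dots> \<le> ennreal \<rho>" using \<rho>(3) that by blast
        finally show ?thesis .
      qed
      have fin: "finite (S n \<inter> F)" using S(1) by simp
      have qn: "0 < q ^ n" using q by simp
      note tail = iid_product_tail[where g = ?g, OF Q_iid[OF elim(2)] fin g_meas g_nonneg g_int \<rho>(1) qn, folded E_def]
      have 1: "E n \<in> sets (M n)" using tail(1) by blast
      have "measure (M n) (E n) \<le> real (card (S n \<inter> F)) * \<rho> ^ n / q ^ n" using tail(2) by blast
      also have "\<dots> = real (card (S n \<inter> F)) * (\<rho> / q) ^ n" by (simp add: power_divide)
      also have "\<dots> \<le> real n ^ k * (\<rho> / q) ^ n"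
      proof (rule mult_right_mono)
        have "card (S n \<inter> F) \<le> card (S n)" using S(1) by (intro card_mono) auto
        thus "real (card (S n \<inter> F)) \<le> real n ^ k" using elim(1) by linarith
      qed (use \<rho> q in simp)
      finally have 2: "measure (M n) (E n) \<le> real n ^ k * (\<rho> / q) ^ n" .
      have "L_n n \<omega> t (\<lambda>_. 0) \<le> L0_n n \<omega> + 2 * real n * ln q" if \<omega>: "\<omega> \<in> space (M n)" "\<omega> \<notin> E n" and t: "t \<in> S n \<inter> F" for \<omega> t
      proof -
        have t': "0 < sigma2 t" using t F_pos by blast
        have "(\<Prod>i<n. ?g t (V n i \<omega>)) < q ^ n" using \<omega> t by (force simp: E_def not_le[symmetric])
        moreover have "0 < (\<Prod>i<n. ?g t (V n i \<omega>))"
          using root_lr_pos[OF s0 t'] by (intro prod_pos) auto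
        ultimately have "ln (\<Prod>i<n. ?g t (V n i \<omega>)) \<le> ln (q ^ n)" using qn by simp
        also have "\<dots> = n * ln q" using q by (simp add: ln_realpow)
        finally show ?thesis using log_lik_eq_log_lik0_add[OF s0 t'] by simp
      qed
      thus ?case using 1 2 by (intro conjI AE_I2) auto
    qed
    show "(\<lambda>n. real n ^ k * (\<rho> / q) ^ n) \<longlonglongrightarrow> 0"
      using \<rho> q by (intro power_times_geometric_tendsto_0) auto
  qed
  show ?thesis
  proof (rule whp_mono[OF whp_conj[OF whp_estimator whp_conj[OF L(3) whp_conj[OF C(2)
        whp_conj[OF whp_l1_small[OF zero_less_one] far]]]]])
    have lnq: "ln q < 0" using q by simp
    have ev1: "\<forall>\<^sub>F n in sequentially. 2 * real n * ln q + Ct + 2 * C * real n powr (3/4) < 0"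
      using lnq by real_asymp
    have ev2: "\<forall>\<^sub>F n in sequentially. 1 / real n ^ 3 \<le> e / 2" using e by real_asymp
    show "\<forall>\<^sub>F n in sequentially. \<forall>\<omega>. (\<theta>_hat n \<omega> \<in> param_space A B u \<and>
        L0_n n \<omega> + p n * l1_hat n \<omega> \<le> L_n n \<omega> (\<theta>_hat n \<omega>) (\<gamma>_hat n \<omega>)) \<and>
        (norm (\<theta>_hat n \<omega>) \<le> L \<and> slo \<le> \<sigma>2_hat n \<omega>) \<and> good_sample C n \<omega> \<and>
        l1_hat n \<omega> \<le> 1 * l1_rate d n \<and>
        (\<forall>t\<in>S n \<inter> F. L_n n \<omega> t (\<lambda>_. 0) \<le> L0_n n \<omega> + 2 * real n * ln q) \<longrightarrow>
        dist (\<theta>_hat n \<omega>) (a0, b0, 0, s0) \<le> e"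
      using eventually_ge_at_top[of 3] S(4) ev1 ev2
    proof (eventually_elim, intro allI impI, elim conjE)
      fix n \<omega>
      assume n: "3 \<le> n"
        and cover: "\<forall>\<theta>. norm \<theta> \<le> L \<and> slo \<le> sigma2 \<theta> \<longrightarrow> (\<exists>t\<in>S n. dist \<theta> t \<le> 1 / real n ^ 3)"
        and neg: "2 * real n * ln q + Ct + 2 * C * real n powr (3/4) < 0" and mesh: "1 / real n ^ 3 \<le> e / 2"
        and like: "L0_n n \<omega> + p n * l1_hat n \<omega> \<le> L_n n \<omega> (\<theta>_hat n \<omega>) (\<gamma>_hat n \<omega>)"
        and \<theta>: "norm (\<theta>_hat n \<omega>) \<le> L" "slo \<le> \<sigma>2_hat n \<omega>" and good: "good_sample C n \<omega>"
        and l1: "l1_hat n \<omega> \<le> 1 * l1_rate d n"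
        and far: "\<forall>t\<in>S n \<inter> F. L_n n \<omega> t (\<lambda>_. 0) \<le> L0_n n \<omega> + 2 * real n * ln q"
      have n2: "2 \<le> n" using n by simp
      have d2: "2 \<le> d n" using dim n2 by blast
      have pn: "0 < p n" using penalty_pos n2 by blast
      have \<tau>: "0 < \<sigma>2_hat n \<omega>" using \<theta>(2) L(1) by linarith
      show "dist (\<theta>_hat n \<omega>) (a0, b0, 0, s0) \<le> e"
      proof (rule ccontr)
        assume "\<not> dist (\<theta>_hat n \<omega>) (a0, b0, 0, s0) \<le> e"
        obtain t where t: "t \<in> S n" "dist (\<theta>_hat n \<omega>) t \<le> 1 / real n ^ 3" using cover \<theta> by blast
        have "dist (\<theta>_hat n \<omega>) (a0, b0, 0, s0) \<le> dist (\<theta>_hat n \<omega>) t + dist t (a0, b0, 0, s0)"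
          by (rule dist_triangle)
        hence "e / 2 \<le> dist t (a0, b0, 0, s0)"
          using \<open>\<not> dist (\<theta>_hat n \<omega>) (a0, b0, 0, s0) \<le> e\<close> t(2) mesh by linarith
        hence tF: "t \<in> S n \<inter> F" using t(1) S(2)[OF t(1)] by (simp add: F_def)
        have Z0: "0 \<le> Zscale n" unfolding Zscale_def using n d2 by simp
        have Z: "\<bar>dotp (d n) (obs_Z (V n i \<omega>)) (\<gamma>_hat n \<omega>)\<bar> \<le> 2 * C * real n powr (-1/4)" if "i < n" for i
        proof -
          have "\<bar>dotp (d n) (obs_Z (V n i \<omega>)) (\<gamma>_hat n \<omega>)\<bar> \<le> (C * Zscale n) * l1_hat n \<omega>"
            using good that by (intro abs_dotp_le) (auto simp: good_sample_def)
          also have "\<dots> \<le> (C * Zscale n) * l1_rate d n"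
            using l1 C(1) Z0 by (intro mult_left_mono) auto
          also have "\<dots> = C * (sqrt (ln n + ln (d n)) * l1_rate d n)" by (simp add: Zscale_def)
          also have "\<dots> \<le> C * (2 * real n powr (-1/4))"
            using Zscale_mult_l1_rate_le[where d = d, OF n d2] C(1) by (intro mult_left_mono) auto
          finally show ?thesis by simp
        qed
        have "L0_n n \<omega> \<le> L_n n \<omega> (\<theta>_hat n \<omega>) (\<gamma>_hat n \<omega>)"
        proof -
          have "0 \<le> p n * l1_hat n \<omega>" using pn by (auto simp: l1norm_def intro!: mult_nonneg_nonneg sum_nonneg)
          thus ?thesis using like by linarith
        qed
        also have "\<dots> \<le> L_n n \<omega> (\<theta>_hat n \<omega>) (\<lambda>_. 0)
            + (\<Sum>i<n. \<bar>dotp (d n) (obs_Z (V n i \<omega>)) (\<gamma>_hat n \<omega>) - dotp (d n) (obs_Z (V n i \<omega>)) (\<lambda>_. 0)\<bar>)"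
          by (rule log_lik_coefficient_lipschitz[OF \<tau>])
        also have "(\<Sum>i<n. \<bar>dotp (d n) (obs_Z (V n i \<omega>)) (\<gamma>_hat n \<omega>) - dotp (d n) (obs_Z (V n i \<omega>)) (\<lambda>_. 0)\<bar>)
            \<le> (\<Sum>i<n. 2 * C * real n powr (-1/4))"
          using Z by (intro sum_mono) (simp add: dotp_def)
        also have "(\<Sum>i<n. 2 * C * real n powr (-1/4)) = 2 * C * real n powr (3/4)"
        proof -
          have "real n * real n powr (-1/4) = real n powr 1 * real n powr (-1/4)" using n by simp
          also have "\<dots> = real n powr (3/4)" by (subst powr_add[symmetric]) simp
          finally show ?thesis by (simp add: mult_ac)
        qed
        also have "L_n n \<omega> (\<theta>_hat n \<omega>) (\<lambda>_. 0) \<le> L_n n \<omega> t (\<lambda>_. 0) + Ct"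
          unfolding Ct_def using n S(2)[OF t(1)] \<theta> L(1) t(2) good
          by (intro log_lik_param_lipschitz) (auto simp: good_sample_def)
        also have "L_n n \<omega> t (\<lambda>_. 0) \<le> L0_n n \<omega> + 2 * real n * ln q" using far tF by blast
        finally show False using neg by simp
      qed
    qed
  qed
qed

end

theorem proposition1:
  fixes M :: "nat \<Rightarrow> 'a measure"
    and Q :: "nat \<Rightarrow> ('q::finite) obs measure"
    and V :: "nat \<Rightarrow> nat \<Rightarrow> 'a \<Rightarrow> 'q obs"
    and d :: "nat \<Rightarrow> nat"
    and p :: "nat \<Rightarrow> real"
    and alpha0 :: "real^'q" and beta0 lambda0 sigsq0 :: real
    and gamma0 :: "nat \<Rightarrow> nat \<Rightarrow> real"
    and \<Theta>\<^sub>\<alpha> :: "(real^'q) set" and \<Theta>\<^sub>\<beta> :: "real set" and u :: real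
    and \<theta>_hat :: "nat \<Rightarrow> 'a \<Rightarrow> 'q param"
    and \<gamma>_hat :: "nat \<Rightarrow> 'a \<Rightarrow> nat \<Rightarrow> real"
  assumes dim: "\<forall>n\<ge>2. 2 \<le> d n"
    and s0: "0 < sigsq0"
    and model: "\<forall>n\<ge>2. regime_model (d n) alpha0 beta0 lambda0 sigsq0 (gamma0 n) (Q n)"
    and U_law: "\<forall>n\<ge>2. \<forall>m\<ge>2. distr (Q n) borel obs_U = distr (Q m) borel obs_U"
    and sample: "\<forall>n\<ge>2. iid_sample n (M n) (Q n) (V n)"
    and penalty_pos: "\<forall>n\<ge>2. 0 < p n"
    and penalty: "(\<lambda>n. p n / real n) \<longlonglongrightarrow> 0"
    and null: "lambda0 = 0"
    and A1a: "compact \<Theta>\<^sub>\<alpha>" "convex \<Theta>\<^sub>\<alpha>" "compact \<Theta>\<^sub>\<beta>" "convex \<Theta>\<^sub>\<beta>"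
    and A1c: "0 < u"
    and A1e: "(alpha0, beta0) \<in> interior (\<Theta>\<^sub>\<alpha> \<times> \<Theta>\<^sub>\<beta>)"
    and A2a: "\<forall>n\<ge>2. integrable (Q n) (\<lambda>v. norm (obs_U v) ^ 10)"
    and A2b: "\<forall>n\<ge>2. pos_definite (second_moment (Q n) obs_U)"
    and A2c: "\<exists>K>0. \<exists>C>0. \<forall>n\<ge>2. \<forall>j<d n. \<forall>t>0.
        measure (Q n) {v \<in> space (Q n). \<bar>obs_Z v j\<bar> > t} \<le> K * exp (- C * t\<^sup>2)"
    and A2d: "\<exists>B. \<forall>n\<ge>2. AE v in Q n. \<bar>obs_D v\<bar> \<le> B"
        "\<forall>n\<ge>2. 0 < prob_space.variance (Q n) obs_D"
    and A3a: "(\<lambda>n. real n powr (7/4) * sqrt (ln (real n)) * ln (real (d n)) / (p n)\<^sup>2) \<in> o(\<lambda>_. 1)"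
    and A3b: "(\<lambda>n. ln (real (d n))) \<in> o(\<lambda>n. real n powr (1/4))"
    and est_meas: "\<forall>n\<ge>2. \<theta>_hat n \<in> borel_measurable (M n)"
        "\<forall>n\<ge>2. \<gamma>_hat n \<in> measurable (M n) (Rvec_borel (d n))"
    and est: "\<forall>\<^sub>F n in sequentially. AE \<omega> in M n.
        is_pen_mle n (d n) (p n) (param_space \<Theta>\<^sub>\<alpha> \<Theta>\<^sub>\<beta> u) (\<lambda>i. V n i \<omega>) (\<theta>_hat n \<omega>) (\<gamma>_hat n \<omega>)"
  shows "converges_in_prob M \<theta>_hat (alpha0, beta0, lambda0, sigsq0) \<and>
    small_o_p M (\<lambda>n \<omega>. l1norm (d n) (\<gamma>_hat n \<omega>))
      (\<lambda>n. real n powr (-1/4) * (ln (real (d n)) * ln (real n)) powr (-1/2))"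
proof -
  have true_param: "alpha0 \<in> \<Theta>\<^sub>\<alpha>" "beta0 \<in> \<Theta>\<^sub>\<beta>" using A1e interior_subset by blast+
  interpret pen_mle_sequence M Q V d alpha0 beta0 sigsq0 gamma0 p \<Theta>\<^sub>\<alpha> \<Theta>\<^sub>\<beta> u \<theta>_hat \<gamma>_hat
  proof
    show "\<forall>n\<ge>2. regime_model (d n) alpha0 beta0 0 sigsq0 (gamma0 n) (Q n)" using model null by simp
    show "bounded \<Theta>\<^sub>\<alpha>" "bounded \<Theta>\<^sub>\<beta>" using A1a by (auto intro: compact_imp_bounded)
    show "(\<lambda>n. real n powr (7/4) * sqrt (ln (real n)) * ln (real (d n)) / (p n)\<^sup>2) \<longlonglongrightarrow> 0"
      using smalloD_tendsto[OF A3a] by simp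
    show "(\<lambda>n. ln (real (d n)) / real n powr (1/4)) \<longlonglongrightarrow> 0" by (rule smalloD_tendsto[OF A3b])
  qed (fact dim s0 U_law sample A2a A2b A2c penalty_pos true_param A1c est)+
  have prob: "\<forall>\<^sub>F n in sequentially. prob_space (M n)"
    using eventually_ge_at_top[of 2] by eventually_elim (rule M_prob)
  show ?thesis
  proof
    show "converges_in_prob M \<theta>_hat (alpha0, beta0, lambda0, sigsq0)"
      unfolding null by (rule converges_in_prob_if_whp[OF prob whp_theta_near])
    show "small_o_p M (\<lambda>n \<omega>. l1norm (d n) (\<gamma>_hat n \<omega>))
      (\<lambda>n. real n powr (-1/4) * (ln (real (d n)) * ln (real n)) powr (-1/2))"
      unfolding small_o_p_def l1_rate_def[symmetric]
    proof (rule converges_in_prob_if_whp[OF prob])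
      fix e :: real assume e: "0 < e"
      show "whp M (\<lambda>n \<omega>. dist (l1_hat n \<omega> / l1_rate d n) 0 \<le> e)"
      proof (rule whp_mono[OF whp_l1_small[OF e]])
        show "\<forall>\<^sub>F n in sequentially. \<forall>\<omega>. l1_hat n \<omega> \<le> e * l1_rate d n \<longrightarrow> dist (l1_hat n \<omega> / l1_rate d n) 0 \<le> e"
          using eventually_ge_at_top[of 2]
        proof (eventually_elim, intro allI impI)
          fix n \<omega> assume n: "2 \<le> n" and le: "l1_hat n \<omega> \<le> e * l1_rate d n"
          have "2 \<le> d n" using dim n by blast
          hence rate: "0 < l1_rate d n" using n by (simp add: l1_rate_def)
          have "0 \<le> l1_hat n \<omega>" by (simp add: l1norm_def sum_nonneg)
          hence "dist (l1_hat n \<omega> / l1_rate d n) 0 = l1_hat n \<omega> / l1_rate d n" using rate by simp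
          also have "\<dots> \<le> e" using le rate by (simp only: pos_divide_le_eq)
          finally show "dist (l1_hat n \<omega> / l1_rate d n) 0 \<le> e" .
        qed
      qed
    qed
  qed
qed

end
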